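(* Let $\Gamma,\Gamma'$ be atomic graphs, with complexes $K=K(\Gamma)$, $K'=K(\Gamma')$ and flat spaces $\mathcal F=\mathcal F(\Gamma)$, $\mathcal F'=\mathcal F(\Gamma')$, and let $\mathcal F^{(0)}$, $\mathcal F'^{(0)}$ be the sets of standard flats in $K$, $K'$. Any bijection $\mathcal F^{(0)}\to\mathcal F'^{(0)}$ which preserves the relation of intersecting coarsely in a geodesic (two standard flats are so related if and only if their images are) is the restriction of an isometry $\mathcal F\to\mathcal F'$.
   Context: A finite simplicial graph $\Gamma$ is atomic if (1) it is connected and has no vertex of valence $<2$; (2) it contains no cycles of length $<5$; (3) it has no separating closed vertex stars (the closed star of a vertex $v$ is the union of all closed edges containing $v$; it is separating if its complement in $\Gamma$ is disconnected). The right-angled Artin group $G(\Gamma)$ has one generator for each vertex and one commutation relation for each edge of $\Gamma$. $\bar K(\Gamma)$ is its presentation complex: one vertex, one oriented unit-length edge for each vertex of $\Gamma$, one unit Euclidean square glued along the commutator for each edge of $\Gamma$. $K(\Gamma)$ is the universal cover of $\bar K(\Gamma)$, a $\mathrm{CAT}(0)$ square complex. A standard geodesic (resp. standard flat) in $K(\Gamma)$ is a geodesic line (resp. an isometrically embedded $\mathbb{R}^2$) covering the circle (resp. torus) in $\bar K(\Gamma)$ associated with a vertex (resp. edge) of $\Gamma$. Two standard flats $F_1,F_2\subset K$ intersect coarsely in a geodesic if for some $r>0$ the intersection $N_r(F_1)\cap N_r(F_2)$ of their $r$-neighborhoods is at finite Hausdorff distance from a standard geodesic of $K$. The flat space $\mathcal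 F(\Gamma)$ (the modified Deligne complex of Charney–Davis) is the following locally infinite $\mathrm{CAT}(0)$ square complex. Its vertices are of three types: flat vertices, in bijection with the standard flats of $K(\Gamma)$ (this set is denoted $\mathcal F^{(0)}$); singular vertices, in bijection with the standard geodesics of $K(\Gamma)$; cone vertices, in bijection with the vertices of $K(\Gamma)$. For every pair $(p,F)$ with $p$ a vertex of $K(\Gamma)$ and $F$ a standard flat containing $p$ there is one unit Euclidean square whose corners are, in cyclic order, $p,\gamma_1,F,\gamma_2$, where $\gamma_1,\gamma_2$ are the two standard geodesics in $F$ through $p$; squares are glued along common edges. $\mathcal F(\Gamma)$ carries the induced path metric. *)

theory Defs
  imports "HOL-Analysis.Analysis"
begin

section \<open>Square complexes and their intrinsic path metric\<close>

text \<open>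
  All complexes below have the property that every cell has pairwise distinct corners and is
  determined by its set of corners.  So a point of the geometric realization can be encoded by
  its (bi)linear weights on the corners of a cell containing it, and two points of different
  cells get the same weights exactly if they are identified by gluing along common faces.
  A square \<open>(a, b, c, d)\<close> lists its corners in cyclic order.
\<close>

record 'a square_complex =
  cverts :: "'a set"
  cedges :: "('a \<times> 'a) set"
  csquares :: "('a \<times> 'a \<times> 'a \<times> 'a) set"

definition vertex_pt :: "'a \<Rightarrow> 'a \<Rightarrow> real" where
  "vertex_pt a = (\<lambda>x. of_bool (x = a))"

fun edge_pt :: "'a \<times> 'a \<Rightarrow> real \<Rightarrow> 'a \<Rightarrow> real" where
  "edge_pt (a, b) s = (\<lambda>x. (1 - s) * vertex_pt a x + s * vertex_pt b x)"

fun square_pt :: "'a \<times> 'a \<times> 'a \<times> 'a \<Rightarrow> real \<times> real \<Rightarrow> 'a \<Rightarrow> real" where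
  "square_pt (a, b, c, d) (s, t) = (\<lambda>x.
      (1 - s) * (1 - t) * vertex_pt a x + s * (1 - t) * vertex_pt b x
      + s * t * vertex_pt c x + (1 - s) * t * vertex_pt d x)"

definition realization :: "'a square_complex \<Rightarrow> ('a \<Rightarrow> real) set" where
  "realization X = vertex_pt ` cverts X
     \<union> (\<Union>e \<in> cedges X. edge_pt e ` {0..1})
     \<union> (\<Union>q \<in> csquares X. square_pt q ` ({0..1} \<times> {0..1}))"

text \<open>
  \<open>polygonal X x y l\<close>: there is a path of length \<open>l\<close> from \<open>x\<close> to \<open>y\<close> that is a finite
  concatenation of Euclidean segments, each contained in a closed edge or a closed square.
  The infimum of these lengths is the usual intrinsic (path) metric of a polyhedral complex.
  It is only used for connected complexes, so the infimum is over a nonempty set.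
\<close>

inductive polygonal ::
    "'a square_complex \<Rightarrow> ('a \<Rightarrow> real) \<Rightarrow> ('a \<Rightarrow> real) \<Rightarrow> real \<Rightarrow> bool"
  for X where
  const: "x \<in> realization X \<Longrightarrow> polygonal X x x 0"
| along_edge: "\<lbrakk>polygonal X x (edge_pt e s) l; e \<in> cedges X; s \<in> {0..1}; t \<in> {0..1}\<rbrakk>
    \<Longrightarrow> polygonal X x (edge_pt e t) (l + dist s t)"
| along_square: "\<lbrakk>polygonal X x (square_pt q z) l; q \<in> csquares X;
      z \<in> {0..1} \<times> {0..1}; w \<in> {0..1} \<times> {0..1}\<rbrakk>
    \<Longrightarrow> polygonal X x (square_pt q w) (l + dist z w)"

definition path_dist :: "'a square_complex \<Rightarrow> ('a \<Rightarrow> real) \<Rightarrow> ('a \<Rightarrow> real) \<Rightarrow> real" where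
  "path_dist X x y = Inf {l. polygonal X x y l}"

definition isometric_embedding ::
    "'b::metric_space itself \<Rightarrow> 'a square_complex \<Rightarrow> ('b \<Rightarrow> 'a \<Rightarrow> real) \<Rightarrow> bool" where
  "isometric_embedding _ X c \<longleftrightarrow>
     range c \<subseteq> realization X \<and> (\<forall>s t. path_dist X (c s) (c t) = dist s t)"

definition complex_isometry ::
    "'a square_complex \<Rightarrow> 'b square_complex \<Rightarrow> (('a \<Rightarrow> real) \<Rightarrow> ('b \<Rightarrow> real)) \<Rightarrow> bool" where
  "complex_isometry X Y \<phi> \<longleftrightarrow>
     bij_betw \<phi> (realization X) (realization Y) \<and>
     (\<forall>x \<in> realization X. \<forall>y \<in> realization X. path_dist Y (\<phi> x) (\<phi> y) = path_dist X x y)"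

definition nbhd :: "'a square_complex \<Rightarrow> real \<Rightarrow> ('a \<Rightarrow> real) set \<Rightarrow> ('a \<Rightarrow> real) set" where
  "nbhd X r S = {x \<in> realization X. \<exists>y \<in> S. path_dist X x y < r}"

definition finite_Hausdorff_dist ::
    "'a square_complex \<Rightarrow> ('a \<Rightarrow> real) set \<Rightarrow> ('a \<Rightarrow> real) set \<Rightarrow> bool" where
  "finite_Hausdorff_dist X S T \<longleftrightarrow> (\<exists>R. S \<subseteq> nbhd X R T \<and> T \<subseteq> nbhd X R S)"


section \<open>Atomic graphs\<close>

record 'v sgraph =
  gverts :: "'v set"
  gedges :: "'v set set"

definition finite_simplicial_graph :: "'v sgraph \<Rightarrow> bool" where
  "finite_simplicial_graph \<Gamma> \<longleftrightarrow>
     finite (gverts \<Gamma>) \<and> (\<forall>e \<in> gedges \<Gamma>. e \<subseteq> gverts \<Gamma> \<and> card e = 2)"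

definition valence :: "'v sgraph \<Rightarrow> 'v \<Rightarrow> nat" where
  "valence \<Gamma> v = card {e \<in> gedges \<Gamma>. v \<in> e}"

definition is_cycle :: "'v sgraph \<Rightarrow> 'v list \<Rightarrow> bool" where
  "is_cycle \<Gamma> vs \<longleftrightarrow> 3 \<le> length vs \<and> distinct vs \<and> set vs \<subseteq> gverts \<Gamma> \<and>
     (\<forall>i < length vs. {vs ! i, vs ! (Suc i mod length vs)} \<in> gedges \<Gamma>)"

definition closed_edge :: "'v set \<Rightarrow> ('v \<Rightarrow> real) set" where
  "closed_edge e = (\<Union>(a, b) \<in> {(a, b). e = {a, b}}. edge_pt (a, b) ` {0..1})"

text \<open>
  For finite graphs, the product topology on \<open>'v \<Rightarrow> real\<close> induces the usual topology on the
  geometric realization, so connectedness is the library's topological notion.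
\<close>

definition graph_realization :: "'v sgraph \<Rightarrow> ('v \<Rightarrow> real) set" where
  "graph_realization \<Gamma> = vertex_pt ` gverts \<Gamma> \<union> (\<Union>e \<in> gedges \<Gamma>. closed_edge e)"

definition closed_star :: "'v sgraph \<Rightarrow> 'v \<Rightarrow> ('v \<Rightarrow> real) set" where
  "closed_star \<Gamma> v = (\<Union>e \<in> {e \<in> gedges \<Gamma>. v \<in> e}. closed_edge e)"

definition atomic :: "'v sgraph \<Rightarrow> bool" where
  "atomic \<Gamma> \<longleftrightarrow> finite_simplicial_graph \<Gamma> \<and>
     gverts \<Gamma> \<noteq> {} \<and> connected (graph_realization \<Gamma>) \<and>
     (\<forall>v \<in> gverts \<Gamma>. 2 \<le> valence \<Gamma> v) \<and>
     (\<forall>vs. is_cycle \<Gamma> vs \<longrightarrow> 5 \<le> length vs) \<and>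
     (\<forall>v \<in> gverts \<Gamma>. connected (graph_realization \<Gamma> - closed_star \<Gamma> v))"


section \<open>The presentation complex and its universal cover\<close>

text \<open>
  The presentation complex of the right-angled Artin group is realized inside the torus whose
  circle factors are indexed by the vertices of \<open>\<Gamma>\<close>: its vertex is the point \<open>1\<close>, and the circle
  of a vertex \<open>v\<close> and the torus of an edge \<open>e\<close> of \<open>\<Gamma>\<close> are the coordinate subtori of \<open>{v}\<close> and \<open>e\<close>.
\<close>

definition subtorus :: "'v set \<Rightarrow> ('v \<Rightarrow> complex) set" where
  "subtorus S = {y. (\<forall>v. cmod (y v) = 1) \<and> (\<forall>v. v \<notin> S \<longrightarrow> y v = 1)}"

definition presentation_complex :: "'v sgraph \<Rightarrow> ('v \<Rightarrow> complex) set" where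
  "presentation_complex \<Gamma> =
     subtorus {} \<union> (\<Union>v \<in> gverts \<Gamma>. subtorus {v}) \<union> (\<Union>e \<in> gedges \<Gamma>. subtorus e)"

text \<open>
  As the presentation complex has a single vertex, its edge paths are the words in the oriented
  edges \<open>(a, True)\<close> and their reversals \<open>(a, False)\<close>.  Homotopy of edge paths rel endpoints is
  generated by inserting or deleting backtracks and boundaries of squares.  The homotopy classes
  are the elements of the right-angled Artin group, and at the same time the vertices of the
  universal cover (homotopy classes of paths starting at the base point).
\<close>

type_synonym 'v word = "('v \<times> bool) list"

definition edge_paths :: "'v sgraph \<Rightarrow> 'v word set" where
  "edge_paths \<Gamma> = lists (gverts \<Gamma> \<times> UNIV)"

inductive_set edge_homotopy :: "'v sgraph \<Rightarrow> ('v word \<times> 'v word) set"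
  for \<Gamma> where
  refl: "u \<in> edge_paths \<Gamma> \<Longrightarrow> (u, u) \<in> edge_homotopy \<Gamma>"
| sym: "(u, w) \<in> edge_homotopy \<Gamma> \<Longrightarrow> (w, u) \<in> edge_homotopy \<Gamma>"
| trans: "\<lbrakk>(u, v) \<in> edge_homotopy \<Gamma>; (v, w) \<in> edge_homotopy \<Gamma>\<rbrakk> \<Longrightarrow> (u, w) \<in> edge_homotopy \<Gamma>"
| backtrack: "\<lbrakk>u \<in> edge_paths \<Gamma>; w \<in> edge_paths \<Gamma>; a \<in> gverts \<Gamma>\<rbrakk>
    \<Longrightarrow> (u @ [(a, d), (a, \<not> d)] @ w, u @ w) \<in> edge_homotopy \<Gamma>"
| square: "\<lbrakk>u \<in> edge_paths \<Gamma>; w \<in> edge_paths \<Gamma>; a \<in> gverts \<Gamma>; b \<in> gverts \<Gamma>; {a, b} \<in> gedges \<Gamma>\<rbrakk>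
    \<Longrightarrow> (u @ [(a, True), (b, True), (a, False), (b, False)] @ w, u @ w) \<in> edge_homotopy \<Gamma>"

type_synonym 'v kvertex = "'v word set"
type_synonym 'v kpoint = "'v kvertex \<Rightarrow> real"

definition raag :: "'v sgraph \<Rightarrow> 'v kvertex set" where
  "raag \<Gamma> = edge_paths \<Gamma> // edge_homotopy \<Gamma>"

definition step :: "'v sgraph \<Rightarrow> 'v kvertex \<Rightarrow> 'v \<Rightarrow> 'v kvertex" where
  "step \<Gamma> g a = (\<Union>w \<in> g. edge_homotopy \<Gamma> `` {w @ [(a, True)]})"

definition lifted_edge :: "'v sgraph \<Rightarrow> 'v kvertex \<Rightarrow> 'v \<Rightarrow> 'v kvertex \<times> 'v kvertex" where
  "lifted_edge \<Gamma> g a = (g, step \<Gamma> g a)"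

definition lifted_square ::
    "'v sgraph \<Rightarrow> 'v kvertex \<Rightarrow> 'v \<Rightarrow> 'v
      \<Rightarrow> 'v kvertex \<times> 'v kvertex \<times> 'v kvertex \<times> 'v kvertex" where
  "lifted_square \<Gamma> g a b = (g, step \<Gamma> g a, step \<Gamma> (step \<Gamma> g a) b, step \<Gamma> g b)"

definition K_complex :: "'v sgraph \<Rightarrow> 'v kvertex square_complex" where
  "K_complex \<Gamma> = \<lparr>cverts = raag \<Gamma>,
     cedges = {lifted_edge \<Gamma> g a | g a. g \<in> raag \<Gamma> \<and> a \<in> gverts \<Gamma>},
     csquares = {lifted_square \<Gamma> g a b | g a b. g \<in> raag \<Gamma> \<and> {a, b} \<in> gedges \<Gamma>}\<rparr>"

text \<open>The universal covering map, given cell by cell.\<close>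

inductive lies_over :: "'v sgraph \<Rightarrow> 'v kpoint \<Rightarrow> ('v \<Rightarrow> complex) \<Rightarrow> bool"
  for \<Gamma> where
  "g \<in> raag \<Gamma> \<Longrightarrow> lies_over \<Gamma> (vertex_pt g) (\<lambda>_. 1)"
| "\<lbrakk>g \<in> raag \<Gamma>; a \<in> gverts \<Gamma>; s \<in> {0..1}\<rbrakk>
    \<Longrightarrow> lies_over \<Gamma> (edge_pt (lifted_edge \<Gamma> g a) s) ((\<lambda>_. 1)(a := cis (2 * pi * s)))"
| "\<lbrakk>g \<in> raag \<Gamma>; {a, b} \<in> gedges \<Gamma>; s \<in> {0..1}; t \<in> {0..1}\<rbrakk>
    \<Longrightarrow> lies_over \<Gamma> (square_pt (lifted_square \<Gamma> g a b) (s, t))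
          ((\<lambda>_. 1)(a := cis (2 * pi * s), b := cis (2 * pi * t)))"

definition covering_proj :: "'v sgraph \<Rightarrow> 'v kpoint \<Rightarrow> 'v \<Rightarrow> complex" where
  "covering_proj \<Gamma> x = (THE y. lies_over \<Gamma> x y)"

text \<open>
  The covering map is well defined: coordinate \<open>a\<close> of the image of a point is determined by the
  affine extension to cells of the exponent sum of \<open>a\<close>.
\<close>

definition exponent_sum :: "'v \<Rightarrow> 'v word \<Rightarrow> int" where
  "exponent_sum a w = (\<Sum>(b, d) \<leftarrow> w. if b = a then (if d then 1 else -1) else 0)"

lemma edge_homotopy_exponent_sum:
  assumes "(u, w) \<in> edge_homotopy \<Gamma>"
  shows "exponent_sum a u = exponent_sum a w"
  using assms by induction (auto simp: exponent_sum_def)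

lemma edge_homotopy_edge_paths:
  assumes "(u, w) \<in> edge_homotopy \<Gamma>"
  shows "u \<in> edge_paths \<Gamma> \<and> w \<in> edge_paths \<Gamma>"
  using assms by induction (auto simp: edge_paths_def)

lemma equiv_edge_homotopy: "equiv (edge_paths \<Gamma>) (edge_homotopy \<Gamma>)"
  by (rule equivI)
     (auto simp: refl_on_def sym_def trans_def dest: edge_homotopy_edge_paths
       intro: edge_homotopy.intros)

definition class_exponent :: "'v \<Rightarrow> 'v kvertex \<Rightarrow> int" where
  "class_exponent a g = exponent_sum a (SOME w. w \<in> g)"

lemma class_exponent_eq:
  assumes "g \<in> raag \<Gamma>" "w \<in> g"
  shows "class_exponent a g = exponent_sum a w"
proof -
  have "(SOME w. w \<in> g) \<in> g"
    using assms(2) by (rule someI)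
  then have "(SOME w. w \<in> g, w) \<in> edge_homotopy \<Gamma>"
    using assms quotient_eq_iff[OF equiv_edge_homotopy] unfolding raag_def by blast
  then show ?thesis
    unfolding class_exponent_def by (rule edge_homotopy_exponent_sum)
qed

lemma edge_homotopy_append:
  assumes "(u, w) \<in> edge_homotopy \<Gamma>" "v \<in> edge_paths \<Gamma>"
  shows "(u @ v, w @ v) \<in> edge_homotopy \<Gamma>"
  using assms
proof induction
  case (backtrack u w a d)
  then show ?case
    using edge_homotopy.backtrack[of u \<Gamma> "w @ v" a d] by (simp add: edge_paths_def)
next
  case (square u w a b)
  then show ?case
    using edge_homotopy.square[of u \<Gamma> "w @ v" a b] by (simp add: edge_paths_def)
qed (auto simp: edge_paths_def intro: edge_homotopy.intros)

lemma step_class: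
  assumes "g \<in> raag \<Gamma>" "a \<in> gverts \<Gamma>" "w \<in> g"
  shows "step \<Gamma> g a = edge_homotopy \<Gamma> `` {w @ [(a, True)]}"
    and "step \<Gamma> g a \<in> raag \<Gamma>" and "w @ [(a, True)] \<in> step \<Gamma> g a"
proof -
  have a: "[(a, True)] \<in> edge_paths \<Gamma>"
    using assms(2) by (simp add: edge_paths_def)
  have rel: "(u, w) \<in> edge_homotopy \<Gamma>" if "u \<in> g" for u
    using that assms quotient_eq_iff[OF equiv_edge_homotopy] unfolding raag_def by blast
  have "edge_homotopy \<Gamma> `` {u @ [(a, True)]} = edge_homotopy \<Gamma> `` {w @ [(a, True)]}"
    if "u \<in> g" for u
    using edge_homotopy_append[OF rel[OF that] a] by (rule equiv_class_eq[OF equiv_edge_homotopy])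
  then show eq: "step \<Gamma> g a = edge_homotopy \<Gamma> `` {w @ [(a, True)]}"
    using assms(3) unfolding step_def by blast
  have w: "w @ [(a, True)] \<in> edge_paths \<Gamma>"
    using edge_homotopy_edge_paths[OF rel[OF assms(3)]] a by (simp add: edge_paths_def)
  show "step \<Gamma> g a \<in> raag \<Gamma>"
    unfolding eq raag_def using w by (rule quotientI)
  show "w @ [(a, True)] \<in> step \<Gamma> g a"
    unfolding eq using w by (auto intro: edge_homotopy.refl)
qed

lemma class_exponent_step:
  assumes "g \<in> raag \<Gamma>" "a \<in> gverts \<Gamma>"
  shows "step \<Gamma> g a \<in> raag \<Gamma>"
    and "class_exponent b (step \<Gamma> g a) = class_exponent b g + of_bool (b = a)"
proof -
  obtain w where w: "w \<in> g"
    using assms(1) in_quotient_imp_non_empty[OF equiv_edge_homotopy] unfolding raag_def by blast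
  note s = step_class[OF assms w]
  show "step \<Gamma> g a \<in> raag \<Gamma>"
    by (rule s(2))
  show "class_exponent b (step \<Gamma> g a) = class_exponent b g + of_bool (b = a)"
    by (simp add: class_exponent_eq[OF s(2,3)] class_exponent_eq[OF assms(1) w]
        exponent_sum_def)
qed

definition point_exponent :: "'v \<Rightarrow> 'v kpoint \<Rightarrow> real" where
  "point_exponent a x = (\<Sum>g | x g \<noteq> 0. x g * class_exponent a g)"

lemma point_exponent_superset:
  assumes "finite S" "\<And>g. g \<notin> S \<Longrightarrow> x g = 0"
  shows "point_exponent a x = (\<Sum>g \<in> S. x g * class_exponent a g)"
  unfolding point_exponent_def by (rule sum.mono_neutral_left) (use assms in auto)

lemma sum_vertex_pt: "finite S \<Longrightarrow> a \<in> S \<Longrightarrow> (\<Sum>g \<in> S. c * vertex_pt a g * h g) = c * h a"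
  by (simp add: vertex_pt_def of_bool_def if_distrib[of "\<lambda>x. _ * x"]
      if_distrib[of "\<lambda>x. x * _"] sum.delta cong: if_cong)

lemma point_exponent_vertex: "point_exponent a (vertex_pt g) = class_exponent a g"
proof -
  have "point_exponent a (vertex_pt g) = (\<Sum>h \<in> {g}. vertex_pt g h * class_exponent a h)"
    by (rule point_exponent_superset) (auto simp: vertex_pt_def)
  then show ?thesis by (simp add: vertex_pt_def)
qed

lemma point_exponent_edge:
  "point_exponent a (edge_pt (g, h) s) = (1 - s) * class_exponent a g + s * class_exponent a h"
proof -
  have "point_exponent a (edge_pt (g, h) s)
      = (\<Sum>k \<in> {g, h}. edge_pt (g, h) s k * class_exponent a k)"
    by (rule point_exponent_superset) (auto simp: vertex_pt_def)
  then show ?thesis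
    by (simp only: edge_pt.simps distrib_right sum.distrib)
       (simp only: sum_vertex_pt finite.intros insert_iff simp_thms)
qed

lemma point_exponent_square:
  "point_exponent a (square_pt (g, h, k, l) (s, t)) =
     (1 - s) * (1 - t) * class_exponent a g + s * (1 - t) * class_exponent a h
     + s * t * class_exponent a k + (1 - s) * t * class_exponent a l"
proof -
  have "point_exponent a (square_pt (g, h, k, l) (s, t))
      = (\<Sum>m \<in> {g, h, k, l}. square_pt (g, h, k, l) (s, t) m * class_exponent a m)"
    by (rule point_exponent_superset) (auto simp: vertex_pt_def)
  then show ?thesis
    by (simp only: square_pt.simps distrib_right sum.distrib)
       (simp only: sum_vertex_pt finite.intros insert_iff simp_thms)
qed

lemma cis_shift: "cis (2 * pi * (of_int n + s)) = cis (2 * pi * s)"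
  by (simp add: distrib_left cis_mult[symmetric])

lemma lies_over_unique:
  assumes "finite_simplicial_graph \<Gamma>" "lies_over \<Gamma> x y"
  shows "y = (\<lambda>a. cis (2 * pi * point_exponent a x))"
  using assms(2)
proof cases
  case (1 g)
  then show ?thesis using cis_shift[of _ 0] by (simp add: point_exponent_vertex)
next
  case (2 g a s)
  have "point_exponent b x = of_int (class_exponent b g) + s * of_bool (b = a)" for b
    by (simp add: 2 lifted_edge_def point_exponent_edge class_exponent_step
        del: edge_pt.simps) (simp add: algebra_simps)
  then show ?thesis
    using cis_shift[of _ 0] by (auto simp: 2 cis_shift fun_eq_iff)
next
  case (3 g a b s t)
  have ab: "a \<in> gverts \<Gamma>" "b \<in> gverts \<Gamma>" "a \<noteq> b"
    using 3(4) assms(1) by (auto simp: finite_simplicial_graph_def dest: bspec)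
  have "point_exponent c x
      = of_int (class_exponent c g) + (s * of_bool (c = a) + t * of_bool (c = b))" for c
    using 3 ab by (simp add: lifted_square_def point_exponent_square class_exponent_step
        del: square_pt.simps) (simp add: algebra_simps)
  then show ?thesis
    using cis_shift[of _ 0] ab(3) by (auto simp: 3 cis_shift fun_eq_iff)
qed

lemma covering_proj_eqI:
  assumes "finite_simplicial_graph \<Gamma>" "lies_over \<Gamma> x y"
  shows "covering_proj \<Gamma> x = y"
  unfolding covering_proj_def
  using assms lies_over_unique[OF assms(1)] by blast

lemma covering_proj_image:
  assumes "finite_simplicial_graph \<Gamma>"
  shows "covering_proj \<Gamma> ` realization (K_complex \<Gamma>) \<subseteq> presentation_complex \<Gamma>"
proof -
  have "y \<in> presentation_complex \<Gamma>" if "lies_over \<Gamma> x y" for x y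
    using that
  proof cases
    case (1 g)
    then show ?thesis by (simp add: presentation_complex_def subtorus_def)
  next
    case (2 g a s)
    then have "y \<in> subtorus {a}" by (simp add: subtorus_def)
    then show ?thesis using 2 by (auto simp: presentation_complex_def)
  next
    case (3 g a b s t)
    then have "y \<in> subtorus {a, b}" by (simp add: subtorus_def)
    then show ?thesis using 3 by (auto simp: presentation_complex_def)
  qed
  moreover have "\<exists>y. lies_over \<Gamma> x y" if "x \<in> realization (K_complex \<Gamma>)" for x
    using that unfolding realization_def K_complex_def
    by (auto simp del: edge_pt.simps square_pt.simps) (metis atLeastAtMost_iff lies_over.intros)+
  ultimately show ?thesis
    using covering_proj_eqI[OF assms] by (metis image_subsetI)
qed

text \<open>
  An isometric embedding is a homeomorphism onto its image, so the image covers the circle or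
  torus exactly if the composite of the embedding with the covering map is a covering.
\<close>

definition standard_geodesics :: "'v sgraph \<Rightarrow> 'v kpoint set set" where
  "standard_geodesics \<Gamma> = {range c | c v. v \<in> gverts \<Gamma> \<and>
     isometric_embedding TYPE(real) (K_complex \<Gamma>) c \<and>
     covering_space (UNIV :: real set) (covering_proj \<Gamma> \<circ> c) (subtorus {v})}"

definition standard_flats :: "'v sgraph \<Rightarrow> 'v kpoint set set" where
  "standard_flats \<Gamma> = {range c | c e. e \<in> gedges \<Gamma> \<and>
     isometric_embedding TYPE(real \<times> real) (K_complex \<Gamma>) c \<and>
     covering_space (UNIV :: (real \<times> real) set) (covering_proj \<Gamma> \<circ> c) (subtorus e)}"

definition intersect_coarsely_in_geodesic ::
    "'v sgraph \<Rightarrow> 'v kpoint set \<Rightarrow> 'v kpoint set \<Rightarrow> bool" where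
  "intersect_coarsely_in_geodesic \<Gamma> F\<^sub>1 F\<^sub>2 \<longleftrightarrow> (\<exists>r > 0. \<exists>\<gamma> \<in> standard_geodesics \<Gamma>.
     finite_Hausdorff_dist (K_complex \<Gamma>)
       (nbhd (K_complex \<Gamma>) r F\<^sub>1 \<inter> nbhd (K_complex \<Gamma>) r F\<^sub>2) \<gamma>)"


section \<open>The flat space\<close>

datatype 'v flat_space_vertex =
    Cone "'v kvertex"
  | Singular "'v kpoint set"
  | Flat "'v kpoint set"

text \<open>Each square occurs twice, once for either order of its two singular vertices.\<close>

definition flat_space_squares ::
    "'v sgraph \<Rightarrow> ('v flat_space_vertex \<times> 'v flat_space_vertex
      \<times> 'v flat_space_vertex \<times> 'v flat_space_vertex) set" where
  "flat_space_squares \<Gamma> = {(Cone p, Singular \<gamma>\<^sub>1, Flat F, Singular \<gamma>\<^sub>2) | p \<gamma>\<^sub>1 F \<gamma>\<^sub>2.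
     p \<in> raag \<Gamma> \<and> F \<in> standard_flats \<Gamma> \<and> vertex_pt p \<in> F \<and> \<gamma>\<^sub>1 \<noteq> \<gamma>\<^sub>2 \<and>
     (\<forall>\<gamma> \<in> {\<gamma>\<^sub>1, \<gamma>\<^sub>2}. \<gamma> \<in> standard_geodesics \<Gamma> \<and> \<gamma> \<subseteq> F \<and> vertex_pt p \<in> \<gamma>)}"

definition flat_space :: "'v sgraph \<Rightarrow> 'v flat_space_vertex square_complex" where
  "flat_space \<Gamma> = \<lparr>
     cverts = Cone ` raag \<Gamma> \<union> Singular ` standard_geodesics \<Gamma> \<union> Flat ` standard_flats \<Gamma>,
     cedges = (\<Union>(p, x, F, y) \<in> flat_space_squares \<Gamma>. {(p, x), (x, F), (F, y), (y, p)}),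
     csquares = flat_space_squares \<Gamma>\<rparr>"

end

theory Submission
  imports Defs
begin

text \<open>
  The extension graph has the parallel classes of standard geodesics as vertices and the standard
  flats as edges, and two flats intersect coarsely in a geodesic exactly if they are adjacent edges.
  As the extension graph has no triangles, a bijection of flats that preserves this relation is
  induced by an isomorphism of extension graphs.  The parallel sets of two classes \<open>u\<close> and \<open>w\<close> are
  disjoint if and only if some hyperplane separates them.  As no closed star separates an atomic
  graph, this happens if and only if \<open>u\<close> and \<open>w\<close> lie in different components of the complement of
  the star of some class \<open>v\<close>, namely the class of edges dual to such a hyperplane.  Hence
  intersections of parallel sets are visible in the extension graph.  By the Helly property of
  parallel sets, the families of classes through a vertex of \<open>K\<close> are mapped to such families, which
  gives the map on cone vertices.  It respects standard geodesics because \<open>g\<langle>a\<rangle>\<close> is the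
  intersection of the parallel sets of \<open>g\<langle>b\<rangle>\<close> over all neighbours \<open>b\<close> of \<open>a\<close>.
\<close>

section \<open>Words acting on the vertices of the universal cover\<close>

text \<open>The vertices of K are given only as homotopy classes of words, so statements about them
  must come from functions that respect homotopy. Such functions arise by giving each hyperplane an
  integer weight and summing signed weights along a path: opposite sides of a square are dual to the
  same hyperplane, so the sum depends only on the end points. One choice of weights yields the two
  sides of a hyperplane, and with them reduced paths, convexity of cosets, gates and Helly. Another
  yields a coordinate that has slope one on the flats incident to a given parallel class and is
  constant on all other flats; it detects coarse intersections. Distances are bounded from above by
  explicit polygonal paths and from below by functions that are Lipschitz on each cell. A second
  obstacle is that standard flats and geodesics are arbitrary isometric images covering a torus or a
  circle; they have to be identified with the explicit grids g a^m b^n and lines g a^n. After that,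
  incidences are read off vertex sets alone, and the isometry is induced by a bijection of the three
  kinds of vertices.\<close>

locale simplicial_graph =
  fixes \<Gamma> :: "'v sgraph"
  assumes fsg: "finite_simplicial_graph \<Gamma>"
begin

abbreviation "V \<equiv> gverts \<Gamma>"
abbreviation "G \<equiv> raag \<Gamma>"

definition lk :: "'v \<Rightarrow> 'v set" where "lk a = {b. {a, b} \<in> gedges \<Gamma>}"
definition st :: "'v \<Rightarrow> 'v set" where "st a = insert a (lk a)"

definition words :: "'v set \<Rightarrow> 'v word set" where "words S = lists (S \<times> UNIV)"

text \<open>Right multiplication by the group element of \<open>u\<close>: it follows the lift of
  the edge path \<open>u\<close> that starts at \<open>g\<close>. \<open>step\<close> is the case of
  one positive letter.\<close>

definition act :: "'v kvertex \<Rightarrow> 'v word \<Rightarrow> 'v kvertex" where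
  "act g u = (\<Union>w \<in> g. edge_homotopy \<Gamma> `` {w @ u})"

lemma edgeD:
  assumes "{a, b} \<in> gedges \<Gamma>"
  shows "a \<in> V" "b \<in> V" "a \<noteq> b"
  using assms fsg by (auto simp: finite_simplicial_graph_def dest: bspec)

lemma lk_sym: "b \<in> lk a \<longleftrightarrow> a \<in> lk b"
  by (simp add: lk_def insert_commute)

lemma lkD: "b \<in> lk a \<Longrightarrow> a \<in> V" "b \<in> lk a \<Longrightarrow> b \<in> V" "b \<in> lk a \<Longrightarrow> a \<noteq> b"
  unfolding lk_def using edgeD by blast+

lemma lk_subset: "lk a \<subseteq> V"
  using lkD by blast

lemma st_subset: "a \<in> V \<Longrightarrow> st a \<subseteq> V"
  unfolding st_def using lk_subset by blast

lemma words_simps [simp]: "[] \<in> words S" "x # u \<in> words S \<longleftrightarrow> fst x \<in> S \<and> u \<in> words S"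
    "u @ w \<in> words S \<longleftrightarrow> u \<in> words S \<and> w \<in> words S"
  by (auto simp: words_def mem_Times_iff)

lemma words_mono: "S \<subseteq> T \<Longrightarrow> u \<in> words S \<Longrightarrow> u \<in> words T"
  unfolding words_def by (meson lists_mono Sigma_mono subset_iff order_refl)

lemma words_iff: "u \<in> words S \<longleftrightarrow> fst ` set u \<subseteq> S"
  by (auto simp: words_def in_lists_conv_set mem_Times_iff)

lemma edge_paths_words: "edge_paths \<Gamma> = words V"
  by (simp add: edge_paths_def words_def)

lemma raag_cases:
  assumes "g \<in> G"
  obtains w where "w \<in> words V" "g = edge_homotopy \<Gamma> `` {w}"
  using assms unfolding raag_def edge_paths_words by (rule quotientE)

lemma act_class:
  assumes "w \<in> words V" "u \<in> words V"
  shows "act (edge_homotopy \<Gamma> `` {w}) u = edge_homotopy \<Gamma> `` {w @ u}"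
proof -
  have "edge_homotopy \<Gamma> `` {w' @ u} = edge_homotopy \<Gamma> `` {w @ u}"
    if "(w, w') \<in> edge_homotopy \<Gamma>" for w'
    using edge_homotopy_append[OF that] assms edge_paths_words
      equiv_class_eq[OF equiv_edge_homotopy] by metis
  moreover have "(w, w) \<in> edge_homotopy \<Gamma>"
    using assms edge_paths_words edge_homotopy.refl by metis
  ultimately show ?thesis
    unfolding act_def by blast
qed

lemma act_in [simp, intro]: "g \<in> G \<Longrightarrow> u \<in> words V \<Longrightarrow> act g u \<in> G"
  by (erule raag_cases) (simp add: act_class raag_def edge_paths_words quotientI)

lemma act_Nil [simp]: "g \<in> G \<Longrightarrow> act g [] = g"
  by (erule raag_cases) (simp add: act_class)

lemma act_append: "g \<in> G \<Longrightarrow> u \<in> words V \<Longrightarrow> w \<in> words V \<Longrightarrow> act g (u @ w) = act (act g u) w"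
  by (erule raag_cases) (simp add: act_class)

lemma act_Cons: "g \<in> G \<Longrightarrow> fst x \<in> V \<Longrightarrow> w \<in> words V \<Longrightarrow> act g (x # w) = act (act g [x]) w"
  using act_append[of g "[x]" w] by simp

lemma act_homotopic:
  assumes "g \<in> G" "(u, w) \<in> edge_homotopy \<Gamma>"
  shows "act g u = act g w"
proof -
  have left: "(v @ u, v @ w) \<in> edge_homotopy \<Gamma>" if "v \<in> words V" for v
    using assms(2)
  proof induction
    case (backtrack u w a d)
    then show ?case
      using edge_homotopy.backtrack[of "v @ u" \<Gamma> w a d] that by (simp add: edge_paths_words)
  next
    case (square u w a b)
    then show ?case
      using edge_homotopy.square[of "v @ u" \<Gamma> w a b] that by (simp add: edge_paths_words)
  qed (use that in \<open>auto simp: edge_paths_words intro: edge_homotopy.intros\<close>)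
  obtain v where v: "v \<in> words V" "g = edge_homotopy \<Gamma> `` {v}"
    using assms(1) by (rule raag_cases)
  have "u \<in> words V" "w \<in> words V"
    using edge_homotopy_edge_paths[OF assms(2)] by (simp_all add: edge_paths_words)
  then show ?thesis
    using v left[OF v(1)] equiv_class_eq[OF equiv_edge_homotopy] by (simp add: act_class)
qed

lemma act_cancel [simp]: "g \<in> G \<Longrightarrow> a \<in> V \<Longrightarrow> act (act g [(a, d)]) [(a, \<not> d)] = g"
  using act_homotopic[of g "[(a, d), (a, \<not> d)]" "[]"]
    edge_homotopy.backtrack[of "[]" \<Gamma> "[]" a d] act_append[of g "[(a, d)]" "[(a, \<not> d)]"]
  by (simp add: edge_paths_words)

lemma act_cancel' [simp]:
  "g \<in> G \<Longrightarrow> a \<in> V \<Longrightarrow> act (act g [(a, True)]) [(a, False)] = g"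
  "g \<in> G \<Longrightarrow> a \<in> V \<Longrightarrow> act (act g [(a, False)]) [(a, True)] = g"
  using act_cancel[of g a True] act_cancel[of g a False] by simp_all

lemma act_commute1:
  assumes "b \<in> lk a" "g \<in> G"
  shows "act (act g [(a, True)]) [(b, True)] = act (act g [(b, True)]) [(a, True)]"
proof -
  have V: "a \<in> V" "b \<in> V" using assms(1) lkD by blast+
  have "act g [(a, True), (b, True), (a, False), (b, False)] = g"
    using act_homotopic[of g "[(a, True), (b, True), (a, False), (b, False)]" "[]"]
      edge_homotopy.square[of "[]" \<Gamma> "[]" a b] assms V
    by (simp add: edge_paths_words lk_def)
  then have "act (act (act (act g [(a, True)]) [(b, True)]) [(a, False)]) [(b, False)] = g"
    using V assms(2) by (simp add: act_Cons[where w = "_ # _"])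
  then have "act (act g [(b, True)]) [(a, True)]
      = act (act (act (act (act (act g [(a, True)]) [(b, True)]) [(a, False)]) [(b, False)]) [(b, True)]) [(a, True)]"
    by simp
  also have "\<dots> = act (act g [(a, True)]) [(b, True)]"
    using V assms(2) by simp
  finally show ?thesis by simp
qed

text \<open>The defining relation only speaks about two positive letters. The other signs follow by
  moving the base point to the far end of a negative letter and reading the same square from
  there.\<close>

lemma act_commute:
  assumes "b \<in> lk a" "g \<in> G"
  shows "act (act g [(a, d)]) [(b, e)] = act (act g [(b, e)]) [(a, d)]"
proof -
  have V: "a \<in> V" "b \<in> V" using assms(1) lkD by blast+
  have [simp, intro]: "act h [(c, i)] \<in> G" if "h \<in> G" "c \<in> V" for h c i using that by auto
  have TF: "act (act k [(c, True)]) [(i, False)] = act (act k [(i, False)]) [(c, True)]"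
    if "i \<in> lk c" "k \<in> G" for c i k
  proof -
    have i: "i \<in> V" "c \<in> V" using that lkD by blast+
    define k' where "k' = act k [(i, False)]"
    have k': "k' \<in> G" "act k' [(i, True)] = k" using i that by (auto simp: k'_def)
    have "act k' [(c, True)] = act (act (act k' [(c, True)]) [(i, True)]) [(i, False)]"
      using k' i act_cancel'(1) by simp
    then show ?thesis using act_commute1[OF that(1) k'(1)] k' by (simp add: k'_def)
  qed
  have FF: "act (act g [(a, False)]) [(b, False)] = act (act g [(b, False)]) [(a, False)]"
  proof -
    define k where "k = act g [(a, False)]"
    have k: "k \<in> G" "act k [(a, True)] = g" using V assms by (auto simp: k_def)
    have "act k [(b, False)] = act (act (act k [(b, False)]) [(a, True)]) [(a, False)]"
      using k V act_cancel'(1) by simp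
    also have "\<dots> = act (act g [(b, False)]) [(a, False)]"
      using TF[OF assms(1) k(1)] k by simp
    finally show ?thesis by (simp add: k_def)
  qed
  show ?thesis
    using act_commute1[OF assms] TF[OF assms] TF[of a b g] FF assms lk_sym
    by (cases d; cases e) auto
qed

lemma act_commute_word:
  assumes "u \<in> words (lk a)" "g \<in> G" "a \<in> V"
  shows "act (act g [(a, d)]) u = act (act g u) [(a, d)]"
  using assms
proof (induction u arbitrary: g)
  case Nil
  then show ?case by auto
next
  case (Cons x u)
  obtain b e where x: "x = (b, e)" by force
  have b: "b \<in> lk a" "b \<in> V" and u: "u \<in> words (lk a)" "u \<in> words V"
    using Cons.prems x lk_subset words_mono[OF lk_subset] by auto
  have "act (act g [(a, d)]) (x # u) = act (act (act g [(a, d)]) [x]) u"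
    using Cons.prems b u x by (intro act_Cons) auto
  also have "\<dots> = act (act (act g [x]) [(a, d)]) u"
    using act_commute b Cons.prems x by metis
  also have "\<dots> = act (act (act g [x]) u) [(a, d)]"
    using Cons.IH[OF u(1), of "act g [x]"] Cons.prems b x by auto
  finally show ?case
    using act_Cons[of g x u] Cons.prems b u x by simp
qed

definition inv_word :: "'v word \<Rightarrow> 'v word" where
  "inv_word u = rev (map (\<lambda>(a, d). (a, \<not> d)) u)"

lemma inv_word_words [simp]: "inv_word u \<in> words S \<longleftrightarrow> u \<in> words S"
  by (auto simp: inv_word_def words_iff image_image case_prod_unfold)

lemma inv_word_Cons: "inv_word (x # u) = inv_word u @ [(fst x, \<not> snd x)]"
  by (cases x) (simp add: inv_word_def)

lemma act_inv_word: "g \<in> G \<Longrightarrow> u \<in> words V \<Longrightarrow> act (act g u) (inv_word u) = g"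
proof (induction u arbitrary: g)
  case Nil
  then show ?case by (simp add: inv_word_def)
next
  case (Cons x u)
  obtain a d where x: "x = (a, d)" by force
  have "act (act g (x # u)) (inv_word (x # u))
      = act (act (act (act g [x]) u) (inv_word u)) [(a, \<not> d)]"
    using Cons.prems x by (simp add: act_Cons[of g "(a, d)" u] inv_word_Cons act_append)
  then show ?case
    using Cons x by auto
qed

lemma act_transitive:
  assumes "g \<in> G" "h \<in> G"
  obtains u where "u \<in> words V" "act g u = h"
proof -
  obtain v where v: "v \<in> words V" "g = edge_homotopy \<Gamma> `` {v}" using assms(1) by (rule raag_cases)
  obtain w where w: "w \<in> words V" "h = edge_homotopy \<Gamma> `` {w}" using assms(2) by (rule raag_cases)
  define e where "e = edge_homotopy \<Gamma> `` {[]}"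
  have e: "e \<in> G" unfolding e_def raag_def by (simp add: quotientI edge_paths_words)
  have ge: "g = act e v" "h = act e w" using v w by (simp_all add: e_def act_class)
  have "act g (inv_word v @ w) = h"
    using v w e assms(1) ge(2) act_inv_word[OF e v(1)] by (simp add: act_append ge(1))
  then show thesis using that v w by (metis inv_word_words words_simps(3))
qed

section \<open>Cosets of standard subgroups\<close>

text \<open>The left coset of the subgroup generated by \<open>S\<close>. The cases that matter are
  \<open>{a}\<close> (a line), \<open>{a, b}\<close> for an edge (a flat), \<open>st a\<close> (a
  parallel set) and \<open>lk a\<close> (one side of the carrier of a hyperplane).\<close>

definition coset :: "'v set \<Rightarrow> 'v kvertex \<Rightarrow> 'v kvertex set" where
  "coset S g = act g ` words S"

lemma coset_self [simp]: "g \<in> G \<Longrightarrow> g \<in> coset S g"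
  unfolding coset_def by (force intro: image_eqI[where x = "[]"])

lemma coset_act: "u \<in> words S \<Longrightarrow> act g u \<in> coset S g"
  by (auto simp: coset_def)

lemma cosetE:
  assumes "h \<in> coset S g"
  obtains u where "u \<in> words S" "h = act g u"
  using assms by (auto simp: coset_def)

lemma coset_subset: "S \<subseteq> V \<Longrightarrow> g \<in> G \<Longrightarrow> coset S g \<subseteq> G"
  using words_mono by (fastforce simp: coset_def)

lemma coset_mono: "S \<subseteq> T \<Longrightarrow> coset S g \<subseteq> coset T g"
  using words_mono by (fastforce simp: coset_def)

lemma coset_trans:
  assumes "S \<subseteq> V" "g \<in> G" "h \<in> coset S g" "k \<in> coset S h"
  shows "k \<in> coset S g"
proof -
  obtain u w where "u \<in> words S" "h = act g u" "w \<in> words S" "k = act h w"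
    using assms by (auto elim!: cosetE)
  then show ?thesis
    using act_append[of g u w] words_mono[OF assms(1)] assms(2)
    by (metis coset_act words_simps(3))
qed

lemma coset_sym:
  assumes "S \<subseteq> V" "g \<in> G" "h \<in> coset S g"
  shows "g \<in> coset S h"
proof -
  obtain u where u: "u \<in> words S" "h = act g u" using assms by (auto elim!: cosetE)
  then show ?thesis
    using act_inv_word[of g u] words_mono[OF assms(1)] assms(2) by (metis coset_act inv_word_words)
qed

lemma coset_eq:
  assumes "S \<subseteq> V" "g \<in> G" "h \<in> coset S g"
  shows "coset S h = coset S g"
  using coset_trans coset_sym coset_subset assms by (meson subsetI subset_antisym subsetD)

lemma coset_eq_iff:
  assumes "S \<subseteq> V" "g \<in> G" "h \<in> G"
  shows "coset S h = coset S g \<longleftrightarrow> h \<in> coset S g"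
  using coset_eq coset_self assms by metis

section \<open>Hyperplanes\<close>

text \<open>The hyperplane dual to an edge is encoded by the label of the edge and the set of initial
  vertices of all positively oriented edges that are dual to it.\<close>

fun hyp :: "'v kvertex \<Rightarrow> 'v \<times> bool \<Rightarrow> 'v \<times> 'v kvertex set" where
  "hyp g (a, d) = (a, coset (lk a) (if d then g else act g [(a, False)]))"

declare hyp.simps [simp del]

lemma fst_hyp [simp]: "fst (hyp g x) = fst x"
  by (cases x) (simp add: hyp.simps)

lemma hyp_flip: "g \<in> G \<Longrightarrow> a \<in> V \<Longrightarrow> hyp (act g [(a, d)]) (a, \<not> d) = hyp g (a, d)"
  by (cases d) (auto simp: hyp.simps)

text \<open>Letters of \<open>lk a\<close> commute with \<open>a\<close>, so moving along them
  carries an \<open>a\<close>-edge through squares to a parallel edge.\<close>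

lemma hyp_parallel:
  assumes "g \<in> G" "h \<in> coset (lk a) g" "a \<in> V"
  shows "hyp h (a, d) = hyp g (a, d)"
proof -
  obtain u where u: "u \<in> words (lk a)" "h = act g u" using assms(2) by (rule cosetE)
  have "act h [(a, False)] \<in> coset (lk a) (act g [(a, False)])"
    using act_commute_word[OF u(1) assms(1,3), of False] u coset_act[of u] by metis
  then show ?thesis
    using coset_eq[OF lk_subset assms(1,2)] assms coset_eq[OF lk_subset, of "act g [(a, False)]" "act h [(a, False)]"]
    by (cases d) (simp_all add: hyp.simps)
qed

lemma hyp_eq_coset:
  assumes "g \<in> G" "h \<in> G" "a \<in> V" "hyp h (a, d) = hyp g (a, d)"
  shows "h \<in> coset (lk a) g"
proof (cases d)
  case True
  then show ?thesis using assms coset_eq_iff[OF lk_subset, of g h] by (simp add: hyp.simps)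
next
  case False
  then have "act h [(a, False)] \<in> coset (lk a) (act g [(a, False)])"
    using assms coset_eq_iff[OF lk_subset, of "act g [(a, False)]" "act h [(a, False)]"]
    by (simp add: hyp.simps)
  then obtain u where u: "u \<in> words (lk a)" "act h [(a, False)] = act (act g [(a, False)]) u"
    by (auto elim: cosetE)
  then have "act h [(a, False)] = act (act g u) [(a, False)]"
    using act_commute_word assms by simp
  then have "act (act h [(a, False)]) [(a, True)] = act (act (act g u) [(a, False)]) [(a, True)]"
    by simp
  then have "h = act g u"
    using assms words_mono[OF lk_subset u(1)] by simp
  then show ?thesis using u coset_act by simp
qed

section \<open>Potentials: summing integer weights of hyperplanes along paths\<close>

primrec pot_word :: "('v \<times> 'v kvertex set \<Rightarrow> int) \<Rightarrow> 'v kvertex \<Rightarrow> 'v word \<Rightarrow> int" where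
  "pot_word \<omega> g [] = 0"
| "pot_word \<omega> g (x # u) = (if snd x then \<omega> (hyp g x) else - \<omega> (hyp g x)) + pot_word \<omega> (act g [x]) u"

lemma pot_word_append:
  "g \<in> G \<Longrightarrow> u \<in> words V \<Longrightarrow> w \<in> words V \<Longrightarrow>
    pot_word \<omega> g (u @ w) = pot_word \<omega> g u + pot_word \<omega> (act g u) w"
proof (induction u arbitrary: g)
  case (Cons x u)
  then show ?case
    using Cons.IH[of "act g [x]"] act_Cons[of g x u] act_in[of g "[x]"] by simp
qed simp

text \<open>A backtrack crosses one hyperplane in both directions. In a square, opposite sides are
  dual to the same hyperplane and are traversed in opposite directions, so the four contributions
  cancel in pairs.\<close>

lemma pot_word_homotopic:
  assumes "(u, w) \<in> edge_homotopy \<Gamma>" "g \<in> G"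
  shows "pot_word \<omega> g u = pot_word \<omega> g w"
  using assms
proof (induction arbitrary: g)
  case (backtrack u w a d)
  then have u: "u \<in> words V" "w \<in> words V" by (simp_all add: edge_paths_words)
  define h where "h = act g u"
  have h: "h \<in> G" using backtrack u h_def by auto
  show ?case
  proof -
    have "pot_word \<omega> h [(a, d), (a, \<not> d)] = 0"
      using hyp_flip[OF h, of a d] backtrack by (cases d) simp_all
    moreover have "act h [(a, d), (a, \<not> d)] = h"
      using act_append[of h "[(a, d)]" "[(a, \<not> d)]"] h backtrack by simp
    ultimately show ?thesis
      using u h backtrack pot_word_append[OF h, of "[(a, d), (a, \<not> d)]" w \<omega>]
      by (simp add: pot_word_append h_def[symmetric] del: pot_word.simps append_Cons)
  qed
next
  case (square u w a b)
  then have u: "u \<in> words V" "w \<in> words V" by (simp_all add: edge_paths_words)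
  have ab: "b \<in> lk a" "a \<in> lk b" using square by (simp_all add: lk_def insert_commute)
  define h where "h = act g u"
  have h: "h \<in> G" using square u h_def by auto
  let ?v = "[(a, True), (b, True), (a, False), (b, False)]"
  have hg: "act h [(c, d)] \<in> G" if "h \<in> G" "c \<in> V" for h c d using that by auto
  have st: "act (act h [(a, True)]) [(b, True)] = act (act h [(b, True)]) [(a, True)]"
    using act_commute[OF ab(1) h] by simp
  have st2: "act (act (act h [(a, True)]) [(b, True)]) [(a, False)] = act h [(b, True)]"
    unfolding st using hg h square by simp
  have e1: "hyp (act h [(a, True)]) (b, True) = hyp h (b, True)"
    using hyp_parallel[OF h _ square(4)] coset_act[of "[(a, True)]"] ab by simp
  have "hyp (act (act h [(b, True)]) [(a, True)]) (a, False) = hyp (act h [(b, True)]) (a, True)"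
    using hyp_flip[of "act h [(b, True)]" a True] hg[OF h square(4)] square by simp
  also have "\<dots> = hyp h (a, True)"
    using hyp_parallel[OF h _ square(3)] coset_act[of "[(b, True)]"] ab by simp
  finally have e2: "hyp (act (act h [(a, True)]) [(b, True)]) (a, False) = hyp h (a, True)"
    unfolding st .
  have e3: "hyp (act h [(b, True)]) (b, False) = hyp h (b, True)"
    using hyp_flip[OF h, of b True] square by simp
  have v: "act h ?v = h"
    using act_homotopic[OF h, of ?v "[]"] edge_homotopy.square[of "[]" \<Gamma> "[]" a b] square h
    by (simp add: edge_paths_words)
  have "pot_word \<omega> h ?v = 0"
    using e1 e2 e3 st2 by simp
  then show ?case
    using u square h v pot_word_append[OF h, of ?v w \<omega>]
    by (simp add: pot_word_append h_def[symmetric] del: pot_word.simps append_Cons)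
qed auto

text \<open>The potential of the weight \<omega>, normalised to vanish at the class of the empty
  word; homotopy invariance makes the choice of a representative harmless. \<open>height\<close> and
  \<open>slab\<close> are its two instances.\<close>

definition pot :: "('v \<times> 'v kvertex set \<Rightarrow> int) \<Rightarrow> 'v kvertex \<Rightarrow> int" where
  "pot \<omega> g = pot_word \<omega> (edge_homotopy \<Gamma> `` {[]}) (SOME w. w \<in> g)"

lemma pot_step:
  assumes "g \<in> G" "fst x \<in> V"
  shows "pot \<omega> (act g [x]) = pot \<omega> g + (if snd x then \<omega> (hyp g x) else - \<omega> (hyp g x))"
proof -
  define e where "e = edge_homotopy \<Gamma> `` {[]}"
  have e: "e \<in> G" unfolding e_def raag_def by (simp add: quotientI edge_paths_words)
  have *: "pot \<omega> (edge_homotopy \<Gamma> `` {w}) = pot_word \<omega> e w" if "w \<in> words V" for w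
  proof -
    have "(SOME u. u \<in> edge_homotopy \<Gamma> `` {w}) \<in> edge_homotopy \<Gamma> `` {w}"
      by (rule someI[of _ w]) (simp add: that edge_homotopy.refl edge_paths_words)
    then show ?thesis
      unfolding pot_def e_def[symmetric] using pot_word_homotopic[OF _ e] by (metis Image_singleton_iff)
  qed
  obtain w where w: "w \<in> words V" "g = edge_homotopy \<Gamma> `` {w}" using assms(1) by (rule raag_cases)
  then have "act e w = g" by (simp add: e_def act_class)
  then show ?thesis
    using w assms by (simp add: act_class * pot_word_append e)
qed

lemma pot_const:
  assumes "g \<in> G" "u \<in> words S" "S \<subseteq> V" "\<And>h a d. h \<in> coset S g \<Longrightarrow> a \<in> S \<Longrightarrow> \<omega> (hyp h (a, d)) = 0"
  shows "pot \<omega> (act g u) = pot \<omega> g"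
  using assms(1,2,4)
proof (induction u arbitrary: g)
  case (Cons x u)
  obtain a d where x: "x = (a, d)" by force
  have a: "a \<in> S" "a \<in> V" and u: "u \<in> words S" "u \<in> words V" using Cons.prems x assms(3) words_mono by auto
  have g': "act g [x] \<in> G" "act g [x] \<in> coset S g" using Cons.prems a x coset_act by auto
  have "coset S (act g [x]) = coset S g" using coset_eq g' assms(3) Cons.prems by blast
  then have "pot \<omega> (act (act g [x]) u) = pot \<omega> (act g [x])"
    using Cons.IH[OF g'(1) u(1)] Cons.prems by simp
  moreover have "pot \<omega> (act g [x]) = pot \<omega> g"
    using pot_step[OF Cons.prems(1), of x] a x Cons.prems by (auto)
  ultimately show ?case using act_Cons[of g x u] Cons.prems(1) a u x by simp
qed simp

section \<open>Separation by hyperplanes\<close>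

text \<open>Signed number of crossings of \<open>h\<close> on the way from the base vertex. For a
  hyperplane only two values occur, and they tell its two sides apart.\<close>

definition height :: "'v \<times> 'v kvertex set \<Rightarrow> 'v kvertex \<Rightarrow> int" where
  "height h = pot (\<lambda>k. of_bool (k = h))"

lemma height_step:
  assumes "g \<in> G" "fst x \<in> V"
  shows "height h (act g [x]) = height h g + (if hyp g x = h then (if snd x then 1 else -1) else 0)"
  using pot_step[OF assms] by (simp add: height_def)

text \<open>Edges labelled in \<open>lk a\<close> are dual to hyperplanes with a label other than
  \<open>a\<close>, so they do not change this height.\<close>

lemma height_parallel:
  assumes "g \<in> G" "g' \<in> coset (lk a) g"
  shows "height (a, C) g' = height (a, C) g"
proof -
  obtain u where u: "u \<in> words (lk a)" "g' = act g u" using assms(2) by (rule cosetE)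
  have "hyp k (b, d) \<noteq> (a, C)" if "b \<in> lk a" for k b d
    using that lkD(3)[of b a] by (metis fst_conv fst_hyp)
  then show ?thesis
    unfolding height_def u(2) by (intro pot_const[OF assms(1) u(1) lk_subset]) auto
qed

text \<open>All positive crossings of the hyperplane start in one coset of \<open>lk a\<close>, on
  which the height is constant. So every crossing switches between one fixed value and its
  successor.\<close>

lemma height_two_values:
  assumes "g \<in> G" "g' \<in> G" "a \<in> V"
  shows "height (hyp g (a, True)) g' \<in> {height (hyp g (a, True)) g, height (hyp g (a, True)) g + 1}"
proof -
  define h where "h = hyp g (a, True)"
  have ha: "h = (a, coset (lk a) g)" by (simp add: h_def hyp.simps)
  have same: "height h k = height h g" if "k \<in> G" "hyp k (a, True) = h" for k
    using hyp_eq_coset[OF assms(1) that(1) assms(3), of True] that height_parallel[OF assms(1)] h_def ha by metis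
  obtain u where u: "u \<in> words V" "act g u = g'" using assms(1,2) by (rule act_transitive)
  have "height h (act k u) \<in> {height h g, height h g + 1}" if "k \<in> G" "height h k \<in> {height h g, height h g + 1}" for k
    using u(1) that
  proof (induction u arbitrary: k)
    case (Cons x u)
    obtain b d where x: "x = (b, d)" by force
    have V: "b \<in> V" "u \<in> words V" using Cons.prems x by auto
    have k': "act k [x] \<in> G" using Cons.prems x by auto
    have "height h (act k [x]) \<in> {height h g, height h g + 1}"
    proof (cases "hyp k x = h")
      case True
      then have b: "b = a" using x ha by (metis fst_conv fst_hyp)
      show ?thesis
      proof (cases d)
        case True
        then show ?thesis using same[of k] \<open>hyp k x = h\<close> x b Cons.prems height_step[of k x h] by auto
      next
        case False
        then have "hyp (act k [x]) (a, True) = h"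
          using hyp_flip[of k a False] \<open>hyp k x = h\<close> x b Cons.prems V by simp
        then show ?thesis using same[OF k'] by simp
      qed
    next
      case False
      then show ?thesis using height_step[of k x h] Cons.prems by auto
    qed
    then show ?case using Cons.IH[OF V(2) k'] act_Cons[of k x u] Cons.prems x V by simp
  qed simp
  from this[OF assms(1)] show ?thesis using u by (simp add: h_def)
qed

definition sep :: "'v \<times> 'v kvertex set \<Rightarrow> 'v kvertex \<Rightarrow> 'v kvertex \<Rightarrow> bool" where
  "sep h x y \<longleftrightarrow> height h x \<noteq> height h y"

lemma sep_two_sides:
  assumes "g \<in> G" "fst c \<in> V" "x \<in> G" "y \<in> G" "z \<in> G" "h = hyp g c" "sep h x y"
  shows "sep h x z \<longleftrightarrow> \<not> sep h y z"
proof -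
  obtain a d where c: "c = (a, d)" by force
  obtain k where k: "k \<in> G" "h = hyp k (a, True)"
  proof (cases d)
    case True
    then show ?thesis using that[of g] assms c by simp
  next
    case False
    then show ?thesis using that[of "act g [(a, False)]"] assms c hyp_flip[of g a False] by auto
  qed
  show ?thesis
    using height_two_values[OF k(1) assms(3), of a] height_two_values[OF k(1) assms(4), of a]
      height_two_values[OF k(1) assms(5), of a] assms c k by (auto simp: sep_def)
qed

primrec hyps :: "'v kvertex \<Rightarrow> 'v word \<Rightarrow> ('v \<times> 'v kvertex set) list" where
  "hyps g [] = []"
| "hyps g (x # u) = hyp g x # hyps (act g [x]) u"

lemma fst_hyps: "map fst (hyps g u) = map fst u"
  by (induction u arbitrary: g) auto

text \<open>The alphabet of a path can be read off the set of hyperplanes it crosses; this turns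
  comparisons of crossing sets into membership in cosets.\<close>

lemma words_iff_hyps: "u \<in> words S \<longleftrightarrow> fst ` set (hyps g u) \<subseteq> S"
  by (metis words_iff fst_hyps list.set_map)

lemma hyps_append:
  "g \<in> G \<Longrightarrow> u \<in> words V \<Longrightarrow> w \<in> words V \<Longrightarrow> hyps g (u @ w) = hyps g u @ hyps (act g u) w"
proof (induction u arbitrary: g)
  case (Cons x u)
  then show ?case using Cons.IH[of "act g [x]"] act_Cons[of g x u] act_in[of g "[x]"] by simp
qed simp

lemma hyps_split:
  assumes "hyps g u = ys @ h # zs" "g \<in> G" "u \<in> words V"
  obtains u1 c u2 where "u = u1 @ c # u2" "hyps g u1 = ys" "hyp (act g u1) c = h"
    "hyps (act g (u1 @ [c])) u2 = zs"
proof -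
  define u1 where "u1 = take (length ys) u"
  have len: "length (hyps k u) = length u" for k u
    using fst_hyps map_eq_imp_length_eq by blast
  have "length ys < length u" using len[of g u] assms(1) by simp
  then obtain c u2 where u: "u = u1 @ c # u2"
    unfolding u1_def by (metis id_take_nth_drop)
  have w: "u1 \<in> words V" "fst c \<in> V" "u2 \<in> words V" using u assms by auto
  have l1: "length (hyps g u1) = length ys" using len u1_def \<open>length ys < length u\<close> by simp
  have "hyps g u = hyps g u1 @ hyp (act g u1) c # hyps (act g (u1 @ [c])) u2"
    using w assms by (simp add: u hyps_append act_append)
  then show thesis
    using that[OF u] l1 assms(1) by simp
qed

lemma hyps_are_hyp:
  assumes "h \<in> set (hyps g u)" "g \<in> G" "u \<in> words V"
  obtains k c where "k \<in> G" "fst c \<in> V" "h = hyp k c"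
proof -
  obtain ys zs where "hyps g u = ys @ h # zs" using assms(1) by (auto simp: in_set_conv_decomp)
  then obtain u1 c u2 where "u = u1 @ c # u2" "hyp (act g u1) c = h"
    using assms by (auto elim: hyps_split)
  then show thesis using that[of "act g u1" c] assms by auto
qed

section \<open>Reduced paths and convexity of cosets\<close>

lemma sep_imp_crossed:
  assumes "x \<in> G" "u \<in> words V" "sep h x (act x u)"
  shows "h \<in> set (hyps x u)"
  using assms
proof (induction u arbitrary: x)
  case Nil
  then show ?case by (simp add: sep_def)
next
  case (Cons c u)
  show ?case
  proof (cases "hyp x c = h")
    case False
    then have "height h (act x [c]) = height h x" using height_step[of x c h] Cons.prems by simp
    then have "sep h (act x [c]) (act (act x [c]) u)"
      using Cons.prems act_Cons[of x c u] by (simp add: sep_def)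
    then show ?thesis using Cons.IH[of "act x [c]"] Cons.prems act_in[of x "[c]"] by simp
  qed simp
qed

lemma crossed_once_imp_sep:
  assumes "x \<in> G" "u \<in> words V" "distinct (hyps x u)" "h \<in> set (hyps x u)"
  shows "sep h x (act x u)"
proof -
  obtain ys zs where yz: "hyps x u = ys @ h # zs" using assms(4) by (auto simp: in_set_conv_decomp)
  then obtain u1 c u2 where u: "u = u1 @ c # u2" "hyps x u1 = ys" "hyp (act x u1) c = h"
    "hyps (act x (u1 @ [c])) u2 = zs"
    using assms by (auto elim: hyps_split)
  have w: "u1 \<in> words V" "fst c \<in> V" "u2 \<in> words V" using u assms by auto
  have n: "h \<notin> set ys" "h \<notin> set zs" using assms(3) yz by auto
  have g: "act x u1 \<in> G" "act x (u1 @ [c]) \<in> G" using w assms by auto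
  have "height h x = height h (act x u1)"
    using sep_imp_crossed[OF assms(1) w(1), of h] n u by (auto simp: sep_def)
  moreover have "height h (act x (u1 @ [c])) = height h (act x u)"
    using sep_imp_crossed[OF g(2) w(3), of h] n u act_append[of x "u1 @ [c]" u2] assms(1) w
    by (auto simp: sep_def)
  moreover have "height h (act x (u1 @ [c])) \<noteq> height h (act x u1)"
    using height_step[OF g(1) w(2), of h] u act_append[of x u1 "[c]"] assms(1) w by auto
  ultimately show ?thesis by (simp add: sep_def)
qed

text \<open>Convexity: a path that crosses no hyperplane twice crosses only hyperplanes separating
  its end points. Any \<open>S\<close>-word between the same end points has to cross these too, so
  their labels lie in \<open>S\<close>.\<close>

lemma reduced_in_coset:
  assumes "x \<in> G" "S \<subseteq> V" "u \<in> words V" "distinct (hyps x u)" "act x u \<in> coset S x"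
  shows "u \<in> words S"
proof -
  obtain v where v: "v \<in> words S" "act x u = act x v" using assms(5) by (rule cosetE)
  have "h \<in> set (hyps x v)" if "h \<in> set (hyps x u)" for h
    using crossed_once_imp_sep[OF assms(1,3,4) that] sep_imp_crossed[OF assms(1), of v]
      v words_mono[OF assms(2) v(1)] by metis
  then show ?thesis using v(1) unfolding words_iff_hyps[of _ _ x] by blast
qed

text \<open>After the crossing at \<open>z\<close>, the vertex \<open>x\<close> is still on the new
  side. As there are only two sides, the edge at \<open>x\<close> must cross in the opposite
  direction, and the two edges have parallel ends on that side.\<close>

lemma crossing_back:
  assumes "z \<in> G" "x \<in> G" "a \<in> V" "hyp z (a, d) = hyp x (a, d')"
    "\<not> sep (hyp z (a, d)) (act z [(a, d)]) x"
  shows "d' = (\<not> d)" "x \<in> coset (lk a) (act z [(a, d)])"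
proof -
  define h where "h = hyp z (a, d)"
  have hz: "height h (act z [(a, d)]) = height h z + (if d then 1 else -1)"
    using height_step[OF assms(1), of "(a, d)" h] assms h_def by simp
  have hx: "height h (act x [(a, d')]) = height h x + (if d' then 1 else -1)"
    using height_step[OF assms(2), of "(a, d')" h] assms h_def by simp
  have xz: "height h x = height h (act z [(a, d)])" using assms(5) by (simp add: sep_def h_def)
  have g: "act z [(a, d)] \<in> G" "act x [(a, d')] \<in> G" using assms by auto
  have "sep h (act z [(a, d)]) z" using hz by (simp add: sep_def)
  from sep_two_sides[OF assms(1) _ g(1) assms(1) g(2) h_def this]
  show "d' = (\<not> d)"
    using assms(3) hz hx xz by (auto simp: sep_def split: if_splits)
  then have "hyp (act z [(a, d)]) (a, \<not> d) = hyp x (a, \<not> d)"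
    using hyp_flip[OF assms(1,3), of d] assms(4) by simp
  then show "x \<in> coset (lk a) (act z [(a, d)])"
    using hyp_eq_coset[OF g(1) assms(2,3)] by metis
qed

text \<open>Between two consecutive crossings of a hyperplane, a path stays parallel to it, so that
  the two crossings cancel.\<close>

lemma reduce_word:
  assumes "x \<in> G" "u \<in> words V"
  obtains v where "v \<in> words V" "act x v = act x u" "length v \<le> length u" "distinct (hyps x v)"
proof -
  have "\<exists>v \<in> words V. act x v = act x u \<and> length v \<le> length u \<and> distinct (hyps x v)"
    using assms
  proof (induction "length u" arbitrary: x u rule: less_induct)
    case less
    show ?case
    proof (cases u)
      case Nil
      then show ?thesis using less.prems by (intro bexI[of _ "[]"]) auto
    next
      case (Cons c u')
      obtain a d where c: "c = (a, d)" by force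
      have V: "a \<in> V" "u' \<in> words V" using Cons less.prems c by auto
      define x1 where "x1 = act x [c]"
      have x1: "x1 \<in> G" using less.prems V c x1_def by auto
      \<comment> \<open>With the tail already reduced, the only hyperplane that can be crossed twice
        is that of the first letter \<open>c\<close>.\<close>
      obtain v where v: "v \<in> words V" "act x1 v = act x1 u'" "length v \<le> length u'"
          "distinct (hyps x1 v)"
        using less.hyps[of u' x1] Cons x1 V by auto
      have cv: "act x (c # w) = act x1 w" if "w \<in> words V" for w
        using act_Cons[of x c w] less.prems V c that by (simp add: x1_def)
      show ?thesis
      proof (cases "hyp x c \<in> set (hyps x1 v)")
        case False
        then show ?thesis
          using v cv[OF v(1)] cv[OF V(2)] Cons V(1) c hyps.simps(2)[of x c v]
          unfolding x1_def[symmetric] by (intro bexI[of _ "c # v"]) simp_all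
      next
        case True
        then obtain ys zs where yz: "hyps x1 v = ys @ hyp x c # zs" by (auto simp: in_set_conv_decomp)
        then obtain u1 e u2 where u: "v = u1 @ e # u2" "hyps x1 u1 = ys" "hyp (act x1 u1) e = hyp x c"
          using v x1 by (auto elim: hyps_split)
        have w: "u1 \<in> words V" "fst e \<in> V" "u2 \<in> words V" using u v by auto
        define x2 where "x2 = act x1 u1"
        have x2: "x2 \<in> G" using x1 w x2_def by auto
        obtain d' where e: "e = (a, d')"
          using u(3) c by (metis fst_conv fst_hyp prod.collapse)
        have ns: "\<not> sep (hyp x c) x1 x2"
          using sep_imp_crossed[OF x1 w(1), of "hyp x c"] u yz v(4) by (auto simp: x2_def)
        have d': "d' = (\<not> d)" "x2 \<in> coset (lk a) x1"
          using crossing_back[of x x2 a d d'] ns u(3) e c V less.prems x2 by (auto simp: x1_def x2_def)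
        have u1: "u1 \<in> words (lk a)"
          using reduced_in_coset[OF x1 lk_subset w(1)] d'(2) v(4) yz u x2_def by simp
        \<comment> \<open>The letter \<open>a\<close> moves past \<open>u1\<close>, so the letters
          \<open>c\<close> and \<open>e\<close> cancel.\<close>
        have "act x2 [e] = act x u1"
          using act_commute_word[OF u1 x1 V(1), of "\<not> d"] d' e c less.prems V
          by (simp add: x2_def x1_def)
        then have "act x (u1 @ u2) = act x1 v"
          using less.prems w x1 x2 by (simp add: u act_append x2_def act_Cons[of _ e u2])
        then have *: "act x (u1 @ u2) = act x u" using cv v Cons V by simp
        have "length (u1 @ u2) < length u" using Cons u v by simp
        then obtain v' where "v' \<in> words V" "act x v' = act x (u1 @ u2)" "length v' \<le> length (u1 @ u2)"
            "distinct (hyps x v')"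
          using less.hyps[of "u1 @ u2" x] less.prems w by auto
        then show ?thesis
          using * \<open>length (u1 @ u2) < length u\<close> by (intro bexI[of _ v']) auto
      qed
    qed
  qed
  then show thesis using that by blast
qed

lemma coset_reduced:
  assumes "x \<in> G" "S \<subseteq> V" "y \<in> coset S x"
  obtains v where "v \<in> words S" "act x v = y" "distinct (hyps x v)"
proof -
  obtain u where u: "u \<in> words S" "y = act x u" using assms(3) by (rule cosetE)
  obtain v where "v \<in> words V" "act x v = y" "distinct (hyps x v)"
    using reduce_word[OF assms(1), of u] words_mono[OF assms(2) u(1)] u by metis
  then show thesis using that reduced_in_coset[OF assms(1,2)] assms(3) by metis
qed

text \<open>A reduced word leading to a point of both cosets uses, by convexity, only letters from
  \<open>S\<close> and only letters from \<open>T\<close>.\<close>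

lemma coset_Int:
  assumes "x \<in> G" "S \<subseteq> V" "T \<subseteq> V"
  shows "coset S x \<inter> coset T x = coset (S \<inter> T) x"
proof
  show "coset S x \<inter> coset T x \<subseteq> coset (S \<inter> T) x"
  proof
    fix y assume y: "y \<in> coset S x \<inter> coset T x"
    then obtain v where v: "v \<in> words S" "act x v = y" "distinct (hyps x v)"
      using coset_reduced[OF assms(1,2)] by blast
    then have "v \<in> words T"
      using reduced_in_coset[OF assms(1,3), of v] y words_mono[OF assms(2)] by blast
    then show "y \<in> coset (S \<inter> T) x"
      using v coset_act[of v "S \<inter> T" x] by (auto simp: words_iff)
  qed
qed (use coset_mono in blast)

section \<open>Gates and the Helly property\<close>

text \<open>Take a shortest path from \<open>q\<close> to the coset and extend it inside the coset
  by a reduced path \<open>v\<close> to \<open>y\<close>. A hyperplane of \<open>u\<close> that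
  fails to separate \<open>q\<close> from \<open>y\<close> is crossed again by \<open>v\<close>. For
  the last hyperplane of \<open>u\<close> that recurs, everything between its two crossings commutes
  with its label \<open>a\<close>. Hence this letter can be moved to the end of \<open>u\<close>,
  where the coset absorbs it, so the path was not shortest.\<close>

lemma gate:
  assumes "q \<in> G" "p \<in> G" "S \<subseteq> V"
  obtains u where "u \<in> words V" "act q u \<in> coset S p" "distinct (hyps q u)"
    "\<And>y h. y \<in> coset S p \<Longrightarrow> h \<in> set (hyps q u) \<Longrightarrow> sep h q y"
proof -
  have "\<exists>u. u \<in> words V \<and> act q u \<in> coset S p"
    using act_transitive[OF assms(1,2)] coset_self[OF assms(2)] by metis
  then obtain u0 where u0: "u0 \<in> words V" "act q u0 \<in> coset S p"
    and min: "\<And>u. u \<in> words V \<Longrightarrow> act q u \<in> coset S p \<Longrightarrow> length u0 \<le> length u"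
    using ex_has_least_nat[of "\<lambda>u. u \<in> words V \<and> act q u \<in> coset S p" _ length] by blast
  obtain u where u: "u \<in> words V" "act q u = act q u0" "length u \<le> length u0" "distinct (hyps q u)"
    using reduce_word[OF assms(1) u0(1)] by metis
  define r where "r = act q u"
  have r: "r \<in> G" "r \<in> coset S p" using u u0 assms r_def by auto
  have Sr: "coset S r = coset S p" using coset_eq r assms by blast
  have "sep h q y" if y: "y \<in> coset S p" and h: "h \<in> set (hyps q u)" for y h
  proof (rule ccontr)
    assume nsep: "\<not> sep h q y"
    have yG: "y \<in> G" using coset_subset assms y by blast
    have yS: "y \<in> coset S r" using y Sr by simp
    obtain v where v: "v \<in> words S" "act r v = y" "distinct (hyps r v)"
      using coset_reduced[OF r(1) assms(3) yS] by metis
    have vV: "v \<in> words V" using v words_mono assms by blast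
    obtain k c where kc: "k \<in> G" "fst c \<in> V" "h = hyp k c"
      using hyps_are_hyp[OF h assms(1) u(1)] by metis
    have "sep h q r" using crossed_once_imp_sep[OF assms(1) u(1,4) h] r_def by simp
    then have "sep h r y"
      using sep_two_sides[OF kc(1,2) assms(1) r(1) yG kc(3)] nsep by blast
    then have "h \<in> set (hyps r v)" using sep_imp_crossed[OF r(1) vV] v by simp
    \<comment> \<open>Choosing the last recurring hyperplane makes the crossings between its two
      occurrences pairwise distinct, so that part of the path is reduced.\<close>
    then obtain ys h' zs where yz: "hyps q u = ys @ h' # zs" and h': "h' \<in> set (hyps r v)"
      and last: "\<And>z. z \<in> set zs \<Longrightarrow> z \<notin> set (hyps r v)"
      using split_list_last_prop[of "hyps q u" "\<lambda>z. z \<in> set (hyps r v)"] h by metis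
    obtain u1 c u2 where us: "u = u1 @ c # u2" "hyps q u1 = ys" "hyp (act q u1) c = h'"
        "hyps (act q (u1 @ [c])) u2 = zs"
      using hyps_split[OF yz assms(1) u(1)] by metis
    obtain ys' zs' where yz': "hyps r v = ys' @ h' # zs'" using h' by (auto simp: in_set_conv_decomp)
    obtain v1 c' v2 where vs: "v = v1 @ c' # v2" "hyps r v1 = ys'" "hyp (act r v1) c' = h'"
      using hyps_split[OF yz' r(1) vV] by metis
    have w: "u1 \<in> words V" "fst c \<in> V" "u2 \<in> words V" "v1 \<in> words V" "fst c' \<in> V"
      "fst c' \<in> S"
      using us u vs vV v by auto
    obtain a d where c: "c = (a, d)" by force
    obtain d' where c': "c' = (a, d')" using us(3) vs(3) c by (metis fst_conv fst_hyp prod.collapse)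
    define z where "z = act q u1"
    define x1 where "x1 = act z [c]"
    define x2 where "x2 = act r v1"
    have g: "z \<in> G" "x1 \<in> G" "x2 \<in> G" using assms w r by (auto simp: z_def x1_def x2_def)
    have x1': "x1 = act q (u1 @ [c])" using w assms by (simp add: x1_def z_def act_append)
    have r': "r = act x1 u2"
      using w assms by (simp add: r_def us x1' act_append act_Cons[of _ c u2])
    have path: "act x1 (u2 @ v1) = x2" using g w by (simp add: act_append r' x2_def)
    have hp: "hyps x1 (u2 @ v1) = zs @ ys'" using g w us x1' vs r' by (simp add: hyps_append)
    have dist: "distinct (zs @ ys')"
      using u(4) yz v(3) yz' last by auto
    have "\<not> sep h' x1 x2"
      using sep_imp_crossed[OF g(2), of "u2 @ v1" h'] path hp w u(4) yz v(3) yz' by auto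
    then have "x2 \<in> coset (lk a) x1"
      using crossing_back(2)[OF g(1,3), of a d d'] us(3) vs(3) w c c' by (auto simp: z_def x1_def x2_def)
    then have "u2 @ v1 \<in> words (lk a)"
      using reduced_in_coset[OF g(2) lk_subset, of "u2 @ v1"] path hp dist w by simp
    then have "u2 \<in> words (lk a)" by simp
    then have "r = act (act z u2) [(a, d)]"
      using act_commute_word[of u2 a z d] g w c by (simp add: r' x1_def)
    then have "act r [(a, \<not> d)] = act q (u1 @ u2)"
      using act_cancel[of "act z u2" a d] g w c assms by (simp add: z_def act_append)
    moreover have "act r [(a, \<not> d)] \<in> coset S r"
      using coset_act[of "[(a, \<not> d)]" S r] w c' by simp
    ultimately have "length u0 \<le> length (u1 @ u2)"
      using min[of "u1 @ u2"] w Sr by simp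
    then show False using u(3) us by simp
  qed
  then show thesis using that[of u] u r r_def by blast
qed

text \<open>Any \<open>S\<close>-word from \<open>x\<close> to \<open>y\<close> crosses every
  hyperplane of \<open>u\<close>, so all labels of \<open>u\<close> are in \<open>S\<close>.\<close>

lemma gate_in_convex:
  assumes "x \<in> G" "y \<in> coset S x" "S \<subseteq> V" "u \<in> words V" "\<And>h. h \<in> set (hyps x u) \<Longrightarrow> sep h x y"
  shows "u \<in> words S"
proof -
  obtain v where v: "v \<in> words S" "y = act x v" using assms(2) by (rule cosetE)
  then have "set (hyps x u) \<subseteq> set (hyps x v)"
    using sep_imp_crossed[OF assms(1) words_mono[OF assms(3) v(1)]] assms(5) by blast
  then show ?thesis using v(1) unfolding words_iff_hyps[of _ _ x] by blast
qed

text \<open>Start at a point \<open>x\<close> common to all cosets but one and walk to the gate in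
  the remaining one. The hyperplanes crossed separate \<open>x\<close> from that whole coset, in
  particular from its intersection with each of the others, so the walk never leaves any of
  them.\<close>

lemma helly:
  assumes "finite I" "I \<noteq> {}" "\<And>i. i \<in> I \<Longrightarrow> P i \<in> G \<and> S i \<subseteq> V"
    "\<And>i j. i \<in> I \<Longrightarrow> j \<in> I \<Longrightarrow> coset (S i) (P i) \<inter> coset (S j) (P j) \<noteq> {}"
  shows "\<exists>x \<in> G. \<forall>i \<in> I. x \<in> coset (S i) (P i)"
  using assms
proof (induction rule: finite_ne_induct)
  case (singleton i)
  then show ?case using coset_self by blast
next
  case (insert i I)
  have "\<exists>x \<in> G. \<forall>j \<in> I. x \<in> coset (S j) (P j)"
    by (rule insert.IH) (use insert.prems in simp_all)
  then obtain x where x: "x \<in> G" "\<And>j. j \<in> I \<Longrightarrow> x \<in> coset (S j) (P j)"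
    by blast
  have i: "P i \<in> G" "S i \<subseteq> V" using insert.prems by auto
  obtain u where u: "u \<in> words V" "act x u \<in> coset (S i) (P i)"
    "\<And>y h. y \<in> coset (S i) (P i) \<Longrightarrow> h \<in> set (hyps x u) \<Longrightarrow> sep h x y"
    using gate[OF x(1) i] by metis
  have "act x u \<in> coset (S j) (P j)" if j: "j \<in> I" for j
  proof -
    have Sj: "P j \<in> G" "S j \<subseteq> V" using insert.prems j by auto
    obtain y where y: "y \<in> coset (S i) (P i)" "y \<in> coset (S j) (P j)"
      using insert.prems(2)[of i j] j by auto
    have eq: "coset (S j) x = coset (S j) (P j)" using coset_eq Sj x(2)[OF j] by blast
    have "u \<in> words (S j)"
      using gate_in_convex[OF x(1) _ Sj(2) u(1)] y eq u(3) by blast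
    then show ?thesis using coset_act eq by blast
  qed
  then show ?case using u x by (intro bexI[of _ "act x u"]) auto
qed

text \<open>Choose \<open>x\<close> in the first coset as close as possible to the second and take
  the first hyperplane on the gate path from \<open>x\<close>. If it also separated two points of
  the first coset, its label would be in \<open>S\<close>, and the end of its edge would be a closer
  starting point.\<close>

lemma disjoint_cosets_separated:
  assumes "p \<in> G" "q \<in> G" "S \<subseteq> V" "T \<subseteq> V" "coset S p \<inter> coset T q = {}"
  obtains x c where "x \<in> coset S p" "fst c \<in> V"
    "\<And>y z. y \<in> coset S p \<Longrightarrow> z \<in> coset T q \<Longrightarrow> sep (hyp x c) y z"
proof -
  define W where "W = {(x, u). x \<in> coset S p \<and> u \<in> words V \<and> act x u \<in> coset T q}"
  have SG: "coset S p \<subseteq> G" "coset T q \<subseteq> G" using coset_subset assms by blast+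
  obtain u0 where u0: "u0 \<in> words V" "act p u0 = q" using assms(1,2) by (rule act_transitive)
  then have "(p, u0) \<in> W" using assms(1,2) by (simp add: W_def)
  then obtain x u where xu: "(x, u) \<in> W" and min: "\<And>y v. (y, v) \<in> W \<Longrightarrow> length u \<le> length v"
    using ex_has_least_nat[of "\<lambda>w. w \<in> W" "(p, u0)" "\<lambda>w. length (snd w)"] by auto
  have x: "x \<in> G" "x \<in> coset S p" "u \<in> words V" "act x u \<in> coset T q" using xu SG by (auto simp: W_def)
  define z where "z = act x u"
  obtain v where v: "v \<in> words V" "act x v \<in> coset T q" "distinct (hyps x v)"
    "\<And>y h. y \<in> coset T q \<Longrightarrow> h \<in> set (hyps x v) \<Longrightarrow> sep h x y"
    using gate[OF x(1) assms(2,4)] by metis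
  have "v \<noteq> []" using v(2) x assms(5) by auto
  then obtain c v' where c: "v = c # v'" by (cases v) auto
  define h where "h = hyp x c"
  have V: "fst c \<in> V" "v' \<in> words V" using c v by auto
  have hv: "h \<in> set (hyps x v)" by (simp add: c h_def)
  show thesis
  proof (rule that[OF x(2) V(1)])
    fix y y' assume y: "y \<in> coset S p" "y' \<in> coset T q"
    have yG: "y \<in> G" "y' \<in> G" using y SG by auto
    have s1: "sep h x y'" using v(4)[OF y(2) hv] .
    have "\<not> sep h x y"
    proof
      assume "sep h x y"
      have "coset S x = coset S p" using coset_eq assms x by blast
      then have "y \<in> coset S x" using y(1) by simp
      then obtain b where b: "b \<in> words S" "y = act x b" by (rule cosetE)
      then have "h \<in> set (hyps x b)"
        using sep_imp_crossed[OF x(1) words_mono[OF assms(3) b(1)]] \<open>sep h x y\<close> by simp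
      then have "fst c \<in> S"
        using b(1) words_iff_hyps[of b S x] by (auto simp: h_def)
      then have "act x [c] \<in> coset S p"
        using coset_act[of "[c]" S x] \<open>coset S x = coset S p\<close> by simp
      moreover have "act (act x [c]) v' = act x v" using c V x by (simp add: act_Cons[of x c v'])
      ultimately have "(act x [c], v') \<in> W" using v V by (simp add: W_def)
      then have "length u \<le> length v'" using min by blast
      \<comment> \<open>The gate path \<open>v\<close> is reduced and crosses only hyperplanes that
        separate \<open>x\<close> from \<open>z\<close>, so it is no longer than
        \<open>u\<close>.\<close>
      have "set (hyps x v) \<subseteq> set (hyps x u)"
        using v(4)[of z] x sep_imp_crossed[OF x(1,3)] z_def by blast
      then have "length (hyps x v) \<le> length (hyps x u)"
        using v(3) by (metis card_length card_mono distinct_card le_trans List.finite_set)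
      moreover have "length (hyps x b) = length b" for b
        using fst_hyps map_eq_imp_length_eq by blast
      ultimately have "length v \<le> length u" by simp
      then show False using \<open>length u \<le> length v'\<close> c by simp
    qed
    then show "sep (hyp x c) y y'"
      using sep_two_sides[OF x(1) V(1) x(1) yG(2,1) h_def s1] s1 by (auto simp: h_def sep_def)
  qed
qed

end

section \<open>Atomic graphs\<close>

locale atomic_graph =
  fixes \<Gamma> :: "'v sgraph"
  assumes atomic: "atomic \<Gamma>"

sublocale atomic_graph \<subseteq> simplicial_graph
  by unfold_locales (use atomic in \<open>simp add: atomic_def\<close>)

context atomic_graph
begin

section \<open>Consequences of the bounds on girth and valence\<close>

lemma no_triangle:
  assumes "b \<in> lk a" "c \<in> lk b" "a \<in> lk c"
  shows False
proof -
  have "is_cycle \<Gamma> [a, b, c]"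
    using assms lkD(1,2)[OF assms(1)] lkD(2)[OF assms(2)] lkD(3)[OF assms(1)] lkD(3)[OF assms(2)]
      lkD(3)[OF assms(3)]
    unfolding is_cycle_def by (auto simp: less_Suc_eq lk_def)
  then show False
    using atomic by (fastforce simp: atomic_def)
qed

lemma no_square:
  assumes "b \<in> lk a" "c \<in> lk b" "d \<in> lk c" "a \<in> lk d" "a \<noteq> c" "b \<noteq> d"
  shows False
proof -
  have "is_cycle \<Gamma> [a, b, c, d]"
    using assms lkD(1,2)[OF assms(1)] lkD(2)[OF assms(2)] lkD(2)[OF assms(3)] lkD(3)[OF assms(1)]
      lkD(3)[OF assms(2)] lkD(3)[OF assms(3)] lkD(3)[OF assms(4)]
    unfolding is_cycle_def by (auto simp: less_Suc_eq lk_def)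
  then show False
    using atomic by (fastforce simp: atomic_def)
qed

lemma two_neighbours:
  assumes "a \<in> V"
  obtains b c where "b \<in> lk a" "c \<in> lk a" "b \<noteq> c"
proof -
  define N where "N = {e \<in> gedges \<Gamma>. a \<in> e}"
  have "2 \<le> card N"
    using atomic assms by (simp add: atomic_def valence_def N_def)
  then have "\<exists>e1 e2. e1 \<in> N \<and> e2 \<in> N \<and> e1 \<noteq> e2"
    by (metis One_nat_def Suc_n_not_le_n card_le_Suc0_iff_eq card.infinite le_trans nat_le_linear not_less_eq_eq numeral_2_eq_2 zero_le)
  moreover have "\<exists>b. e = {a, b}" if "e \<in> N" for e
  proof -
    have "card e = 2" "a \<in> e" using that fsg by (auto simp: N_def finite_simplicial_graph_def)
    then show ?thesis by (auto simp: card_2_iff)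
  qed
  ultimately obtain b c where "{a, b} \<in> N" "{a, c} \<in> N" "{a, b} \<noteq> {a, c}"
    by metis
  then show thesis using that[of b c] by (auto simp: N_def lk_def)
qed

lemma other_neighbour:
  assumes "a \<in> V"
  obtains b where "b \<in> lk a" "b \<noteq> c"
  using two_neighbours[OF assms] by metis

lemma st_Int_edge: "b \<in> lk a \<Longrightarrow> st a \<inter> st b = {a, b}"
  using no_triangle[of b a] lk_sym by (auto simp: st_def)

text \<open>A second common point would close a triangle or a square. This is what isolates a single
  label by stars, and later a line by parallel sets.\<close>

lemma st_Int_neighbours:
  assumes "b \<in> lk a" "c \<in> lk a" "b \<noteq> c"
  shows "st b \<inter> st c = {a}"
proof -
  have "x = a" if "x \<in> st b" "x \<in> st c" for x
    using that assms no_square[of b a x c] no_triangle[of b a c] lk_sym unfolding st_def by blast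
  then show ?thesis using assms lk_sym by (auto simp: st_def)
qed

section \<open>Star complements: from topological to edge-path connectedness\<close>

definition adj_in :: "'v set \<Rightarrow> ('v \<times> 'v) set" where
  "adj_in T = {(c, d). d \<in> lk c \<and> c \<in> T \<and> d \<in> T}"

lemma edge_pt_ends:
  "edge_pt (p, q) 0 = vertex_pt p" "edge_pt (p, q) 1 = vertex_pt q"
  by auto

lemma edge_pt_nonzero: "edge_pt (p, q) s c \<noteq> 0 \<Longrightarrow> c = p \<or> c = q"
  by (auto simp: vertex_pt_def split: if_splits)

lemma edge_pt_in_star:
  assumes "{p, q} \<in> gedges \<Gamma>" "x \<in> {p, q}" "0 \<le> s" "s \<le> 1"
  shows "edge_pt (p, q) s \<in> closed_star \<Gamma> x"
proof -
  have "edge_pt (p, q) s \<in> closed_edge {p, q}"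
    unfolding closed_edge_def by (rule UN_I[of "(p, q)"]) (use assms in \<open>auto simp del: edge_pt.simps\<close>)
  then show ?thesis using assms by (auto simp: closed_star_def simp del: edge_pt.simps)
qed

lemma vertex_in_star:
  assumes "x \<in> V" "c \<in> V"
  shows "vertex_pt c \<in> closed_star \<Gamma> x \<longleftrightarrow> c \<in> st x"
proof
  assume "vertex_pt c \<in> closed_star \<Gamma> x"
  then obtain p q s where pq: "{p, q} \<in> gedges \<Gamma>" "x \<in> {p, q}" "vertex_pt c = edge_pt (p, q) s"
    unfolding closed_star_def closed_edge_def by blast
  have "edge_pt (p, q) s c \<noteq> 0" using pq(3)[symmetric] by (simp add: vertex_pt_def del: edge_pt.simps)
  then show "c \<in> st x"
    using edge_pt_nonzero[of p q s c] pq by (auto simp: st_def lk_def insert_commute simp del: edge_pt.simps)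
next
  assume c: "c \<in> st x"
  obtain b where b: "b \<in> lk x" using two_neighbours[OF assms(1)] by metis
  have *: "edge_pt (x, d) s \<in> closed_star \<Gamma> x" if "d \<in> lk x" "s \<in> {0..1}" for d s
    using that edge_pt_in_star[of x d x s] by (simp add: lk_def del: edge_pt.simps)
  show "vertex_pt c \<in> closed_star \<Gamma> x"
    using *[OF b, of 0] *[of c 1] c by (auto simp: st_def edge_pt_ends simp del: edge_pt.simps)
qed

text \<open>If an edge-path component \<open>A\<close> of the remaining vertices were proper, the
  points with a positive weight in \<open>A\<close> and those with a positive weight in the rest
  \<open>B\<close> would be two disjoint relatively open sets covering the complement of the closed
  star.\<close>

lemma star_complement_connected:
  assumes "x \<in> V" "a \<in> V - st x" "b \<in> V - st x"
  shows "(a, b) \<in> (adj_in (V - st x))\<^sup>*"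
proof (rule ccontr)
  assume nab: "(a, b) \<notin> (adj_in (V - st x))\<^sup>*"
  define A where "A = {c \<in> V - st x. (a, c) \<in> (adj_in (V - st x))\<^sup>*}"
  define B where "B = V - st x - A"
  define X where "X = graph_realization \<Gamma> - closed_star \<Gamma> x"
  \<comment> \<open>On the graph, this is the union of the open stars of the vertices of
    \<open>A\<close>.\<close>
  define U where "U = (\<lambda>A. {y :: 'v \<Rightarrow> real. \<exists>c \<in> A. y c > 0})"
  have op: "open (U A)" for A
  proof -
    have "U A = (\<Union>c \<in> A. {y. 0 < y c})" by (auto simp: U_def)
    then show ?thesis
      by (simp add: open_UN open_Collect_less continuous_on_product_coordinates)
  qed
  have conX: "connected X" using atomic assms(1) by (simp add: atomic_def X_def)
  have cases: "(\<exists>c \<in> V. y = vertex_pt c) \<or>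
      (\<exists>p q s. {p, q} \<in> gedges \<Gamma> \<and> y = edge_pt (p, q) s \<and> 0 \<le> s \<and> s \<le> 1)" if "y \<in> X" for y
    using that unfolding X_def graph_realization_def closed_edge_def by fastforce
  have vert: "c \<notin> st x" if "vertex_pt c \<in> X" "c \<in> V" for c
    using that vertex_in_star[OF assms(1)] by (simp add: X_def)
  have cov: "X \<subseteq> U A \<union> U B"
  proof
    fix y assume y: "y \<in> X"
    have "\<exists>c \<in> V - st x. y c > 0"
      using cases[OF y]
    proof (elim disjE bexE exE conjE)
      fix c assume "c \<in> V" "y = vertex_pt c"
      then show ?thesis using vert y by (intro bexI[of _ c]) (auto simp: vertex_pt_def)
    next
      fix p q s assume e: "{p, q} \<in> gedges \<Gamma>" "y = edge_pt (p, q) s" "0 \<le> s" "s \<le> (1 :: real)"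
      have pq: "p \<in> V" "q \<in> V" "p \<noteq> q" using edgeD[OF e(1)] by auto
      have val: "y p = 1 - s" "y q = s" using pq e(2) by (auto simp: vertex_pt_def)
      \<comment> \<open>An edge with both ends in \<open>st x\<close> must contain \<open>x\<close>,
        as there are no triangles, and then it lies inside the closed star.\<close>
      have "p \<notin> st x \<or> q \<notin> st x"
      proof (rule ccontr)
        assume "\<not> ?thesis"
        then have "x \<in> {p, q}"
          using no_triangle[of p x q] e(1) lk_sym by (auto simp: st_def lk_def)
        then have "y \<in> closed_star \<Gamma> x"
          using e edge_pt_in_star[of p q x s] by (simp del: edge_pt.simps)
        then show False using y by (simp add: X_def)
      qed
      moreover have "p \<notin> st x" if "s = 0"
        using vert[of p] y e that pq by (simp add: edge_pt_ends del: edge_pt.simps)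
      moreover have "q \<notin> st x" if "s = 1"
        using vert[of q] y e that pq by (simp add: edge_pt_ends del: edge_pt.simps)
      ultimately show ?thesis
        using pq val e(3,4) by (cases "s = 0"; cases "s = 1") force+
    qed
    then show "y \<in> U A \<union> U B" by (auto simp: U_def B_def)
  qed
  have dis: "U A \<inter> U B \<inter> X = {}"
  proof -
    have False if y: "y \<in> X" "c \<in> A" "y c > 0" "d \<in> B" "y d > 0" for y c d
    proof -
      have cd: "c \<noteq> d" using y by (auto simp: B_def)
      have "d \<in> lk c"
        using cases[OF y(1)]
      proof (elim disjE bexE exE conjE)
        fix k assume "y = vertex_pt k"
        then show ?thesis using y cd by (auto simp: vertex_pt_def split: if_splits)
      next
        fix p q s assume e: "{p, q} \<in> gedges \<Gamma>" "y = edge_pt (p, q) s"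
        have "c = p \<or> c = q" "d = p \<or> d = q"
          using edge_pt_nonzero[of p q s c] edge_pt_nonzero[of p q s d] y e(2) by (auto simp del: edge_pt.simps)
        then show ?thesis using cd e by (auto simp: lk_def insert_commute)
      qed
      then have "(c, d) \<in> adj_in (V - st x)" using y by (auto simp: adj_in_def A_def B_def)
      then show False using y by (auto simp: A_def B_def intro: rtrancl.rtrancl_into_rtrancl)
    qed
    then show ?thesis by (auto simp: U_def)
  qed
  have inX: "vertex_pt c \<in> X" if "c \<in> V - st x" for c
    using that vertex_in_star[OF assms(1), of c] by (auto simp: X_def graph_realization_def)
  have "vertex_pt a \<in> U A \<inter> X" "vertex_pt b \<in> U B \<inter> X"
    using inX assms nab by (auto simp: U_def A_def B_def vertex_pt_def)
  then show False
    using connectedD[OF conX op op dis cov] by blast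
qed

section \<open>The extension graph\<close>

text \<open>The vertices of the extension graph are the parallel classes of standard geodesics: the
  class of \<open>g\<langle>a\<rangle>\<close> is encoded by its label and by the vertices of its parallel set.\<close>

definition par_class :: "'v kvertex \<Rightarrow> 'v \<Rightarrow> 'v \<times> 'v kvertex set" where
  "par_class g a = (a, coset (st a) g)"

definition ext_verts :: "('v \<times> 'v kvertex set) set" where
  "ext_verts = {par_class g a | g a. g \<in> G \<and> a \<in> V}"

definition ext_adj :: "'v \<times> 'v kvertex set \<Rightarrow> 'v \<times> 'v kvertex set \<Rightarrow> bool" where
  "ext_adj u w \<longleftrightarrow> (\<exists>g a b. g \<in> G \<and> b \<in> lk a \<and> u = par_class g a \<and> w = par_class g b)"

lemma par_class_simps [simp]: "fst (par_class g a) = a" "snd (par_class g a) = coset (st a) g"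
  by (simp_all add: par_class_def)

lemma par_class_in_EV [simp]: "g \<in> G \<Longrightarrow> a \<in> V \<Longrightarrow> par_class g a \<in> ext_verts"
  by (auto simp: ext_verts_def)

lemma par_class_eq_iff: "g \<in> G \<Longrightarrow> h \<in> G \<Longrightarrow> a \<in> V \<Longrightarrow> par_class h b = par_class g a \<longleftrightarrow> b = a \<and> h \<in> coset (st a) g"
  using coset_eq_iff[OF st_subset, of a g h] by (auto simp: par_class_def)

lemma ext_verts_at:
  assumes "u \<in> ext_verts" "p \<in> snd u"
  shows "p \<in> G" "fst u \<in> V" "u = par_class p (fst u)"
proof -
  obtain g a where u: "u = par_class g a" "g \<in> G" "a \<in> V" using assms(1) by (auto simp: ext_verts_def)
  then show "p \<in> G" "fst u \<in> V" "u = par_class p (fst u)"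
    using assms(2) coset_subset[OF st_subset, of a g] par_class_eq_iff[of g p a a] by auto
qed

lemma ext_adj_EV: "ext_adj u w \<Longrightarrow> u \<in> ext_verts \<and> w \<in> ext_verts"
  unfolding ext_adj_def ext_verts_def using lkD by blast

lemma ext_adj_fst: "ext_adj u w \<Longrightarrow> fst w \<in> lk (fst u)"
  by (auto simp: ext_adj_def)

lemma ext_adj_sym: "ext_adj u w \<Longrightarrow> ext_adj w u"
  unfolding ext_adj_def using lk_sym by blast

lemma ext_adj_common: "ext_adj u w \<Longrightarrow> \<exists>p. p \<in> snd u \<and> p \<in> snd w"
  unfolding ext_adj_def using coset_self by fastforce

lemma ext_adj_cl: "g \<in> G \<Longrightarrow> b \<in> lk a \<Longrightarrow> ext_adj (par_class g a) (par_class g b)"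
  unfolding ext_adj_def by blast

text \<open>Passing to labels sends adjacent classes to adjacent vertices of \<Gamma>, so a triangle
  would descend to \<Gamma>.\<close>

lemma ext_adj_no_triangle:
  assumes "ext_adj u w" "ext_adj w z" "ext_adj z u"
  shows False
  using ext_adj_fst[OF assms(1)] ext_adj_fst[OF assms(2)] ext_adj_fst[OF assms(3)] no_triangle by blast

section \<open>Stars in the extension graph and the hyperplanes they describe\<close>

definition ext_star :: "'v \<times> 'v kvertex set \<Rightarrow> ('v \<times> 'v kvertex set) set" where
  "ext_star v = {w. w = v \<or> ext_adj v w}"

definition ext_adj_off :: "'v \<times> 'v kvertex set \<Rightarrow> (('v \<times> 'v kvertex set) \<times> ('v \<times> 'v kvertex set)) set" where
  "ext_adj_off v = {(u, w). ext_adj u w \<and> u \<notin> ext_star v \<and> w \<notin> ext_star v}"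

text \<open>Expressed through adjacency alone, so that isomorphisms of extension graphs preserve it;
  a star that contains \<open>u\<close> or \<open>w\<close> imposes no condition. It turns out to
  mean that the two parallel sets meet.\<close>

definition unsep :: "'v \<times> 'v kvertex set \<Rightarrow> 'v \<times> 'v kvertex set \<Rightarrow> bool" where
  "unsep u w \<longleftrightarrow> (\<forall>v \<in> ext_verts. u \<notin> ext_star v \<longrightarrow> w \<notin> ext_star v \<longrightarrow> (u, w) \<in> (ext_adj_off v)\<^sup>*)"

lemma ext_star_fst: "w \<in> ext_star v \<Longrightarrow> fst w \<in> st (fst v)"
  using ext_adj_fst[of v w] by (auto simp: ext_star_def st_def)

lemma ext_star_cl: "g \<in> G \<Longrightarrow> b \<in> st a \<Longrightarrow> par_class g b \<in> ext_star (par_class g a)"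
  by (auto simp: st_def ext_star_def ext_adj_cl)

text \<open>Edges dual to one hyperplane differ by letters of \<open>lk a\<close> and possibly by
  reversal, that is, by one letter \<open>a\<close>. Both stay inside \<open>st a\<close>, so a
  hyperplane determines a vertex of the extension graph.\<close>

lemma hyp_class:
  assumes "k \<in> G" "x \<in> G" "fst c \<in> V" "hyp k e = hyp x c"
  shows "fst e = fst c" "k \<in> coset (st (fst c)) x"
proof -
  obtain a d where c: "c = (a, d)" by force
  show e: "fst e = fst c" using assms(4) by (metis fst_hyp)
  then obtain d' where e': "e = (a, d')" using c by (metis fst_conv prod.collapse)
  have V: "a \<in> V" "st a \<subseteq> V" "lk a \<subseteq> st a" using assms c st_subset by (auto simp: st_def)
  define k' where "k' = (if d' then k else act k [(a, False)])"
  define x' where "x' = (if d then x else act x [(a, False)])"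
  have G': "k' \<in> G" "x' \<in> G" using assms V by (auto simp: k'_def x'_def)
  have "coset (lk a) k' = coset (lk a) x'"
    using assms(4) c e' by (simp add: hyp.simps k'_def x'_def)
  then have 1: "k' \<in> coset (st a) x'"
    using coset_eq_iff[OF lk_subset G'(2,1)] coset_mono[OF V(3)] by blast
  have 2: "x' \<in> coset (st a) x"
    using coset_act[of "[(a, False)]" "st a" x] assms V by (auto simp: x'_def st_def)
  have 3: "k' \<in> coset (st a) k"
    using coset_act[of "[(a, False)]" "st a" k] assms V by (auto simp: k'_def st_def)
  show "k \<in> coset (st (fst c)) x"
    using 1 2 3 coset_eq[OF V(2)] coset_self assms G' c by (metis fst_conv)
qed

text \<open>A path inside the parallel set of \<open>u\<close> that crosses the hyperplane has an
  edge dual to it. The start of this edge lies in both parallel sets, and its label lies in the star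
  of the label of \<open>u\<close>, which puts \<open>u\<close> into the excluded star.\<close>

lemma not_sep_in_class:
  assumes "u \<in> ext_verts" "x \<in> G" "fst c \<in> V" "u \<notin> ext_star (par_class x (fst c))" "y \<in> snd u" "z \<in> snd u"
  shows "\<not> sep (hyp x c) y z"
proof
  assume s: "sep (hyp x c) y z"
  define a b where "a = fst c" and "b = fst u"
  have y: "y \<in> G" "b \<in> V" "u = par_class y b" using ext_verts_at[OF assms(1,5)] by (auto simp: b_def)
  then have "z \<in> coset (st b) y" using assms(6) by (metis par_class_simps(2))
  then obtain w where w: "w \<in> words (st b)" "z = act y w" by (rule cosetE)
  have wV: "w \<in> words V" using w words_mono[OF st_subset] y by blast
  have "hyp x c \<in> set (hyps y w)" using sep_imp_crossed[OF y(1) wV] s w by simp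
  then obtain ys zs where "hyps y w = ys @ hyp x c # zs" by (auto simp: in_set_conv_decomp)
  then obtain w1 e w2 where e: "w = w1 @ e # w2" "hyp (act y w1) e = hyp x c"
    using y wV by (auto elim: hyps_split)
  define k where "k = act y w1"
  have k: "k \<in> G" "k \<in> coset (st b) y"
    using e w wV y coset_act[of w1 "st b" y] by (auto simp: k_def)
  have ka: "fst e = a" "k \<in> coset (st a) x"
    using hyp_class[OF k(1) assms(2,3), of e] e by (auto simp: k_def a_def)
  have "a \<in> st b" using e w ka by auto
  moreover have "u = par_class k b" using par_class_eq_iff[of y k b b] y k by simp
  moreover have "par_class x a = par_class k a" using par_class_eq_iff[of x k a a] k ka assms by (simp add: a_def)
  moreover have "b \<in> st a" using \<open>a \<in> st b\<close> lk_sym by (auto simp: st_def)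
  ultimately show False using ext_star_cl[OF k(1), of b a] assms(4) by (simp add: a_def)
qed

text \<open>A parallel set is a product: letters \<open>a\<close> commute with \<open>lk a\<close>
  and can be collected in front.\<close>

lemma act_st_decompose:
  assumes "y \<in> G" "u \<in> words (st a)" "a \<in> V"
  obtains u1 u2 where "u1 \<in> words {a}" "u2 \<in> words (lk a)" "act y u = act (act y u1) u2"
proof -
  have "\<exists>u1 \<in> words {a}. \<exists>u2 \<in> words (lk a). act y u = act (act y u1) u2"
    using assms(2)
  proof (induction u rule: rev_induct)
    case Nil
    then show ?case using assms by (intro bexI[of _ "[]"]) auto
  next
    case (snoc x u)
    then obtain u1 u2 where u: "u1 \<in> words {a}" "u2 \<in> words (lk a)" "act y u = act (act y u1) u2"
      by auto
    have V: "u1 \<in> words V" "u2 \<in> words V" "u \<in> words V" "fst x \<in> V" "act y u1 \<in> G"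
      using u words_mono[of "{a}" V] words_mono[OF lk_subset] words_mono[OF st_subset] assms snoc.prems
        st_subset[OF assms(3)] by auto
    have *: "act y (u @ [x]) = act (act (act y u1) u2) [x]"
      using u V assms by (simp add: act_append)
    show ?case
    proof (cases "fst x = a")
      case True
      then have "act y (u @ [x]) = act (act y (u1 @ [x])) u2"
        using * act_commute_word[OF u(2) V(5) assms(3), of "snd x"] V assms
        by (metis act_append prod.collapse words_simps(1,2))
      then show ?thesis using u True by (intro bexI[of _ "u1 @ [x]"] bexI[of _ u2]) auto
    next
      case False
      then have "fst x \<in> lk a" using snoc.prems by (auto simp: st_def)
      moreover have "act y (u @ [x]) = act (act y u1) (u2 @ [x])"
        using * V by (simp add: act_append)
      ultimately show ?thesis using u by (intro bexI[of _ u1] bexI[of _ "u2 @ [x]"]) auto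
    qed
  qed
  then show thesis using that by blast
qed

text \<open>The converse of \<open>not_sep_in_class\<close>. From a common vertex \<open>p\<close>,
  the vertex \<open>x\<close> is reached by a power of \<open>a\<close> followed by a word in
  \<open>lk a\<close>. The power of \<open>a\<close> stays in the parallel set of \<open>w\<close>,
  the rest only moves parallel to the hyperplane, so an edge dual to it is found inside the parallel
  set.\<close>

lemma crossed_in_class:
  assumes "w \<in> ext_verts" "x \<in> G" "fst c \<in> V" "w \<in> ext_star (par_class x (fst c))"
  obtains y z where "y \<in> snd w" "z \<in> snd w" "sep (hyp x c) y z"
proof -
  obtain a d where c: "c = (a, d)" by force
  define b where "b = fst w"
  have b: "b \<in> st a" "a \<in> st b" using ext_star_fst[OF assms(4)] c lk_sym by (auto simp: b_def st_def)
  have V: "a \<in> V" "st a \<subseteq> V" using assms c st_subset by auto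
  have "\<exists>p. p \<in> snd w \<and> p \<in> coset (st a) x"
  proof (cases "w = par_class x a")
    case True
    then show ?thesis using coset_self[OF assms(2), of "st a"] by auto
  next
    case False
    then show ?thesis using assms(4) ext_adj_common[of "par_class x a" w] c by (auto simp: ext_star_def)
  qed
  then obtain p where p: "p \<in> snd w" "p \<in> coset (st a) x" by blast
  have pG: "p \<in> G" "b \<in> V" "w = par_class p b" using ext_verts_at[OF assms(1) p(1)] by (auto simp: b_def)
  have "x \<in> coset (st a) p" using coset_sym[OF V(2) assms(2) p(2)] .
  then obtain u where "u \<in> words (st a)" "x = act p u" by (rule cosetE)
  then obtain u1 u2 where u: "u1 \<in> words {a}" "u2 \<in> words (lk a)" "x = act (act p u1) u2"
    using act_st_decompose[OF pG(1) _ V(1)] by metis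
  define y where "y = act p u1"
  have uV: "u1 \<in> words (st b)" "u1 \<in> words V"
    using u words_mono[of "{a}"] b V by auto
  have y: "y \<in> G" "y \<in> coset (st b) p" using pG uV coset_act by (auto simp: y_def)
  have "hyp x c = hyp y c"
    using hyp_parallel[OF y(1) _ V(1)] u coset_act[of u2 "lk a" y] c by (simp add: y_def)
  then have "sep (hyp x c) y (act y [c])"
    using height_step[OF y(1), of c "hyp x c"] V c by (auto simp: sep_def)
  moreover have "act y [c] \<in> coset (st b) p"
    using coset_act[of "[c]" "st b" y] coset_eq[OF st_subset[OF pG(2)] pG(1) y(2)] b c by simp
  ultimately show thesis using that y pG by (metis par_class_simps(2))
qed

text \<open>Disjoint parallel sets are separated by a hyperplane; let \<open>v\<close> be its class.
  Neither set is crossed by it, so \<open>u\<close> and \<open>w\<close> are off the star of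
  \<open>v\<close>. Along a path off this star the height stays constant, as it is constant on each
  parallel set and consecutive ones share a vertex. Hence such a path cannot join \<open>u\<close>
  to \<open>w\<close>.\<close>

lemma unsep_imp_common:
  assumes "u \<in> ext_verts" "w \<in> ext_verts" "unsep u w"
  shows "snd u \<inter> snd w \<noteq> {}"
proof
  assume dis: "snd u \<inter> snd w = {}"
  obtain p a where p: "p \<in> G" "a \<in> V" "u = par_class p a" using assms(1) by (auto simp: ext_verts_def)
  obtain q b where q: "q \<in> G" "b \<in> V" "w = par_class q b" using assms(2) by (auto simp: ext_verts_def)
  obtain x c where x: "x \<in> coset (st a) p" "fst c \<in> V"
    "\<And>y z. y \<in> coset (st a) p \<Longrightarrow> z \<in> coset (st b) q \<Longrightarrow> sep (hyp x c) y z"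
    using disjoint_cosets_separated[OF p(1) q(1) st_subset[OF p(2)] st_subset[OF q(2)]] dis p q by auto
  have xG: "x \<in> G" using x coset_subset st_subset p by blast
  define h where "h = hyp x c"
  define v where "v = par_class x (fst c)"
  have v: "v \<in> ext_verts" using xG x by (simp add: v_def)
  have SG: "coset (st a) p \<subseteq> G" "coset (st b) q \<subseteq> G"
    using coset_subset st_subset p q by auto
  have "u \<notin> ext_star v"
  proof
    assume "u \<in> ext_star v"
    then obtain y z where "y \<in> coset (st a) p" "z \<in> coset (st a) p" "sep h y z"
      using crossed_in_class[OF assms(1) xG x(2)] p by (auto simp: h_def v_def)
    then show False
      using x(3)[of y q] x(3)[of z q] coset_self[OF q(1)] SG
        sep_two_sides[OF xG x(2) _ _ q(1) h_def, of y z] by (auto simp: h_def)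
  qed
  moreover have "w \<notin> ext_star v"
  proof
    assume "w \<in> ext_star v"
    then obtain y z where "y \<in> coset (st b) q" "z \<in> coset (st b) q" "sep h y z"
      using crossed_in_class[OF assms(2) xG x(2)] q by (auto simp: h_def v_def)
    then show False
      using x(3)[of p y] x(3)[of p z] coset_self[OF p(1)] SG
        sep_two_sides[OF xG x(2) _ _ p(1) h_def, of y z] by (auto simp: h_def sep_def)
  qed
  ultimately have "(u, w) \<in> (ext_adj_off v)\<^sup>*" using assms(3) v by (auto simp: unsep_def)
  moreover have "\<forall>y \<in> snd u. height h y = height h x"
  proof
    fix y assume "y \<in> snd u"
    moreover have "x \<in> snd u" using x(1) p by simp
    ultimately have "\<not> sep (hyp x c) y x"
      using not_sep_in_class[OF assms(1) xG x(2)] \<open>u \<notin> ext_star v\<close> unfolding v_def by blast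
    then show "height h y = height h x" by (simp add: sep_def h_def)
  qed
  ultimately have "\<forall>y \<in> snd w. height h y = height h x"
  proof (induction rule: rtrancl_induct)
    case (step y z)
    then have yz: "ext_adj y z" "z \<notin> ext_star v" "z \<in> ext_verts" using ext_adj_EV[of y z] by (auto simp: ext_adj_off_def)
    then obtain k where k: "k \<in> snd y" "k \<in> snd z" using ext_adj_common by blast
    show ?case
    proof
      fix z' assume "z' \<in> snd z"
      then have "\<not> sep (hyp x c) k z'"
        using not_sep_in_class[OF yz(3) xG x(2)] yz(2) k unfolding v_def by blast
      then have "height h k = height h z'" by (simp add: sep_def h_def)
      moreover have "height h k = height h x" using k step.IH step.prems by blast
      ultimately show "height h z' = height h x" by simp
    qed
  qed
  then show False using x(3)[OF x(1), of q] coset_self[OF q(1)] q by (auto simp: sep_def h_def)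
qed

lemma adj_in_par_class:
  assumes "(c, d) \<in> (adj_in T)\<^sup>*" "p \<in> G" "\<And>c. c \<in> T \<Longrightarrow> par_class p c \<notin> ext_star v"
  shows "(par_class p c, par_class p d) \<in> (ext_adj_off v)\<^sup>*"
  using assms(1)
proof (induction rule: rtrancl_induct)
  case (step y z)
  then have "(par_class p y, par_class p z) \<in> ext_adj_off v" using ext_adj_cl assms by (auto simp: ext_adj_off_def adj_in_def)
  then show ?case using step by (meson rtrancl.rtrancl_into_rtrancl)
qed simp

lemma adj_in_mono: "S \<subseteq> T \<Longrightarrow> (adj_in S)\<^sup>* \<subseteq> (adj_in T)\<^sup>*"
  by (rule rtrancl_mono) (auto simp: adj_in_def)

lemma adj_in_sym: "(a, b) \<in> (adj_in T)\<^sup>* \<Longrightarrow> (b, a) \<in> (adj_in T)\<^sup>*"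
  by (rule symD[OF sym_rtrancl]) (auto simp: sym_def adj_in_def lk_sym)

text \<open>The classes through \<open>p\<close> form a copy of \<Gamma>, and what the star of
  \<open>v\<close> removes from it is contained in the star of a single vertex \<open>x\<close>. The
  rest of \<Gamma> is connected since \<Gamma> is atomic; what remains is to attach the surviving
  vertices of \<open>st x\<close> to it.\<close>

lemma common_imp_unsep:
  assumes "p \<in> G" "a \<in> V" "b \<in> V"
  shows "unsep (par_class p a) (par_class p b)"
  unfolding unsep_def
proof (intro ballI impI)
  fix v assume v: "v \<in> ext_verts" and na: "par_class p a \<notin> ext_star v" and nb: "par_class p b \<notin> ext_star v"
  show "(par_class p a, par_class p b) \<in> (ext_adj_off v)\<^sup>*"
  proof (cases "p \<in> snd v")
    case True
    define x where "x = fst v"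
    have x: "x \<in> V" "v = par_class p x" using ext_verts_at[OF v True] by (auto simp: x_def)
    have *: "par_class p c \<in> ext_star v \<longleftrightarrow> c \<in> st x" for c
      using ext_star_cl[OF assms(1), of c x] ext_star_fst[of "par_class p c" v] x by auto
    show ?thesis
      by (rule adj_in_par_class[OF star_complement_connected[OF x(1)]]) (use na nb * assms in auto)
  next
    case False
    obtain q y where q: "q \<in> G" "y \<in> V" "v = par_class q y" using v by (auto simp: ext_verts_def)
    obtain u where u: "u \<in> words V" "act p u \<in> coset (st y) q"
        "\<And>z h. z \<in> coset (st y) q \<Longrightarrow> h \<in> set (hyps p u) \<Longrightarrow> sep h p z"
      using gate[OF assms(1) q(1) st_subset[OF q(2)]] by metis
    have "u \<noteq> []" using u(2) False q assms by auto
    then obtain e u' where e: "u = e # u'" by (cases u) auto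
    \<comment> \<open>The first hyperplane towards the parallel set of \<open>v\<close> separates
      \<open>p\<close> from all of it. A parallel set through \<open>p\<close> that meets it must
      cross this hyperplane, so its label is equal or adjacent to \<open>x\<close>.\<close>
    define x where "x = fst e"
    have x: "x \<in> V" using e u x_def by simp
    define T where "T = {c \<in> V. par_class p c \<notin> ext_star v}"
    have common: "\<exists>z. z \<in> coset (st c) p \<and> z \<in> coset (st y) q" if "par_class p c \<in> ext_star v" for c
    proof (cases "par_class p c = v")
      case True
      then have "snd (par_class p c) = snd (par_class q y)" using q by simp
      then have "coset (st c) p = coset (st y) q" by simp
      then show ?thesis using coset_self[OF assms(1), of "st c"] by auto
    next
      case False
      then show ?thesis using that ext_adj_common[of v "par_class p c"] q by (auto simp: ext_star_def)
    qed
    have stx: "c \<in> st x" if cv: "par_class p c \<in> ext_star v" "c \<in> V" for c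
    proof -
      obtain z where z: "z \<in> coset (st c) p" "z \<in> coset (st y) q" using common[OF cv(1)] by blast
      obtain w where w: "w \<in> words (st c)" "z = act p w" using z(1) by (rule cosetE)
      have "sep (hyp p e) p z" using u(3)[OF z(2)] e by simp
      then have "hyp p e \<in> set (hyps p w)"
        using sep_imp_crossed[OF assms(1) words_mono[OF st_subset[OF cv(2)] w(1)]] w(2) by simp
      then have "x \<in> st c" using w(1) words_iff_hyps[of w "st c" p] by (auto simp: x_def)
      then show ?thesis using lk_sym by (auto simp: st_def)
    qed
    have sub: "V - st x \<subseteq> T" using stx by (auto simp: T_def)
    \<comment> \<open>A neighbour of \<open>c\<close> other than \<open>x\<close> lies outside
      \<open>st x\<close>, as there are no triangles.\<close>
    have nb_conn: "\<exists>d \<in> V - st x. (c, d) \<in> (adj_in T)\<^sup>*" if c: "c \<in> T" "c \<in> lk x" for c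
    proof -
      obtain d where d: "d \<in> lk c" "d \<noteq> x" using other_neighbour[of c x] c by (auto simp: T_def)
      then have "d \<in> V - st x" using no_triangle[of c x d] c lkD(2) lk_sym by (auto simp: st_def)
      then show ?thesis using d sub c by (intro bexI[of _ d]) (auto simp: adj_in_def)
    qed
    have conn: "\<exists>d \<in> V - st x. (c, d) \<in> (adj_in T)\<^sup>*" if c: "c \<in> T" for c
    proof (cases "c = x")
      case False
      then show ?thesis using nb_conn[OF c] c by (auto simp: T_def st_def)
    next
      case True
      \<comment> \<open>Only \<open>x\<close> itself may lose its neighbours. If it lost two,
        \<open>b1\<close> and \<open>b2\<close>, the label of \<open>v\<close> would be adjacent to
        both, hence equal to \<open>x\<close>. Helly for the three parallel sets then gives a vertex
        of that of \<open>v\<close> on the \<open>x\<close>-line through \<open>p\<close>, which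
        puts \<open>p\<close> into the parallel set of \<open>v\<close>.\<close>
      have "\<exists>b \<in> lk x. b \<in> T"
      proof (rule ccontr)
        assume nT: "\<not> ?thesis"
        obtain b1 b2 where b: "b1 \<in> lk x" "b2 \<in> lk x" "b1 \<noteq> b2" using two_neighbours[OF x] by metis
        have bV: "b1 \<in> V" "b2 \<in> V" using b lkD by blast+
        have be: "par_class p b1 \<in> ext_star v" "par_class p b2 \<in> ext_star v" using b bV nT by (auto simp: T_def)
        have ne: "par_class p c \<noteq> v" for c using False coset_self[OF assms(1)] by auto
        have "y \<in> lk b1" "y \<in> lk b2"
          using be ne ext_adj_fst[of v "par_class p b1"] ext_adj_fst[of v "par_class p b2"] q lk_sym[of y]
          by (simp_all add: ext_star_def)
        then have "y = x"
          using st_Int_neighbours[OF b] by (auto simp: st_def)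
        define Pf where "Pf = (\<lambda>i :: nat. if i = 2 then q else p)"
        define Sf where "Sf = (\<lambda>i :: nat. if i = 0 then st b1 else if i = 1 then st b2 else st y)"
        have ps: "p \<in> coset S p" "q \<in> coset S q" for S using assms q by auto
        have fin: "finite {0, 1, 2 :: nat}" "{0, 1, 2 :: nat} \<noteq> {}" by auto
        have A: "\<And>i. i \<in> {0, 1, 2} \<Longrightarrow> Pf i \<in> G \<and> Sf i \<subseteq> V"
          using assms q bV st_subset by (auto simp: Pf_def Sf_def)
        have B: "\<And>i j. i \<in> {0, 1, 2} \<Longrightarrow> j \<in> {0, 1, 2} \<Longrightarrow>
            coset (Sf i) (Pf i) \<inter> coset (Sf j) (Pf j) \<noteq> {}"
          using common[OF be(1)] common[OF be(2)] ps by (auto simp: Pf_def Sf_def)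
        have "\<exists>r \<in> G. \<forall>i \<in> {0, 1, 2}. r \<in> coset (Sf i) (Pf i)"
          using fin A B by (rule helly)
        then obtain r where r: "r \<in> G" "\<And>i. i \<in> {0, 1, 2} \<Longrightarrow> r \<in> coset (Sf i) (Pf i)"
          by blast
        have r': "r \<in> coset (st b1) p" "r \<in> coset (st b2) p" "r \<in> coset (st x) q"
          using r(2)[of 0] r(2)[of 1] r(2)[of 2] \<open>y = x\<close> by (simp_all add: Pf_def Sf_def)
        have "r \<in> coset {x} p"
          using r' coset_Int[OF assms(1) st_subset st_subset, of b1 b2] bV st_Int_neighbours[OF b] by auto
        then have "r \<in> coset (st x) p" using coset_mono[of "{x}" "st x"] by (auto simp: st_def)
        then have "p \<in> coset (st x) q"
          using r'(3) coset_eq[OF st_subset[OF x]] assms(1) q(1) coset_self by metis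
        then show False using False q \<open>y = x\<close> by simp
      qed
      then obtain b where b: "b \<in> lk x" "b \<in> T" by blast
      then obtain d where d: "d \<in> V - st x" "(b, d) \<in> (adj_in T)\<^sup>*" using nb_conn by blast
      have "(c, b) \<in> adj_in T" using True b c by (auto simp: adj_in_def)
      then show ?thesis using d by (meson converse_rtrancl_into_rtrancl)
    qed
    have "a \<in> T" "b \<in> T" using na nb assms by (auto simp: T_def)
    then obtain a' b' where ab: "a' \<in> V - st x" "(a, a') \<in> (adj_in T)\<^sup>*"
        "b' \<in> V - st x" "(b, b') \<in> (adj_in T)\<^sup>*"
      using conn by meson
    have "(a', b') \<in> (adj_in T)\<^sup>*"
      using star_complement_connected[OF x ab(1,3)] adj_in_mono[OF sub] by blast
    then have "(a, b) \<in> (adj_in T)\<^sup>*"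
      using ab adj_in_sym by (meson rtrancl_trans)
    then show ?thesis by (rule adj_in_par_class) (use assms in \<open>auto simp: T_def\<close>)
  qed
qed

section \<open>Recovering vertices, lines and flats from parallel sets\<close>

lemma coset_empty: "g \<in> G \<Longrightarrow> coset {} g = {g}"
  by (auto simp: coset_def words_iff)

text \<open>Already the stars of \<open>b\<close>, \<open>c\<close> and \<open>d\<close> have no
  common vertex: those of two neighbours of \<open>a\<close> meet only in \<open>a\<close>, and
  \<open>d\<close> is not adjacent to \<open>a\<close>. So the corresponding cosets through
  \<open>p\<close> meet only in \<open>p\<close>.\<close>

lemma vertex_determined:
  assumes "p \<in> G" "\<And>a. a \<in> V \<Longrightarrow> q \<in> coset (st a) p"
  shows "q = p"
proof -
  obtain a where a: "a \<in> V" using atomic by (auto simp: atomic_def)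
  obtain b c where b: "b \<in> lk a" "c \<in> lk a" "b \<noteq> c" using two_neighbours[OF a] by metis
  obtain d where d: "d \<in> lk b" "d \<noteq> a" using other_neighbour[of b a] b lkD by metis
  have V: "b \<in> V" "c \<in> V" "d \<in> V" using b d lkD by blast+
  have "a \<notin> st d" using no_triangle[of b a d] b d lk_sym by (auto simp: st_def)
  then have "{a} \<inter> st d = {}" by simp
  moreover have "q \<in> coset {a} p"
    using coset_Int[OF assms(1) st_subset st_subset, of b c] V assms(2) st_Int_neighbours[OF b] by auto
  moreover have "q \<in> coset (st d) p" using assms(2) V by blast
  ultimately have "q \<in> coset {} p"
    using coset_Int[OF assms(1), of "{a}" "st d"] a V st_subset by auto
  then show ?thesis using coset_empty assms by auto
qed

text \<open>Pairwise intersections come from \<open>unsep_imp_common\<close>, a common vertex from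
  Helly.\<close>

lemma unsep_family_common:
  assumes "finite A" "A \<noteq> {}" "A \<subseteq> ext_verts" "\<And>u w. u \<in> A \<Longrightarrow> w \<in> A \<Longrightarrow> unsep u w"
  shows "\<exists>p \<in> G. \<forall>u \<in> A. p \<in> snd u"
proof -
  have "\<forall>u \<in> A. \<exists>g. g \<in> G \<and> fst u \<in> V \<and> snd u = coset (st (fst u)) g"
  proof
    fix u assume "u \<in> A"
    then obtain g a where "g \<in> G" "a \<in> V" "u = par_class g a" using assms(3) by (auto simp: ext_verts_def)
    then show "\<exists>g. g \<in> G \<and> fst u \<in> V \<and> snd u = coset (st (fst u)) g" by auto
  qed
  then obtain P where P: "\<And>u. u \<in> A \<Longrightarrow> P u \<in> G \<and> fst u \<in> V \<and> snd u = coset (st (fst u)) (P u)"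
    by metis
  have "coset (st (fst u)) (P u) \<inter> coset (st (fst w)) (P w) \<noteq> {}"
    if "u \<in> A" "w \<in> A" for u w
    using unsep_imp_common[of u w] assms(3,4) P that by auto
  then have "\<exists>p \<in> G. \<forall>u \<in> A. p \<in> coset (st (fst u)) (P u)"
    by (intro helly[OF assms(1,2), of P "\<lambda>u. st (fst u)"]) (use P st_subset in simp_all)
  then show ?thesis using P by auto
qed

lemma coset_edge:
  assumes "g \<in> G" "b \<in> lk a"
  shows "coset {a, b} g = coset (st a) g \<inter> coset (st b) g"
  using coset_Int[OF assms(1) st_subset st_subset, of a b] assms st_Int_edge lkD by auto

text \<open>Two neighbours cut out the line; all of them are used because this description involves
  no choice and can be transported by an isomorphism.\<close>

lemma coset_vertex:
  assumes "g \<in> G" "a \<in> V"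
  shows "coset {a} g = {q \<in> G. \<forall>b \<in> lk a. q \<in> coset (st b) g}"
proof -
  obtain b c where b: "b \<in> lk a" "c \<in> lk a" "b \<noteq> c" using two_neighbours[OF assms(2)] by metis
  have "coset {a} g = coset (st b) g \<inter> coset (st c) g"
    using coset_Int[OF assms(1) st_subset st_subset, of b c] b lkD st_Int_neighbours[OF b] by auto
  moreover have "coset {a} g \<subseteq> coset (st d) g" if "d \<in> lk a" for d
    by (rule coset_mono) (use that lk_sym in \<open>auto simp: st_def\<close>)
  moreover have "coset {a} g \<subseteq> G" using coset_subset assms by simp
  ultimately show ?thesis using b by blast
qed

end

section \<open>Isomorphisms of line graphs\<close>

text \<open>A triangle and a star with three edges have the same line graph;
  \<open>triangle_free\<close> removes this ambiguity. \<open>degree\<close> makes a vertex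
  recoverable from its set of edges.\<close>

locale incidence =
  fixes N :: "'u set" and E :: "'e set" and inc :: "'u \<Rightarrow> 'e \<Rightarrow> bool"
  assumes simple: "\<lbrakk>e \<in> E; e' \<in> E; u \<in> N; w \<in> N; u \<noteq> w; inc u e; inc w e; inc u e'; inc w e'\<rbrakk> \<Longrightarrow> e = e'"
    and degree: "u \<in> N \<Longrightarrow> \<exists>e \<in> E. \<exists>e' \<in> E. e \<noteq> e' \<and> inc u e \<and> inc u e'"
    and triangle_free: "\<lbrakk>u \<in> N; v \<in> N; w \<in> N; u \<noteq> v; v \<noteq> w; w \<noteq> u; e1 \<in> E; e2 \<in> E; e3 \<in> E;
      inc u e1; inc v e1; inc v e2; inc w e2; inc w e3; inc u e3\<rbrakk> \<Longrightarrow> False"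
begin

lemma same_star: "u \<in> N \<Longrightarrow> w \<in> N \<Longrightarrow> (\<And>e. e \<in> E \<Longrightarrow> inc u e \<Longrightarrow> inc w e) \<Longrightarrow> u = w"
  using degree[of u] simple[of _ _ u w] by metis

end

locale line_graph_iso = A: incidence N E inc + B: incidence N' E' inc'
  for N :: "'u set" and E :: "'e set" and inc and N' :: "'x set" and E' :: "'y set" and inc' +
  fixes f :: "'e \<Rightarrow> 'y"
  assumes bij: "bij_betw f E E'"
    and meet: "\<lbrakk>e1 \<in> E; e2 \<in> E; e1 \<noteq> e2\<rbrakk> \<Longrightarrow>
      (\<exists>u \<in> N. inc u e1 \<and> inc u e2) \<longleftrightarrow> (\<exists>u \<in> N'. inc' u (f e1) \<and> inc' u (f e2))"
begin

text \<open>In the absence of triangles, edges that meet pairwise share a vertex.\<close>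

lemma star_image:
  assumes "u \<in> N"
  shows "\<exists>u' \<in> N'. \<forall>e \<in> E. inc u e \<longrightarrow> inc' u' (f e)"
proof -
  obtain e1 e2 where e: "e1 \<in> E" "e2 \<in> E" "e1 \<noteq> e2" "inc u e1" "inc u e2"
    using A.degree[OF assms] by blast
  then obtain u' where u': "u' \<in> N'" "inc' u' (f e1)" "inc' u' (f e2)"
    using meet assms by blast
  have fE: "f e \<in> E'" if "e \<in> E" for e using bij that by (auto simp: bij_betw_def)
  have inj: "f e = f e' \<Longrightarrow> e = e'" if "e \<in> E" "e' \<in> E" for e e'
    using bij that by (auto simp: bij_betw_def inj_on_def)
  have "inc' u' (f e)" if e': "e \<in> E" "inc u e" for e
  proof (rule ccontr)
    assume n: "\<not> inc' u' (f e)"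
    then have "e \<noteq> e1" "e \<noteq> e2" using u' by auto
    then obtain x y where x: "x \<in> N'" "inc' x (f e)" "inc' x (f e1)"
      and y: "y \<in> N'" "inc' y (f e)" "inc' y (f e2)"
      using meet[OF e'(1) e(1)] meet[OF e'(1) e(2)] assms e e' by blast
    have "x \<noteq> y" using B.simple[of "f e1" "f e2" u' x] u' x y e fE inj n by blast
    then show False
      using B.triangle_free[of u' x y "f e1" "f e" "f e2"] u' x y e e' fE n by blast
  qed
  then show ?thesis using u'(1) by blast
qed

lemma inverse: "line_graph_iso N' E' inc' N E inc (inv_into E f)"
proof
  show "bij_betw (inv_into E f) E' E" using bij by (rule bij_betw_inv_into)
next
  fix e1 e2 assume e: "e1 \<in> E'" "e2 \<in> E'" "e1 \<noteq> e2"
  have *: "inv_into E f e \<in> E \<and> f (inv_into E f e) = e" if "e \<in> E'" for e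
    using bij_betw_inv_into_right[OF bij that] bij_betwE[OF bij_betw_inv_into[OF bij]] that by blast
  have "inv_into E f e1 \<noteq> inv_into E f e2" using *[OF e(1)] *[OF e(2)] e(3) by metis
  then show "(\<exists>u \<in> N'. inc' u e1 \<and> inc' u e2) \<longleftrightarrow>
      (\<exists>u \<in> N. inc u (inv_into E f e1) \<and> inc u (inv_into E f e2))"
    using meet[of "inv_into E f e1" "inv_into E f e2"] *[OF e(1)] *[OF e(2)] by simp
qed

text \<open>The star of \<open>u\<close> is mapped into the star of some \<open>u'\<close>, whose
  preimage lies in the star of some \<open>w\<close>. As nested stars agree, \<open>u = w\<close>
  and both inclusions are equalities.\<close>

lemma star_image_iff:
  assumes "u \<in> N"
  shows "\<exists>u' \<in> N'. \<forall>e \<in> E. inc u e \<longleftrightarrow> inc' u' (f e)"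
proof -
  interpret I: line_graph_iso N' E' inc' N E inc "inv_into E f" by (rule inverse)
  obtain u' where u': "u' \<in> N'" "\<And>e. e \<in> E \<Longrightarrow> inc u e \<Longrightarrow> inc' u' (f e)"
    using star_image[OF assms] by blast
  obtain w where w: "w \<in> N" "\<And>e. e \<in> E' \<Longrightarrow> inc' u' e \<Longrightarrow> inc w (inv_into E f e)"
    using I.star_image[OF u'(1)] by blast
  have *: "f e \<in> E' \<and> inv_into E f (f e) = e" if "e \<in> E" for e
    using bij that by (auto simp: bij_betw_def)
  have "u = w" by (rule A.same_star[OF assms w(1)]) (use u' w * in metis)
  then show ?thesis using u' w * by metis
qed

lemma vertex_bijection:
  "\<exists>F. bij_betw F N N' \<and> (\<forall>u \<in> N. \<forall>e \<in> E. inc u e \<longleftrightarrow> inc' (F u) (f e))"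
proof -
  interpret I: line_graph_iso N' E' inc' N E inc "inv_into E f" by (rule inverse)
  obtain F where F: "\<And>u. u \<in> N \<Longrightarrow> F u \<in> N' \<and> (\<forall>e \<in> E. inc u e \<longleftrightarrow> inc' (F u) (f e))"
    using star_image_iff by metis
  have "inj_on F N"
  proof
    fix u w assume "u \<in> N" "w \<in> N" "F u = F w"
    then show "u = w" by (intro A.same_star) (use F in metis)+
  qed
  moreover have "u' \<in> F ` N" if u': "u' \<in> N'" for u'
  proof -
    obtain u where u: "u \<in> N" "\<And>e. e \<in> E' \<Longrightarrow> inc' u' e \<longleftrightarrow> inc u (inv_into E f e)"
      using I.star_image_iff[OF u'] by blast
    have *: "inv_into E f e \<in> E \<and> f (inv_into E f e) = e" if "e \<in> E'" for e
      using bij_betw_inv_into_right[OF bij that] bij_betwE[OF bij_betw_inv_into[OF bij]] that by blast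
    have "u' = F u" by (rule B.same_star) (use F u u' * in metis)+
    then show ?thesis using u by blast
  qed
  ultimately have "bij_betw F N N'" using F by (auto simp: bij_betw_def)
  then show ?thesis using F by blast
qed

end

section \<open>Isomorphisms of extension graphs\<close>

locale extension_graph_iso = A: atomic_graph \<Gamma> + B: atomic_graph \<Gamma>'
  for \<Gamma> :: "'v sgraph" and \<Gamma>' :: "'w sgraph" +
  fixes F :: "'v \<times> 'v kvertex set \<Rightarrow> 'w \<times> 'w kvertex set"
  assumes bij: "bij_betw F A.ext_verts B.ext_verts"
    and adj: "\<lbrakk>u \<in> A.ext_verts; w \<in> A.ext_verts\<rbrakk> \<Longrightarrow> A.ext_adj u w \<longleftrightarrow> B.ext_adj (F u) (F w)"
begin

lemma F_in: "u \<in> A.ext_verts \<Longrightarrow> F u \<in> B.ext_verts"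
  using bij by (auto simp: bij_betw_def)

lemma F_eq: "u \<in> A.ext_verts \<Longrightarrow> w \<in> A.ext_verts \<Longrightarrow> F u = F w \<longleftrightarrow> u = w"
  using bij by (auto simp: bij_betw_def inj_on_def)

lemma F_est: "u \<in> A.ext_verts \<Longrightarrow> v \<in> A.ext_verts \<Longrightarrow> F u \<in> B.ext_star (F v) \<longleftrightarrow> u \<in> A.ext_star v"
  using adj[of v u] F_eq[of u v] by (auto simp: A.ext_star_def B.ext_star_def)

lemma F_unsep:
  assumes "u \<in> A.ext_verts" "w \<in> A.ext_verts" "A.unsep u w"
  shows "B.unsep (F u) (F w)"
  unfolding B.unsep_def
proof (intro ballI impI)
  fix v' assume v': "v' \<in> B.ext_verts" "F u \<notin> B.ext_star v'" "F w \<notin> B.ext_star v'"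
  then obtain v where v: "v \<in> A.ext_verts" "v' = F v"
    using bij_betw_imp_surj_on[OF bij] by blast
  then have "(u, w) \<in> (A.ext_adj_off v)\<^sup>*"
    using assms v' F_est by (auto simp: A.unsep_def)
  then show "(F u, F w) \<in> (B.ext_adj_off v')\<^sup>*"
  proof (induction rule: rtrancl_induct)
    case (step y z)
    then have "A.ext_adj y z" "y \<notin> A.ext_star v" "z \<notin> A.ext_star v" "y \<in> A.ext_verts" "z \<in> A.ext_verts"
      using A.ext_adj_EV[of y z] by (auto simp: A.ext_adj_off_def)
    then have "(F y, F z) \<in> B.ext_adj_off v'"
      using v F_est adj by (auto simp: B.ext_adj_off_def)
    then show ?case using step.IH by (meson rtrancl.rtrancl_into_rtrancl)
  qed simp
qed

text \<open>The classes through \<open>p\<close> are pairwise unseparated, a property that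
  \<open>F\<close> preserves, so their finitely many images share a vertex.\<close>

lemma image_vertex:
  assumes "p \<in> A.G"
  shows "\<exists>p' \<in> B.G. \<forall>a \<in> A.V. p' \<in> snd (F (A.par_class p a))"
proof -
  define X where "X = (\<lambda>a. F (A.par_class p a)) ` A.V"
  have "finite X" "X \<noteq> {}"
    using A.atomic by (auto simp: X_def atomic_def finite_simplicial_graph_def)
  moreover have "X \<subseteq> B.ext_verts"
    unfolding X_def using assms F_in A.par_class_in_EV by blast
  moreover have "B.unsep u w" if uw: "u \<in> X" "w \<in> X" for u w
  proof -
    obtain a b where "a \<in> A.V" "b \<in> A.V" "u = F (A.par_class p a)" "w = F (A.par_class p b)"
      using uw unfolding X_def by blast
    then show ?thesis
      using F_unsep[OF _ _ A.common_imp_unsep[OF assms]] A.par_class_in_EV[OF assms] by simp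
  qed
  ultimately have "\<exists>p' \<in> B.G. \<forall>u \<in> X. p' \<in> snd u"
    by (rule B.unsep_family_common)
  then show ?thesis unfolding X_def by blast
qed

lemma inverse: "extension_graph_iso \<Gamma>' \<Gamma> (inv_into A.ext_verts F)"
proof
  show "bij_betw (inv_into A.ext_verts F) B.ext_verts A.ext_verts" using bij by (rule bij_betw_inv_into)
next
  fix u w assume u: "u \<in> B.ext_verts" "w \<in> B.ext_verts"
  have *: "inv_into A.ext_verts F x \<in> A.ext_verts \<and> F (inv_into A.ext_verts F x) = x" if "x \<in> B.ext_verts" for x
    using bij_betw_inv_into_right[OF bij that] bij_betwE[OF bij_betw_inv_into[OF bij]] that by blast
  show "B.ext_adj u w \<longleftrightarrow> A.ext_adj (inv_into A.ext_verts F u) (inv_into A.ext_verts F w)"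
    using adj[of "inv_into A.ext_verts F u" "inv_into A.ext_verts F w"] *[OF u(1)] *[OF u(2)] by simp
qed

text \<open>Image vertices are chosen independently for \<open>F\<close> and for its inverse. The
  two choices are inverse to each other because a vertex is determined by the classes through
  it.\<close>

lemma vertex_bijection:
  "\<exists>\<phi>. bij_betw \<phi> A.G B.G \<and> (\<forall>u \<in> A.ext_verts. \<forall>q \<in> A.G. q \<in> snd u \<longleftrightarrow> \<phi> q \<in> snd (F u))"
proof -
  interpret I: extension_graph_iso \<Gamma>' \<Gamma> "inv_into A.ext_verts F" by (rule inverse)
  let ?I = "inv_into A.ext_verts F"
  have IF: "?I (F u) = u" if "u \<in> A.ext_verts" for u using bij_betw_inv_into_left[OF bij that] .
  have FI: "F (?I u) = u" if "u \<in> B.ext_verts" for u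
    using bij_betw_inv_into_right[OF bij that] .
  obtain \<phi> where \<phi>: "\<And>p. p \<in> A.G \<Longrightarrow> \<phi> p \<in> B.G \<and> (\<forall>a \<in> A.V. \<phi> p \<in> snd (F (A.par_class p a)))"
    using image_vertex by metis
  obtain \<psi> where \<psi>: "\<And>p. p \<in> B.G \<Longrightarrow> \<psi> p \<in> A.G \<and> (\<forall>a \<in> B.V. \<psi> p \<in> snd (?I (B.par_class p a)))"
    using I.image_vertex by metis
  have fwd: "\<phi> q \<in> snd (F u)" if "u \<in> A.ext_verts" "q \<in> snd u" for u q
    using A.ext_verts_at[OF that] \<phi> by metis
  have bwd: "\<psi> q \<in> snd u" if "u \<in> A.ext_verts" "q \<in> snd (F u)" for u q
    using B.ext_verts_at[OF F_in[OF that(1)] that(2)] \<psi>[of q] IF[OF that(1)] by metis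
  have \<psi>\<phi>: "\<psi> (\<phi> p) = p" if "p \<in> A.G" for p
  proof (rule A.vertex_determined[OF that])
    fix a assume "a \<in> A.V"
    then show "\<psi> (\<phi> p) \<in> A.coset (A.st a) p"
      using bwd[of "A.par_class p a" "\<phi> p"] \<phi>[OF that] that by simp
  qed
  have \<phi>\<psi>: "\<phi> (\<psi> p) = p" if "p \<in> B.G" for p
  proof (rule B.vertex_determined[OF that])
    fix a assume a: "a \<in> B.V"
    have "?I (B.par_class p a) \<in> A.ext_verts" using I.F_in a that by simp
    then show "\<phi> (\<psi> p) \<in> B.coset (B.st a) p"
      using fwd[of "?I (B.par_class p a)" "\<psi> p"] \<psi>[OF that] that a FI[of "B.par_class p a"] by simp
  qed
  have "bij_betw \<phi> A.G B.G"
    by (rule bij_betw_byWitness[of _ \<psi>]) (use \<phi> \<psi> \<phi>\<psi> \<psi>\<phi> in auto)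
  moreover have "q \<in> snd u \<longleftrightarrow> \<phi> q \<in> snd (F u)" if "u \<in> A.ext_verts" "q \<in> A.G" for u q
    using fwd[OF that(1), of q] bwd[OF that(1), of "\<phi> q"] \<psi>\<phi>[OF that(2)] by auto
  ultimately show ?thesis by blast
qed

end

section \<open>Polygonal paths\<close>

declare edge_pt.simps [simp del] square_pt.simps [simp del]

lemma edge_pt_in_realization: "e \<in> cedges X \<Longrightarrow> s \<in> {0..1} \<Longrightarrow> edge_pt e s \<in> realization X"
  unfolding realization_def by blast

lemma square_pt_in_realization:
  "q \<in> csquares X \<Longrightarrow> z \<in> {0..1} \<times> {0..1} \<Longrightarrow> square_pt q z \<in> realization X"
  unfolding realization_def by blast

lemma realization_cases [consumes 1, case_names vertex edge square]:
  assumes "x \<in> realization X"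
  obtains a where "a \<in> cverts X" "x = vertex_pt a"
  | e s where "e \<in> cedges X" "s \<in> {0..1}" "x = edge_pt e s"
  | q z where "q \<in> csquares X" "z \<in> {0..1} \<times> {0..1}" "x = square_pt q z"
  using assms unfolding realization_def by blast

lemma polygonal_in_realization:
  assumes "polygonal X x y l"
  shows "x \<in> realization X" "y \<in> realization X" "0 \<le> l"
  using assms
  by (induction) (auto intro: edge_pt_in_realization square_pt_in_realization add_nonneg_nonneg)

lemma polygonal_trans:
  assumes "polygonal X y z m" "polygonal X x y l"
  shows "polygonal X x z (l + m)"
  using assms
proof (induction)
  case (along_edge y e s m t)
  then show ?case using polygonal.along_edge[of X x e s "l + m" t] by (simp add: add.assoc)
next
  case (along_square y q z m w)
  then show ?case using polygonal.along_square[of X x q z "l + m" w] by (simp add: add.assoc)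
qed simp

lemma polygonal_edge:
  assumes "e \<in> cedges X" "s \<in> {0..1}" "t \<in> {0..1}"
  shows "polygonal X (edge_pt e s) (edge_pt e t) (dist s t)"
  using polygonal.along_edge[OF polygonal.const[OF edge_pt_in_realization] assms] assms by simp

lemma polygonal_square:
  assumes "q \<in> csquares X" "z \<in> {0..1} \<times> {0..1}" "w \<in> {0..1} \<times> {0..1}"
  shows "polygonal X (square_pt q z) (square_pt q w) (dist z w)"
  using polygonal.along_square[OF polygonal.const[OF square_pt_in_realization] assms] assms by simp

lemma polygonal_sym:
  assumes "polygonal X x y l"
  shows "polygonal X y x l"
  using assms
proof (induction)
  case (along_edge x e s l t)
  then show ?case
    using polygonal_trans[OF along_edge.IH polygonal_edge[of e X t s]] by (simp add: dist_commute add.commute)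
next
  case (along_square x q z l w)
  then show ?case
    using polygonal_trans[OF along_square.IH polygonal_square[of q X w z]] by (simp add: dist_commute add.commute)
qed (rule polygonal.const)

lemma path_dist_le:
  assumes "polygonal X x y l"
  shows "path_dist X x y \<le> l"
  unfolding path_dist_def
  by (rule cInf_lower) (use assms polygonal_in_realization(3) in \<open>auto intro!: bdd_belowI[of _ 0]\<close>)

text \<open>The first premise guarantees that the infimum is over a nonempty set.\<close>

lemma path_dist_ge:
  assumes "polygonal X x y l" "\<And>l. polygonal X x y l \<Longrightarrow> c \<le> l"
  shows "c \<le> path_dist X x y"
  unfolding path_dist_def by (rule cInf_greatest) (use assms in auto)

lemma path_dist_less:
  assumes "polygonal X x y l" "path_dist X x y < r"
  obtains m where "polygonal X x y m" "m < r"
  using cInf_lessD[of "{l. polygonal X x y l}" r] assms unfolding path_dist_def by auto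

text \<open>The source of lower bounds for \<open>path_dist\<close>: a Lipschitz condition on single
  cells adds up along a polygonal path.\<close>

lemma polygonal_lipschitz:
  assumes "polygonal X x y l"
    "\<And>e s t. e \<in> cedges X \<Longrightarrow> s \<in> {0..1} \<Longrightarrow> t \<in> {0..1} \<Longrightarrow>
      dist (f (edge_pt e s)) (f (edge_pt e t)) \<le> C * dist s t"
    "\<And>q z w. q \<in> csquares X \<Longrightarrow> z \<in> {0..1} \<times> {0..1} \<Longrightarrow> w \<in> {0..1} \<times> {0..1} \<Longrightarrow>
      dist (f (square_pt q z)) (f (square_pt q w)) \<le> C * dist z w"
  shows "dist (f x) (f y) \<le> C * l"
  using assms(1)
proof (induction)
  case (along_edge x e s l t)
  then show ?case
    using assms(2)[of e s t] dist_triangle[of "f x" "f (edge_pt e t)" "f (edge_pt e s)"]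
    by (simp add: distrib_left)
next
  case (along_square x q z l w)
  then show ?case
    using assms(3)[of q z w] dist_triangle[of "f x" "f (square_pt q w)" "f (square_pt q z)"]
    by (simp add: distrib_left)
qed simp

lemma edge_pt_0 [simp]: "edge_pt (a, b) 0 = vertex_pt a"
  and edge_pt_1 [simp]: "edge_pt (a, b) 1 = vertex_pt b"
  by (auto simp: edge_pt.simps)

lemma square_pt_sides:
  "square_pt (a, b, c, d) (s, 0) = edge_pt (a, b) s"
  "square_pt (a, b, c, d) (1, t) = edge_pt (b, c) t"
  "square_pt (a, b, c, d) (s, 1) = edge_pt (d, c) s"
  "square_pt (a, b, c, d) (0, t) = edge_pt (a, d) t"
  by (auto simp: edge_pt.simps square_pt.simps)

lemma square_pt_swap: "square_pt (a, b, c, d) (s, t) = square_pt (a, d, c, b) (t, s)"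
  by (auto simp: square_pt.simps algebra_simps)

section \<open>Affine extensions of functions on the vertices\<close>

text \<open>Extends a function on vertices to all points by their weights, so it is affine on edges
  and bilinear on squares. \<open>point_exponent\<close> is the extension of
  \<open>class_exponent\<close>.\<close>

definition affine_ext :: "('a \<Rightarrow> real) \<Rightarrow> ('a \<Rightarrow> real) \<Rightarrow> real" where
  "affine_ext \<phi> x = (\<Sum>g | x g \<noteq> 0. x g * \<phi> g)"

lemma affine_ext_superset:
  assumes "finite S" "\<And>g. g \<notin> S \<Longrightarrow> x g = 0"
  shows "affine_ext \<phi> x = (\<Sum>g \<in> S. x g * \<phi> g)"
  unfolding affine_ext_def by (rule sum.mono_neutral_left) (use assms in auto)

lemma affine_ext_square:
  "affine_ext \<phi> (square_pt (g, h, k, l) (s, t)) =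
     (1 - s) * (1 - t) * \<phi> g + s * (1 - t) * \<phi> h + s * t * \<phi> k + (1 - s) * t * \<phi> l"
proof -
  have "affine_ext \<phi> (square_pt (g, h, k, l) (s, t))
      = (\<Sum>m \<in> {g, h, k, l}. square_pt (g, h, k, l) (s, t) m * \<phi> m)"
    by (rule affine_ext_superset) (auto simp: vertex_pt_def square_pt.simps)
  then show ?thesis
    by (simp only: square_pt.simps distrib_right sum.distrib)
       (simp only: sum_vertex_pt finite.intros insert_iff simp_thms)
qed

lemma affine_ext_edge: "affine_ext \<phi> (edge_pt (g, h) s) = (1 - s) * \<phi> g + s * \<phi> h"
  using affine_ext_square[of \<phi> g h h h s 0] by (simp add: square_pt_sides)

lemma affine_ext_vertex: "affine_ext \<phi> (vertex_pt g) = \<phi> g"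
  using affine_ext_edge[of \<phi> g g 0] by simp

lemma point_exponent_affine_ext: "point_exponent a = affine_ext (\<lambda>g. real_of_int (class_exponent a g))"
  by (simp add: point_exponent_def affine_ext_def fun_eq_iff)

lemma dist_prod_bounds:
  fixes s t s' t' :: real
  shows "\<bar>s - s'\<bar> \<le> dist (s, t) (s', t')" "\<bar>t - t'\<bar> \<le> dist (s, t) (s', t')"
  using dist_fst_le[of "(s, t)" "(s', t')"] dist_snd_le[of "(s, t)" "(s', t')"] by (simp_all add: dist_real_def)

text \<open>The constant 2 arises from changing the two coordinates one after the other: each change
  costs at most the difference in that coordinate, which is at most the distance.\<close>

lemma bilinear_lipschitz:
  fixes A B C D s t s' t' :: real
  assumes "s \<in> {0..1}" "t \<in> {0..1}" "s' \<in> {0..1}" "t' \<in> {0..1}"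
    "\<bar>B - A\<bar> \<le> 1" "\<bar>C - B\<bar> \<le> 1" "\<bar>C - D\<bar> \<le> 1" "\<bar>D - A\<bar> \<le> 1"
  defines "f \<equiv> \<lambda>s t. (1 - s) * (1 - t) * A + s * (1 - t) * B + s * t * C + (1 - s) * t * D"
  shows "\<bar>f s t - f s' t'\<bar> \<le> 2 * dist (s, t) (s', t')"
proof -
  have conv: "\<bar>(1 - r) * x + r * y\<bar> \<le> 1" if "r \<in> {0..1}" "\<bar>x\<bar> \<le> 1" "\<bar>y\<bar> \<le> 1" for r x y :: real
  proof -
    have "\<bar>(1 - r) * x + r * y\<bar> \<le> (1 - r) * \<bar>x\<bar> + r * \<bar>y\<bar>"
      using that abs_triangle_ineq[of "(1 - r) * x" "r * y"] by (simp add: abs_mult)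
    also have "\<dots> \<le> (1 - r) * 1 + r * 1"
      using that by (intro add_mono mult_left_mono) auto
    finally show ?thesis by simp
  qed
  have "f s t - f s' t = (s - s') * ((1 - t) * (B - A) + t * (C - D))"
    by (simp add: f_def algebra_simps)
  then have 1: "\<bar>f s t - f s' t\<bar> \<le> \<bar>s - s'\<bar>"
    using conv[OF assms(2,5,7)] by (simp add: abs_mult mult_left_le)
  have "f s' t - f s' t' = (t - t') * ((1 - s') * (D - A) + s' * (C - B))"
    by (simp add: f_def algebra_simps)
  then have 2: "\<bar>f s' t - f s' t'\<bar> \<le> \<bar>t - t'\<bar>"
    using conv[OF assms(3,8,6)] by (simp add: abs_mult mult_left_le)
  show ?thesis using 1 2 dist_prod_bounds(1)[of s s' t t'] dist_prod_bounds(2)[of t t' s s'] by linarith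
qed

section \<open>The metric of K: connectedness, neighbourhoods and Lipschitz functions\<close>

context simplicial_graph
begin

abbreviation "K \<equiv> K_complex \<Gamma>"

lemma step_act: "step \<Gamma> g a = act g [(a, True)]"
  by (simp add: step_def act_def)

lemma K_edges: "cedges K = {lifted_edge \<Gamma> g a | g a. g \<in> G \<and> a \<in> V}"
  and K_squares: "csquares K = {lifted_square \<Gamma> g a b | g a b. g \<in> G \<and> b \<in> lk a}"
  and K_verts: "cverts K = G"
  by (simp_all add: K_complex_def lk_def)

lemma lifted_in [simp]:
  "g \<in> G \<Longrightarrow> a \<in> V \<Longrightarrow> lifted_edge \<Gamma> g a \<in> cedges K"
  "g \<in> G \<Longrightarrow> b \<in> lk a \<Longrightarrow> lifted_square \<Gamma> g a b \<in> csquares K"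
  by (auto simp: K_edges K_squares)

lemma vertex_in_K [simp]: "g \<in> G \<Longrightarrow> vertex_pt g \<in> realization K"
  by (simp add: realization_def K_verts)

lemma polygonal_step:
  assumes "g \<in> G" "a \<in> V"
  shows "polygonal K (vertex_pt g) (vertex_pt (act g [(a, d)])) 1"
proof -
  have *: "polygonal K (vertex_pt h) (vertex_pt (act h [(a, True)])) 1" if "h \<in> G" for h
    using polygonal_edge[OF lifted_in(1)[OF that assms(2)], of 0 1]
    by (simp add: lifted_edge_def step_act)
  show ?thesis
  proof (cases d)
    case True
    then show ?thesis using * assms by simp
  next
    case False
    then show ?thesis using polygonal_sym[OF *[of "act g [(a, False)]"]] assms by simp
  qed
qed

lemma polygonal_act:
  "g \<in> G \<Longrightarrow> u \<in> words V \<Longrightarrow> polygonal K (vertex_pt g) (vertex_pt (act g u)) (length u)"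
proof (induction u arbitrary: g)
  case Nil
  then show ?case by (simp add: polygonal.const)
next
  case (Cons x u)
  have "polygonal K (vertex_pt g) (vertex_pt (act g [x])) 1"
    using polygonal_step[of g "fst x" "snd x"] Cons.prems by simp
  then show ?case
    using polygonal_trans[OF Cons.IH[of "act g [x]"], of "vertex_pt g" 1] Cons.prems
      act_Cons[of g x u] act_in[of g "[x]"] by simp
qed

lemma polygonal_to_vertex:
  assumes "x \<in> realization K"
  obtains g l where "g \<in> G" "polygonal K x (vertex_pt g) l"
  using assms
proof (cases rule: realization_cases)
  case (vertex a)
  then show ?thesis using that[of a 0] assms by (simp add: K_verts polygonal.const)
next
  case (edge e s)
  then obtain g a where e: "e = lifted_edge \<Gamma> g a" "g \<in> G" "a \<in> V" by (auto simp: K_edges)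
  show ?thesis
    using that[OF e(2)] polygonal_edge[OF edge(1,2), of 0] edge e by (simp add: lifted_edge_def)
next
  case (square q z)
  then obtain g a b where e: "q = lifted_square \<Gamma> g a b" "g \<in> G" by (auto simp: K_squares)
  show ?thesis
    using that[OF e(2)] polygonal_square[OF square(1,2), of "(0, 0)"] square e
    by (simp add: lifted_square_def square_pt_sides)
qed

lemma K_connected:
  assumes "x \<in> realization K" "y \<in> realization K"
  obtains l where "polygonal K x y l"
proof -
  obtain g l where g: "g \<in> G" "polygonal K x (vertex_pt g) l" using assms(1) by (rule polygonal_to_vertex)
  obtain h m where h: "h \<in> G" "polygonal K y (vertex_pt h) m" using assms(2) by (rule polygonal_to_vertex)
  obtain u where "u \<in> words V" "act g u = h" using g(1) h(1) by (rule act_transitive)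
  then have "polygonal K x (vertex_pt h) (l + length u)"
    using polygonal_trans[OF polygonal_act g(2)] g by blast
  then show thesis using that polygonal_trans[OF polygonal_sym[OF h(2)]] by blast
qed

text \<open>A strict bound on the infimum is realised by an actual path; estimates can then be made
  with path lengths, which add up exactly.\<close>

lemma nbhd_iff:
  assumes "S \<subseteq> realization K"
  shows "x \<in> nbhd K r S \<longleftrightarrow> (\<exists>y \<in> S. \<exists>l < r. polygonal K x y l)"
proof
  assume "x \<in> nbhd K r S"
  then obtain y where y: "x \<in> realization K" "y \<in> S" "path_dist K x y < r" by (auto simp: nbhd_def)
  obtain l where "polygonal K x y l" using K_connected[of x y] y assms by blast
  then show "\<exists>y \<in> S. \<exists>l < r. polygonal K x y l" using path_dist_less y by blast
next
  assume "\<exists>y \<in> S. \<exists>l < r. polygonal K x y l"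
  then show "x \<in> nbhd K r S"
    unfolding nbhd_def using path_dist_le polygonal_in_realization(1) by (fastforce intro: le_less_trans)
qed

lemma lifted_square_act:
  "lifted_square \<Gamma> g a b = (g, act g [(a, True)], act (act g [(a, True)]) [(b, True)], act g [(b, True)])"
  by (simp add: lifted_square_def step_act)

lemma lifted_square_swap:
  "g \<in> G \<Longrightarrow> b \<in> lk a \<Longrightarrow>
    square_pt (lifted_square \<Gamma> g a b) (s, t) = square_pt (lifted_square \<Gamma> g b a) (t, s)"
  using act_commute1[of b a g] square_pt_swap by (simp add: lifted_square_act)

lemma affine_ext_lipschitz:
  assumes "polygonal K x y l" "\<And>g a. g \<in> G \<Longrightarrow> a \<in> V \<Longrightarrow> \<bar>\<phi> (act g [(a, True)]) - \<phi> g\<bar> \<le> 1"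
  shows "\<bar>affine_ext \<phi> x - affine_ext \<phi> y\<bar> \<le> 2 * l"
proof -
  have "dist (affine_ext \<phi> x) (affine_ext \<phi> y) \<le> 2 * l"
    using assms(1)
  proof (rule polygonal_lipschitz)
    fix e s t assume "e \<in> cedges K" "s \<in> {0..1 :: real}" "t \<in> {0..1 :: real}"
    then obtain g a where e: "e = (g, act g [(a, True)])" "g \<in> G" "a \<in> V"
      by (auto simp: K_edges lifted_edge_def step_act)
    have "affine_ext \<phi> (edge_pt e s) - affine_ext \<phi> (edge_pt e t) = (s - t) * (\<phi> (act g [(a, True)]) - \<phi> g)"
      by (simp add: e affine_ext_edge algebra_simps)
    also have "\<bar>\<dots>\<bar> \<le> \<bar>s - t\<bar>" using assms(2)[OF e(2,3)] by (simp add: abs_mult mult_left_le)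
    finally show "dist (affine_ext \<phi> (edge_pt e s)) (affine_ext \<phi> (edge_pt e t)) \<le> 2 * dist s t"
      unfolding dist_real_def using order_trans[of _ "\<bar>s - t\<bar>" "2 * \<bar>s - t\<bar>"] by simp
  next
    fix q z w assume q: "q \<in> csquares K" "z \<in> {0..1 :: real} \<times> {0..1 :: real}" "w \<in> {0..1 :: real} \<times> {0..1 :: real}"
    then obtain g a b where e: "q = lifted_square \<Gamma> g a b" "g \<in> G" "b \<in> lk a" by (auto simp: K_squares)
    have V: "a \<in> V" "b \<in> V" using e lkD by blast+
    obtain s t s' t' where z: "z = (s, t)" "w = (s', t')" by (cases z; cases w)
    have g: "act g [(a, True)] \<in> G" "act g [(b, True)] \<in> G" using e V by auto
    show "dist (affine_ext \<phi> (square_pt q z)) (affine_ext \<phi> (square_pt q w)) \<le> 2 * dist z w"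
      using bilinear_lipschitz[of s t s' t' "\<phi> (act g [(a, True)])" "\<phi> g"
          "\<phi> (act (act g [(a, True)]) [(b, True)])" "\<phi> (act g [(b, True)])"]
        q z assms(2)[OF e(2) V(1)] assms(2)[OF e(2) V(2)] assms(2)[OF g(1) V(2)] assms(2)[OF g(2) V(1)]
        act_commute1[OF e(3,2)]
      by (simp add: e lifted_square_act affine_ext_square dist_real_def)
  qed
  then show ?thesis by (simp add: dist_real_def)
qed

lemma class_exponent_act:
  "g \<in> G \<Longrightarrow> a \<in> V \<Longrightarrow> class_exponent c (act g [(a, True)]) = class_exponent c g + of_bool (c = a)"
  using class_exponent_step(2)[of g \<Gamma> a c] by (simp add: step_act)

lemma point_exponent_lifted_edge:
  fixes s :: real
  shows "g \<in> G \<Longrightarrow> a \<in> V \<Longrightarrow>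
    point_exponent c (edge_pt (lifted_edge \<Gamma> g a) s) = class_exponent c g + s * of_bool (c = a)"
  by (simp add: lifted_edge_def step_act point_exponent_edge class_exponent_act algebra_simps)

lemma point_exponent_lifted_square:
  fixes s t :: real
  assumes "g \<in> G" "b \<in> lk a"
  shows "point_exponent c (square_pt (lifted_square \<Gamma> g a b) (s, t))
    = class_exponent c g + s * of_bool (c = a) + t * of_bool (c = b)"
proof -
  have V: "a \<in> V" "b \<in> V" using assms lkD by blast+
  then have "act g [(a, True)] \<in> G" using assms by auto
  then show ?thesis
    using assms V by (simp add: lifted_square_act point_exponent_square class_exponent_act algebra_simps)
qed

text \<open>The coordinates of a flat are given by exponent sums, which bound distances from below.\<close>

lemma exponents_lipschitz:
  assumes "polygonal K x y l" "a \<noteq> b"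
  shows "dist (point_exponent a x, point_exponent b x) (point_exponent a y, point_exponent b y) \<le> l"
proof -
  let ?f = "\<lambda>x. (point_exponent a x, point_exponent b x)"
  have "dist (?f x) (?f y) \<le> 1 * l"
    using assms(1)
  proof (rule polygonal_lipschitz)
    fix e s t assume "e \<in> cedges K" "s \<in> {0..1 :: real}" "t \<in> {0..1 :: real}"
    then obtain g c where e: "e = lifted_edge \<Gamma> g c" "g \<in> G" "c \<in> V" by (auto simp: K_edges)
    show "dist (?f (edge_pt e s)) (?f (edge_pt e t)) \<le> 1 * dist s t"
      using assms(2) by (auto simp: e point_exponent_lifted_edge dist_prod_def dist_real_def)
  next
    fix q z w assume q: "q \<in> csquares K" "z \<in> {0..1 :: real} \<times> {0..1 :: real}" "w \<in> {0..1 :: real} \<times> {0..1 :: real}"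
    then obtain g c d where e: "q = lifted_square \<Gamma> g c d" "g \<in> G" "d \<in> lk c" by (auto simp: K_squares)
    have cd: "c \<noteq> d" using e lkD by blast
    obtain s t s' t' where z: "z = (s, t)" "w = (s', t')" by (cases z; cases w)
    show "dist (?f (square_pt q z)) (?f (square_pt q w)) \<le> 1 * dist z w"
      using assms(2) cd by (auto simp: e z point_exponent_lifted_square dist_prod_def dist_real_def
          add.commute)
  qed
  then show ?thesis by simp
qed

section \<open>Coordinates on flats\<close>

definition vpow :: "'v kvertex \<Rightarrow> 'v \<Rightarrow> int \<Rightarrow> 'v kvertex" where
  "vpow g a n = act g (replicate (nat \<bar>n\<bar>) (a, 0 \<le> n))"

lemma vpow_0 [simp]: "g \<in> G \<Longrightarrow> vpow g a 0 = g"
  by (simp add: vpow_def)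

lemma words_replicate [simp]: "a \<in> S \<Longrightarrow> replicate n (a, d) \<in> words S"
  by (auto simp: words_iff)

lemma vpow_in [simp]: "g \<in> G \<Longrightarrow> a \<in> V \<Longrightarrow> vpow g a n \<in> G"
  by (simp add: vpow_def)

lemma vpow_succ:
  assumes "g \<in> G" "a \<in> V"
  shows "vpow g a (n + 1) = act (vpow g a n) [(a, True)]"
proof (cases "0 \<le> n")
  case True
  then have "nat \<bar>n + 1\<bar> = Suc (nat \<bar>n\<bar>)" by simp
  then show ?thesis using True assms
    by (simp add: vpow_def replicate_append_same[symmetric] act_append del: replicate_Suc)
      (simp add: replicate_append_same[symmetric] act_append)
next
  case False
  define k where "k = nat (- n - 1)"
  have n: "nat \<bar>n\<bar> = Suc k" "nat (- n) = Suc k" using False unfolding k_def by arith+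
  have "vpow g a n = act g (replicate k (a, False) @ [(a, False)])"
    using False by (simp add: vpow_def n replicate_append_same)
  also have "\<dots> = act (act g (replicate k (a, False))) [(a, False)]"
    using assms by (simp add: act_append)
  finally have "act (vpow g a n) [(a, True)] = act g (replicate k (a, False))"
    using assms by simp
  also have "\<dots> = vpow g a (n + 1)"
  proof (cases "n = -1")
    case True
    then show ?thesis by (simp add: vpow_def k_def)
  next
    case False
    then have "\<not> 0 \<le> n + 1" "nat \<bar>n + 1\<bar> = k" using \<open>\<not> 0 \<le> n\<close> by (auto simp: k_def)
    then show ?thesis by (simp add: vpow_def)
  qed
  finally show ?thesis by simp
qed

lemma vpow_pred: "g \<in> G \<Longrightarrow> a \<in> V \<Longrightarrow> vpow g a (n - 1) = act (vpow g a n) [(a, False)]"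
  using vpow_succ[of g a "n - 1"] by simp

lemma vpow_add:
  assumes "g \<in> G" "a \<in> V"
  shows "vpow (vpow g a m) a n = vpow g a (m + n)"
proof (induction n rule: int_induct[where k = 0])
  case base
  then show ?case using assms by simp
next
  case (step1 i)
  then show ?case using assms vpow_succ[of "vpow g a m" a i] vpow_succ[of g a "m + i"] by (simp add: add.assoc)
next
  case (step2 i)
  then show ?case using assms vpow_pred[of "vpow g a m" a i] vpow_pred[of g a "m + i"]
    by (simp add: add_diff_eq)
qed

lemma vpow_act_commute:
  assumes "g \<in> G" "u \<in> words (lk a)" "a \<in> V"
  shows "vpow (act g u) a n = act (vpow g a n) u"
proof -
  have u: "u \<in> words V" using words_mono[OF lk_subset assms(2)] .
  show ?thesis
  proof (induction n rule: int_induct[where k = 0])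
    case base
    then show ?case using assms u by simp
  next
    case (step1 i)
    then show ?case using assms u vpow_succ[of "act g u" a i] vpow_succ[of g a i] act_commute_word[of u a "vpow g a i" True]
      by simp
  next
    case (step2 i)
    then show ?case using assms u vpow_pred[of "act g u" a i] vpow_pred[of g a i] act_commute_word[of u a "vpow g a i" False]
      by simp
  qed
qed

lemma class_exponent_vpow:
  assumes "g \<in> G" "a \<in> V"
  shows "class_exponent c (vpow g a n) = class_exponent c g + n * of_bool (c = a)"
proof (induction n rule: int_induct[where k = 0])
  case base
  then show ?case using assms by simp
next
  case (step1 i)
  then show ?case using assms vpow_succ[of g a i] class_exponent_act[of "vpow g a i" a c] by (simp add: algebra_simps)
next
  case (step2 i)
  then show ?case using assms vpow_succ[of g a "i - 1"] class_exponent_act[of "vpow g a (i - 1)" a c]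
    by (simp add: algebra_simps)
qed

definition grid :: "'v kvertex \<Rightarrow> 'v \<Rightarrow> 'v \<Rightarrow> int \<Rightarrow> int \<Rightarrow> 'v kvertex" where
  "grid g a b m n = vpow (vpow g a m) b n"

lemma grid_0 [simp]: "g \<in> G \<Longrightarrow> a \<in> V \<Longrightarrow> grid g a b m 0 = vpow g a m"
  by (simp add: grid_def)

lemma grid_in [simp]: "g \<in> G \<Longrightarrow> b \<in> lk a \<Longrightarrow> grid g a b m n \<in> G"
  using lkD unfolding grid_def by auto

lemma grid_succ:
  assumes "g \<in> G" "b \<in> lk a"
  shows "grid g a b (m + 1) n = act (grid g a b m n) [(a, True)]"
    "grid g a b m (n + 1) = act (grid g a b m n) [(b, True)]"
proof -
  have V: "a \<in> V" "b \<in> V" "a \<in> lk b" using assms lkD lk_sym by blast+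
  then show "grid g a b (m + 1) n = act (grid g a b m n) [(a, True)]"
    "grid g a b m (n + 1) = act (grid g a b m n) [(b, True)]"
    using assms vpow_act_commute[of "vpow g a m" "[(a, True)]" b n] by (simp_all add: grid_def vpow_succ)
qed

lemma grid_commute:
  assumes "g \<in> G" "b \<in> lk a"
  shows "grid g a b m n = grid g b a n m"
proof -
  have V: "a \<in> V" "b \<in> V" "a \<in> lk b" using assms lkD lk_sym by blast+
  then show ?thesis
    using assms vpow_act_commute[of g "replicate (nat \<bar>n\<bar>) (b, 0 \<le> n)" a m] by (simp add: grid_def vpow_def[of _ b])
qed

lemma grid_add:
  assumes "g \<in> G" "b \<in> lk a"
  shows "grid (grid g a b m n) a b i j = grid g a b (m + i) (n + j)"
proof -
  have V: "a \<in> V" "b \<in> V" "a \<in> lk b" using assms lkD lk_sym by blast+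
  have "vpow (grid g a b m n) a i = grid g b a n (m + i)"
    using grid_commute[OF assms] assms V by (simp add: grid_def vpow_add)
  also have "\<dots> = grid g a b (m + i) n" using grid_commute[OF assms] by simp
  finally show ?thesis using assms V by (simp add: grid_def vpow_add)
qed

lemma class_exponent_grid:
  assumes "g \<in> G" "b \<in> lk a"
  shows "class_exponent c (grid g a b m n) = class_exponent c g + m * of_bool (c = a) + n * of_bool (c = b)"
  using assms lkD[OF assms(2)] by (simp add: grid_def class_exponent_vpow)

definition flat_pt :: "'v kvertex \<Rightarrow> 'v \<Rightarrow> 'v \<Rightarrow> real \<times> real \<Rightarrow> 'v kpoint" where
  "flat_pt g a b z = square_pt (lifted_square \<Gamma> (grid g a b \<lfloor>fst z\<rfloor> \<lfloor>snd z\<rfloor>) a b) (frac (fst z), frac (snd z))"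

text \<open>Floors assign a lattice side to only one of its cells. This makes every closed cell
  containing the point usable, since adjacent squares agree along their common side.\<close>

lemma flat_pt_cell:
  assumes "g \<in> G" "b \<in> lk a" "of_int m \<le> s" "s \<le> of_int m + 1" "of_int n \<le> t" "t \<le> of_int n + 1"
  shows "flat_pt g a b (s, t) = square_pt (lifted_square \<Gamma> (grid g a b m n) a b) (s - of_int m, t - of_int n)"
proof -
  have V: "a \<in> V" "b \<in> V" using assms lkD by blast+
  have s: "\<lfloor>s\<rfloor> = m \<and> frac s = s - of_int m \<or> \<lfloor>s\<rfloor> = m + 1 \<and> frac s = 0 \<and> s = of_int m + 1"
    using assms(3,4) by (cases "s = of_int m + 1") (auto simp: frac_def floor_unique)
  have t: "\<lfloor>t\<rfloor> = n \<and> frac t = t - of_int n \<or> \<lfloor>t\<rfloor> = n + 1 \<and> frac t = 0 \<and> t = of_int n + 1"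
    using assms(5,6) by (cases "t = of_int n + 1") (auto simp: frac_def floor_unique)
  have G': "grid g a b m n \<in> G" using assms by simp
  note comm = act_commute1[OF assms(2) G']
  show ?thesis
    using s t
    by (elim disjE conjE)
      (simp_all add: flat_pt_def lifted_square_act square_pt_sides grid_succ[OF assms(1,2)] comm)
qed

lemma flat_pt_lattice: "g \<in> G \<Longrightarrow> b \<in> lk a \<Longrightarrow> flat_pt g a b (of_int m, of_int n) = vertex_pt (grid g a b m n)"
  by (simp add: flat_pt_def lifted_square_act square_pt_sides)

lemma flat_pt_in_K: "g \<in> G \<Longrightarrow> b \<in> lk a \<Longrightarrow> flat_pt g a b z \<in> realization K"
  unfolding flat_pt_def
  by (rule square_pt_in_realization) (auto simp: frac_ge_0 frac_lt_1 less_imp_le)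

lemma point_exponent_flat_pt:
  fixes s t :: real
  assumes "g \<in> G" "b \<in> lk a"
  shows "point_exponent c (flat_pt g a b (s, t)) = class_exponent c g + s * of_bool (c = a) + t * of_bool (c = b)"
  using assms by (simp add: flat_pt_def point_exponent_lifted_square class_exponent_grid frac_def algebra_simps)

lemma flat_pt_translate:
  fixes s t :: real
  assumes "g \<in> G" "b \<in> lk a"
  shows "flat_pt (grid g a b m n) a b (s, t) = flat_pt g a b (s + of_int m, t + of_int n)"
  using grid_add[OF assms] by (simp add: flat_pt_def frac_def add.commute)

lemma flat_pt_swap:
  assumes "g \<in> G" "b \<in> lk a"
  shows "flat_pt g a b (s, t) = flat_pt g b a (t, s)"
proof -
  have "square_pt (lifted_square \<Gamma> (grid g a b \<lfloor>s\<rfloor> \<lfloor>t\<rfloor>) a b) (frac s, frac t)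
      = square_pt (lifted_square \<Gamma> (grid g a b \<lfloor>s\<rfloor> \<lfloor>t\<rfloor>) b a) (frac t, frac s)"
    using lifted_square_swap[OF grid_in[OF assms] assms(2)] .
  then show ?thesis by (simp add: flat_pt_def grid_commute[OF assms, of "\<lfloor>s\<rfloor>"])
qed

text \<open>Which unit interval to use at an integer \<open>s\<close> depends on the direction,
  hence the floor for \<open>u\<close> nonnegative and the ceiling minus one otherwise. The
  denominator \<open>u + 1\<close> is positive also for a constant motion.\<close>

lemma cell_direction:
  fixes s u :: real
  obtains d and m :: int where "d > 0" "\<And>e. 0 \<le> e \<Longrightarrow> e < d \<Longrightarrow> of_int m \<le> s + e * u \<and> s + e * u \<le> of_int m + 1"
proof (cases "0 \<le> u")
  case True
  define d where "d = (of_int \<lfloor>s\<rfloor> + 1 - s) / (u + 1)"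
  have p: "0 < of_int \<lfloor>s\<rfloor> + 1 - s" by linarith
  show ?thesis
  proof (rule that[of d "\<lfloor>s\<rfloor>"])
    show "d > 0" using True p by (simp add: d_def)
    fix e assume e: "0 \<le> e" "e < d"
    then have "e * (u + 1) \<le> of_int \<lfloor>s\<rfloor> + 1 - s" using True by (simp add: d_def pos_less_divide_eq)
    then have "e * u \<le> of_int \<lfloor>s\<rfloor> + 1 - s" using e by (simp add: algebra_simps)
    moreover have "0 \<le> e * u" using True e by simp
    moreover have "of_int \<lfloor>s\<rfloor> \<le> s" by simp
    ultimately show "of_int \<lfloor>s\<rfloor> \<le> s + e * u \<and> s + e * u \<le> of_int \<lfloor>s\<rfloor> + 1" by linarith
  qed
next
  case False
  define m where "m = \<lceil>s\<rceil> - 1"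
  define d where "d = (s - of_int m) / (1 - u)"
  have p: "0 < s - of_int m" "s \<le> of_int m + 1" unfolding m_def by linarith+
  show ?thesis
  proof (rule that[of d m])
    show "d > 0" using False p by (simp add: d_def)
    fix e assume e: "0 \<le> e" "e < d"
    then have "e * (1 - u) \<le> s - of_int m" using False by (simp add: d_def pos_less_divide_eq)
    then have "- (e * u) \<le> s - of_int m" using e by (simp add: algebra_simps)
    moreover have "e * u \<le> 0" using False e by (simp add: mult_nonneg_nonpos)
    ultimately show "of_int m \<le> s + e * u \<and> s + e * u \<le> of_int m + 1" using p by linarith
  qed
qed

lemma flat_pt_polygonal_cell:
  assumes "g \<in> G" "b \<in> lk a" "of_int m \<le> s" "s \<le> of_int m + 1" "of_int n \<le> t" "t \<le> of_int n + 1"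
    "of_int m \<le> s'" "s' \<le> of_int m + 1" "of_int n \<le> t'" "t' \<le> of_int n + 1"
  shows "polygonal K (flat_pt g a b (s, t)) (flat_pt g a b (s', t')) (dist (s, t) (s', t'))"
proof -
  have "polygonal K (square_pt (lifted_square \<Gamma> (grid g a b m n) a b) (s - of_int m, t - of_int n))
      (square_pt (lifted_square \<Gamma> (grid g a b m n) a b) (s' - of_int m, t' - of_int n))
      (dist (s - of_int m, t - of_int n) (s' - of_int m, t' - of_int n))"
    by (rule polygonal_square) (use assms in auto)
  moreover have "dist (s - of_int m, t - of_int n) (s' - of_int m, t' - of_int n) = dist (s, t) (s', t')"
    by (simp add: dist_prod_def dist_real_def)
  ultimately show ?thesis using assms by (simp add: flat_pt_cell[of g b a m _ n])
qed

lemma flat_pt_polygonal_local: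
  assumes "g \<in> G" "b \<in> lk a"
  obtains d where "d > 0"
    "\<And>e. 0 \<le> e \<Longrightarrow> e < d \<Longrightarrow> polygonal K (flat_pt g a b z) (flat_pt g a b (z + e *\<^sub>R u)) (e * norm u)"
proof -
  obtain s t where z: "z = (s, t)" by force
  obtain v w where u: "u = (v, w)" by force
  obtain d1 m where 1: "d1 > 0" "\<And>e. 0 \<le> e \<Longrightarrow> e < d1 \<Longrightarrow> of_int m \<le> s + e * v \<and> s + e * v \<le> of_int m + 1"
    using cell_direction[of s v] by metis
  obtain d2 n where 2: "d2 > 0" "\<And>e. 0 \<le> e \<Longrightarrow> e < d2 \<Longrightarrow> of_int n \<le> t + e * w \<and> t + e * w \<le> of_int n + 1"
    using cell_direction[of t w] by metis
  show thesis
  proof (rule that[of "min d1 d2"])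
    show "0 < min d1 d2" using 1 2 by simp
    fix e :: real assume e: "0 \<le> e" "e < min d1 d2"
    have "polygonal K (flat_pt g a b (s, t)) (flat_pt g a b (s + e * v, t + e * w)) (dist (s, t) (s + e * v, t + e * w))"
      by (rule flat_pt_polygonal_cell[OF assms, of m _ n]) (use 1(1) 1(2)[of 0] 1(2)[of e] 2(1) 2(2)[of 0] 2(2)[of e] e in auto)
    moreover have "dist z (z + e *\<^sub>R u) = e * norm u" using e by (simp add: dist_norm)
    ultimately show "polygonal K (flat_pt g a b z) (flat_pt g a b (z + e *\<^sub>R u)) (e * norm u)"
      by (simp add: z u)
  qed
qed

text \<open>By bisection it suffices to treat short subsegments around one parameter
  \<open>r\<close>. There the pieces before and after \<open>r\<close> each stay in one cell, and
  the lengths add up to the Euclidean length.\<close>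

lemma flat_pt_polygonal:
  assumes "g \<in> G" "b \<in> lk a"
  shows "polygonal K (flat_pt g a b z) (flat_pt g a b w) (dist z w)"
proof -
  define c where "c = (\<lambda>r. flat_pt g a b (z + r *\<^sub>R (w - z)))"
  have "0 \<le> (1 :: real)" by simp
  then have "polygonal K (c 0) (c 1) ((1 - 0) * norm (w - z))"
  proof (induct rule: Bolzano[where P = "\<lambda>r r'. polygonal K (c r) (c r') ((r' - r) * norm (w - z))"])
    case (trans r r' r'')
    then show ?case using polygonal_trans[OF trans(2,1)] by (simp add: algebra_simps)
  next
    case (local r)
    obtain d1 where 1: "d1 > 0" "\<And>e. 0 \<le> e \<Longrightarrow> e < d1 \<Longrightarrow>
        polygonal K (c r) (flat_pt g a b (z + r *\<^sub>R (w - z) + e *\<^sub>R (w - z))) (e * norm (w - z))"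
      using flat_pt_polygonal_local[OF assms, of "z + r *\<^sub>R (w - z)" "w - z"] unfolding c_def by metis
    obtain d2 where 2: "d2 > 0" "\<And>e. 0 \<le> e \<Longrightarrow> e < d2 \<Longrightarrow>
        polygonal K (c r) (flat_pt g a b (z + r *\<^sub>R (w - z) + e *\<^sub>R (z - w))) (e * norm (z - w))"
      using flat_pt_polygonal_local[OF assms, of "z + r *\<^sub>R (w - z)" "z - w"] unfolding c_def by metis
    have "polygonal K (c p) (c q) ((q - p) * norm (w - z))"
      if "p \<le> r" "r \<le> q" "q - p < min d1 d2" for p q
    proof -
      have "polygonal K (c r) (c q) ((q - r) * norm (w - z))"
        using 1(2)[of "q - r"] that by (simp add: c_def algebra_simps)
      moreover have "polygonal K (c r) (c p) ((r - p) * norm (w - z))"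
        using 2(2)[of "r - p"] that by (simp add: c_def algebra_simps norm_minus_commute)
      ultimately show ?thesis
        using polygonal_trans[of K "c r" "c q" _ "c p"] polygonal_sym by (fastforce simp: algebra_simps)
    qed
    then show ?case using 1(1) 2(1) by (intro exI[of _ "min d1 d2"]) auto
  qed
  then show ?thesis by (simp add: c_def dist_norm norm_minus_commute)
qed

lemma flat_pt_coordinates:
  assumes "g \<in> G" "b \<in> lk a"
  shows "(point_exponent a (flat_pt g a b z), point_exponent b (flat_pt g a b z)) =
     z + (real_of_int (class_exponent a g), real_of_int (class_exponent b g))"
  using lkD(3)[OF assms(2)] point_exponent_flat_pt[OF assms, of _ "fst z" "snd z"]
  by (cases z) simp

text \<open>The straight segment bounds the distance from above. From below, the two exponents
  recover the plane coordinates up to translation and do not increase distances.\<close>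

lemma flat_pt_isometric:
  assumes "g \<in> G" "b \<in> lk a"
  shows "path_dist K (flat_pt g a b z) (flat_pt g a b w) = dist z w"
proof (rule antisym)
  show "path_dist K (flat_pt g a b z) (flat_pt g a b w) \<le> dist z w"
    using path_dist_le[OF flat_pt_polygonal[OF assms]] .
  have "dist z w \<le> l" if "polygonal K (flat_pt g a b z) (flat_pt g a b w) l" for l
    using exponents_lipschitz[OF that, of a b] lkD(3)[OF assms(2)] flat_pt_coordinates[OF assms] by simp
  then show "dist z w \<le> path_dist K (flat_pt g a b z) (flat_pt g a b w)"
    using path_dist_ge[OF flat_pt_polygonal[OF assms]] by blast
qed

end

section \<open>Coverings of circles and tori\<close>

text \<open>The sheets over \<open>T\<close> are the translates of \<open>U\<close> by periods. They
  are disjoint since \<open>P\<close> is injective on \<open>U\<close>, and they exhaust the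
  preimage since points with equal image differ by a period.\<close>

lemma covering_by_periods:
  fixes P :: "'e::real_normed_vector \<Rightarrow> 'y::topological_space"
  assumes cont: "continuous_on UNIV P"
    and per: "\<And>z w. P z = P w \<longleftrightarrow> z - w \<in> L"
    and loc: "\<And>z. \<exists>U T q. open U \<and> z \<in> U \<and> openin (top_of_set (range P)) T \<and> homeomorphism U T P q"
  shows "covering_space UNIV P (range P)"
proof (rule covering_spaceI[OF cont HOL.refl])
  fix x assume "x \<in> range P"
  then obtain z where z: "x = P z" by blast
  obtain U T q where U: "open U" "z \<in> U" "openin (top_of_set (range P)) T" and h: "homeomorphism U T P q"
    using loc by blast
  have h': "P ` U = T" "\<And>u. u \<in> U \<Longrightarrow> q (P u) = u" "continuous_on U P" "continuous_on T q"
    using h by (auto simp: homeomorphism_def)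
  have shift: "P (l + u) = P u" if "l \<in> L" for l u
    using per[of "l + u" u] that by simp
  define v where "v = (\<lambda>l. (+) l ` U) ` L"
  have "\<Union>v = UNIV \<inter> P -` T"
  proof
    show "\<Union>v \<subseteq> UNIV \<inter> P -` T" using shift h'(1) by (auto simp: v_def)
    show "UNIV \<inter> P -` T \<subseteq> \<Union>v"
    proof
      fix w assume "w \<in> UNIV \<inter> P -` T"
      then obtain u where u: "u \<in> U" "P w = P u" using h'(1) by blast
      then have "w - u \<in> L" using per by blast
      then show "w \<in> \<Union>v" using u by (auto simp: v_def intro!: bexI[of _ "w - u"] image_eqI[of _ _ u])
    qed
  qed
  moreover have "\<forall>u \<in> v. openin (top_of_set UNIV) u"
    using open_translation[OF U(1)] by (auto simp: v_def)
  moreover have "pairwise disjnt v"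
  proof (rule pairwiseI)
    fix a b assume "a \<in> v" "b \<in> v" "a \<noteq> b"
    then obtain l m where l: "l \<in> L" "m \<in> L" "a = (+) l ` U" "b = (+) m ` U" by (auto simp: v_def)
    show "disjnt a b"
    proof (rule ccontr)
      assume "\<not> disjnt a b"
      then obtain u u' where u: "u \<in> U" "u' \<in> U" "l + u = m + u'" using l by (auto simp: disjnt_def)
      then have "u = u'" using shift l h'(2) by metis
      then show False using u l \<open>a \<noteq> b\<close> by simp
    qed
  qed
  moreover have "\<forall>u \<in> v. \<exists>q. homeomorphism u T P q"
  proof
    fix a assume "a \<in> v"
    then obtain l where l: "l \<in> L" "a = (+) l ` U" by (auto simp: v_def)
    have "homeomorphism a T P (\<lambda>y. l + q y)"
      unfolding homeomorphism_def
      using h h'(1) shift[OF l(1)] l(2)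
      by (auto simp: homeomorphism_def image_image image_iff intro: continuous_on_subset[OF cont] intro!: continuous_intros)
    then show "\<exists>q. homeomorphism a T P q" by blast
  qed
  ultimately show "\<exists>T. x \<in> T \<and> openin (top_of_set (range P)) T \<and>
      (\<exists>v. \<Union>v = UNIV \<inter> P -` T \<and> (\<forall>u \<in> v. openin (top_of_set UNIV) u) \<and> pairwise disjnt v \<and>
        (\<forall>u \<in> v. \<exists>q. homeomorphism u T P q))"
    using U z h'(1) by blast
qed

section \<open>Charts of the circle and of the torus\<close>

lemma cis_eq_iff: "cis (2 * pi * s) = cis (2 * pi * t) \<longleftrightarrow> s - t \<in> \<int>"
proof -
  have "cis (2 * pi * s) = cis (2 * pi * t) \<longleftrightarrow> (\<exists>n :: int. 2 * pi * s = 2 * pi * t + 2 * pi * n)"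
    using sin_cos_eq_iff[of "2 * pi * s" "2 * pi * t"] by (auto simp: complex_eq_iff)
  also have "\<dots> \<longleftrightarrow> (\<exists>n :: int. s - t = n)"
  proof -
    have "2 * pi * s = 2 * pi * t + 2 * pi * n \<longleftrightarrow> s - t = n" for n :: int
    proof -
      have "2 * pi * s = 2 * pi * t + 2 * pi * n \<longleftrightarrow> 2 * pi * s = 2 * pi * (t + n)"
        by (simp only: distrib_left)
      also have "\<dots> \<longleftrightarrow> s = t + n" by (subst mult_cancel_left) simp
      finally show ?thesis by linarith
    qed
    then show ?thesis by simp
  qed
  finally show ?thesis by (auto simp: Ints_def)
qed

text \<open>The branch of the inverse of the circle parametrisation with values within 1/2 of
  \<open>s\<close>; rotating by the image of \<open>s\<close> keeps the cut of \<open>Arg\<close> at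
  the antipodal point.\<close>

definition arg_near :: "real \<Rightarrow> complex \<Rightarrow> real" where
  "arg_near s w = s + Arg (w / cis (2 * pi * s)) / (2 * pi)"

definition circle_near :: "real \<Rightarrow> complex set" where
  "circle_near s = {w. cmod w = 1 \<and> w \<noteq> - cis (2 * pi * s)}"

lemma circle_near_cis:
  assumes "r \<in> {s - 1 / 2 <..< s + 1 / 2}"
  shows "cis (2 * pi * r) \<in> circle_near s" "arg_near s (cis (2 * pi * r)) = r"
proof -
  have d: "cis (2 * pi * r) / cis (2 * pi * s) = cis (2 * pi * (r - s))"
    by (simp add: cis_divide algebra_simps)
  have "s - 1 / 2 < r" "r < s + 1 / 2" using assms by simp_all
  then have "\<bar>r - s\<bar> < 1 / 2" by linarith
  then have "2 * pi * \<bar>r - s\<bar> < 2 * pi * (1 / 2)"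
    using pi_gt_zero by (intro mult_strict_left_mono) auto
  then have b: "\<bar>2 * pi * (r - s)\<bar> < pi" by (simp add: abs_mult)
  then have A: "Arg (cis (2 * pi * (r - s))) = 2 * pi * (r - s)"
    by (intro Arg_cis) (auto simp: abs_less_iff)
  then show "arg_near s (cis (2 * pi * r)) = r"
    unfolding arg_near_def d A by simp
  have "cis (2 * pi * r) \<noteq> - cis (2 * pi * s)"
  proof
    assume "cis (2 * pi * r) = - cis (2 * pi * s)"
    then have "cis (2 * pi * (r - s)) = -1" using d by simp
    then have "Arg (-1) = 2 * pi * (r - s)" using A by simp
    moreover have "Arg (-1) = pi" using Arg_cis[of pi] by simp
    ultimately show False using b by simp
  qed
  then show "cis (2 * pi * r) \<in> circle_near s" by (simp add: circle_near_def)
qed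

lemma arg_near_circle:
  assumes "w \<in> circle_near s"
  shows "arg_near s w \<in> {s - 1 / 2 <..< s + 1 / 2}" "cis (2 * pi * arg_near s w) = w"
proof -
  define x where "x = w / cis (2 * pi * s)"
  have x: "cmod x = 1" "x \<noteq> -1" "x \<noteq> 0"
    using assms by (auto simp: x_def circle_near_def norm_divide divide_eq_eq)
  have cx: "cis (Arg x) = x" using x cis_Arg[of x] by (simp add: sgn_div_norm)
  have "Arg x \<noteq> pi" using cx x by auto
  then have "\<bar>Arg x\<bar> < pi" using Arg_bounded[of x] by (auto simp: abs_less_iff)
  then have "\<bar>Arg x / (2 * pi)\<bar> < 1 / 2"
    by (simp add: abs_divide divide_less_eq)
  moreover have "arg_near s w = s + Arg x / (2 * pi)" by (simp add: arg_near_def x_def)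
  ultimately have "s - 1 / 2 < arg_near s w" "arg_near s w < s + 1 / 2" by linarith+
  then show "arg_near s w \<in> {s - 1 / 2 <..< s + 1 / 2}" by simp
  have "cis (2 * pi * arg_near s w) = cis (2 * pi * s) * cis (Arg x)"
    by (simp add: arg_near_def x_def[symmetric] cis_mult distrib_left)
  then show "cis (2 * pi * arg_near s w) = w" unfolding cx by (simp add: x_def)
qed

lemma continuous_arg_near: "continuous_on (circle_near s) (arg_near s)"
proof -
  have "w / cis (2 * pi * s) \<notin> \<real>\<^sub>\<le>\<^sub>0" if "w \<in> circle_near s" for w
  proof
    assume "w / cis (2 * pi * s) \<in> \<real>\<^sub>\<le>\<^sub>0"
    then obtain r where r: "w / cis (2 * pi * s) = of_real r" "r \<le> 0" by (auto simp: nonpos_Reals_def)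
    have "cmod (w / cis (2 * pi * s)) = 1" using that by (simp add: circle_near_def norm_divide)
    then have "r = -1" using r by simp
    then have "w = - cis (2 * pi * s)" using r by (simp add: divide_eq_eq)
    then show False using that by (simp add: circle_near_def)
  qed
  then show ?thesis unfolding arg_near_def by (intro continuous_intros) auto
qed

definition circle_map :: "'v \<Rightarrow> real \<Rightarrow> 'v \<Rightarrow> complex" where
  "circle_map a s = (\<lambda>_. 1)(a := cis (2 * pi * s))"

definition torus_map :: "'v \<Rightarrow> 'v \<Rightarrow> real \<times> real \<Rightarrow> 'v \<Rightarrow> complex" where
  "torus_map a b z = (\<lambda>_. 1)(a := cis (2 * pi * fst z), b := cis (2 * pi * snd z))"

lemma continuous_cis_mult: "continuous_on S f \<Longrightarrow> continuous_on S (\<lambda>x. cis (2 * pi * f x))"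
  unfolding cis_conv_exp by (intro continuous_intros)

lemma unit_circle_cis: "cmod w = 1 \<Longrightarrow> \<exists>s. w = cis (2 * pi * s)"
  by (metis complex_norm_eq_1_exp cis_conv_exp nonzero_mult_div_cancel_left mult.commute
      times_divide_eq_right pi_neq_zero mult_eq_0_iff zero_neq_numeral)

lemma range_circle_map: "range (circle_map a) = subtorus {a}"
proof
  show "subtorus {a} \<subseteq> range (circle_map a)"
  proof
    fix y assume y: "y \<in> subtorus {a}"
    obtain s where "y a = cis (2 * pi * s)" using unit_circle_cis[of "y a"] y by (auto simp: subtorus_def)
    then have "y = circle_map a s" using y by (auto simp: subtorus_def circle_map_def)
    then show "y \<in> range (circle_map a)" by blast
  qed
qed (auto simp: subtorus_def circle_map_def)

lemma range_torus_map: "a \<noteq> b \<Longrightarrow> range (torus_map a b) = subtorus {a, b}"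
proof
  assume "a \<noteq> b"
  show "subtorus {a, b} \<subseteq> range (torus_map a b)"
  proof
    fix y assume y: "y \<in> subtorus {a, b}"
    obtain s where "y a = cis (2 * pi * s)" using unit_circle_cis[of "y a"] y by (auto simp: subtorus_def)
    moreover obtain t where "y b = cis (2 * pi * t)" using unit_circle_cis[of "y b"] y by (auto simp: subtorus_def)
    ultimately have "y = torus_map a b (s, t)" using y \<open>a \<noteq> b\<close> by (auto simp: subtorus_def torus_map_def)
    then show "y \<in> range (torus_map a b)" by blast
  qed
qed (auto simp: subtorus_def torus_map_def)

lemma open_not_eq: "open {y :: 'v \<Rightarrow> complex. y a \<noteq> w}"
  by (intro open_Collect_neq continuous_on_product_coordinates continuous_on_const)

lemma circle_covering: "covering_space UNIV (circle_map a) (subtorus {a})"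
  unfolding range_circle_map[of a, symmetric]
proof (rule covering_by_periods[where L = "\<int>"])
  show cont: "continuous_on UNIV (circle_map a)"
  proof (rule continuous_on_coordinatewise_then_product)
    show "continuous_on UNIV (\<lambda>s. circle_map a s i)" for i
      by (cases "i = a") (auto simp: circle_map_def intro!: continuous_cis_mult continuous_intros)
  qed
  show "circle_map a z = circle_map a w \<longleftrightarrow> z - w \<in> \<int>" for z w
    by (auto simp: circle_map_def fun_eq_iff cis_eq_iff[symmetric])
  fix s :: real
  define U where "U = {s - 1/2 <..< s + 1/2}"
  define T where "T = {y \<in> subtorus {a}. y a \<in> circle_near s}"
  have "T = subtorus {a} \<inter> {y. y a \<noteq> - cis (2 * pi * s)}"
    by (auto simp: T_def subtorus_def circle_near_def)
  then have "openin (top_of_set (subtorus {a})) T"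
    using openin_open_Int[OF open_not_eq[of a "- cis (2 * pi * s)"]] by simp
  moreover have "homeomorphism U T (circle_map a) (\<lambda>y. arg_near s (y a))"
  proof (rule homeomorphismI)
    show "continuous_on U (circle_map a)" using cont continuous_on_subset by blast
    show "continuous_on T (\<lambda>y. arg_near s (y a))"
      by (rule continuous_on_compose2[OF continuous_arg_near])
        (auto simp: T_def intro: continuous_on_subset[OF continuous_on_product_coordinates])
    show "circle_map a ` U \<subseteq> T"
      using circle_near_cis(1)[of _ s] unfolding T_def U_def circle_map_def subtorus_def by auto
    show "(\<lambda>y. arg_near s (y a)) ` T \<subseteq> U"
      using arg_near_circle(1)[of _ s] unfolding T_def U_def by blast
    show "arg_near s (circle_map a x a) = x" if "x \<in> U" for x
      using circle_near_cis(2)[of x s] that by (simp add: circle_map_def U_def)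
    show "circle_map a (arg_near s (y a)) = y" if "y \<in> T" for y
      using arg_near_circle(2)[of "y a" s] that by (auto simp: circle_map_def T_def subtorus_def)
  qed
  moreover have "open U" "s \<in> U" by (auto simp: U_def)
  ultimately show "\<exists>U T q. open U \<and> s \<in> U \<and> openin (top_of_set (range (circle_map a))) T \<and>
      homeomorphism U T (circle_map a) q"
    unfolding range_circle_map by blast
qed

lemma torus_covering:
  assumes "a \<noteq> b"
  shows "covering_space UNIV (torus_map a b) (subtorus {a, b})"
  unfolding range_torus_map[OF assms, symmetric]
proof (rule covering_by_periods[where L = "\<int> \<times> \<int>"])
  show cont: "continuous_on UNIV (torus_map a b)"
  proof (rule continuous_on_coordinatewise_then_product)
    show "continuous_on UNIV (\<lambda>z. torus_map a b z i)" for i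
      using assms by (cases "i = a"; cases "i = b")
        (auto simp: torus_map_def intro!: continuous_cis_mult continuous_intros)
  qed
  show "torus_map a b z = torus_map a b w \<longleftrightarrow> z - w \<in> \<int> \<times> \<int>" for z w
    using assms by (auto simp: torus_map_def fun_eq_iff cis_eq_iff[symmetric] mem_Times_iff)
  fix z :: "real \<times> real"
  obtain s t where z: "z = (s, t)" by force
  define U where "U = {s - 1/2 <..< s + 1/2} \<times> {t - 1/2 <..< t + 1/2}"
  define T where "T = {y \<in> subtorus {a, b}. y a \<in> circle_near s \<and> y b \<in> circle_near t}"
  have "T = subtorus {a, b} \<inter> ({y. y a \<noteq> - cis (2 * pi * s)} \<inter> {y. y b \<noteq> - cis (2 * pi * t)})"
    by (auto simp: T_def subtorus_def circle_near_def)
  then have "openin (top_of_set (subtorus {a, b})) T"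
    using openin_open_Int[OF open_Int[OF open_not_eq[of a "- cis (2 * pi * s)"]
      open_not_eq[of b "- cis (2 * pi * t)"]]] by simp
  moreover have "homeomorphism U T (torus_map a b) (\<lambda>y. (arg_near s (y a), arg_near t (y b)))"
  proof (rule homeomorphismI)
    show "continuous_on U (torus_map a b)" using cont continuous_on_subset by blast
    have coord: "continuous_on T (\<lambda>y. y c)" for c
      by (rule continuous_on_subset[OF continuous_on_product_coordinates]) simp
    have "continuous_on T (\<lambda>y. arg_near s (y a))"
      by (rule continuous_on_compose2[OF continuous_arg_near coord]) (auto simp: T_def)
    moreover have "continuous_on T (\<lambda>y. arg_near t (y b))"
      by (rule continuous_on_compose2[OF continuous_arg_near coord]) (auto simp: T_def)
    ultimately show "continuous_on T (\<lambda>y. (arg_near s (y a), arg_near t (y b)))"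
      by (rule continuous_on_Pair)
    show "torus_map a b ` U \<subseteq> T"
      using assms circle_near_cis(1)[of _ s] circle_near_cis(1)[of _ t]
      unfolding T_def U_def torus_map_def subtorus_def by auto
    show "(\<lambda>y. (arg_near s (y a), arg_near t (y b))) ` T \<subseteq> U"
      using arg_near_circle(1)[of _ s] arg_near_circle(1)[of _ t]
      unfolding T_def U_def by blast
    show "(arg_near s (torus_map a b x a), arg_near t (torus_map a b x b)) = x" if "x \<in> U" for x
      using circle_near_cis(2)[of "fst x" s] circle_near_cis(2)[of "snd x" t] that assms
      unfolding torus_map_def U_def by auto
    show "torus_map a b (arg_near s (y a), arg_near t (y b)) = y" if "y \<in> T" for y
      using arg_near_circle(2)[of "y a" s] arg_near_circle(2)[of "y b" t] that
      by (auto simp: torus_map_def T_def subtorus_def)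
  qed
  moreover have "open U" "z \<in> U" by (auto simp: U_def z open_Times)
  ultimately show "\<exists>U T q. open U \<and> z \<in> U \<and> openin (top_of_set (range (torus_map a b))) T \<and>
      homeomorphism U T (torus_map a b) q"
    unfolding range_torus_map[OF assms] by blast
qed

text \<open>After subtracting the value at 0, a distance-preserving self-map of a Euclidean space is
  an orthogonal transformation.\<close>

lemma isometry_surj:
  fixes f :: "'e::euclidean_space \<Rightarrow> 'e"
  assumes "\<And>x y. dist (f x) (f y) = dist x y"
  shows "surj f"
proof -
  have "orthogonal_transformation (\<lambda>x. f x - f 0)"
    unfolding orthogonal_transformation_isometry using assms by (simp add: dist_norm)
  then have s: "surj (\<lambda>x. f x - f 0)" by (rule orthogonal_transformation_surj)
  have "y \<in> range f" for y
  proof -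
    obtain x where "f x - f 0 = y - f 0" using surjD[OF s] by metis
    then show ?thesis by (auto simp: image_iff)
  qed
  then show ?thesis by blast
qed

section \<open>Standard flats and standard geodesics\<close>

context simplicial_graph
begin

definition flat :: "'v kvertex \<Rightarrow> 'v \<Rightarrow> 'v \<Rightarrow> 'v kpoint set" where
  "flat g a b = range (flat_pt g a b)"

definition line_pt :: "'v kvertex \<Rightarrow> 'v \<Rightarrow> real \<Rightarrow> 'v kpoint" where
  "line_pt g a s = edge_pt (lifted_edge \<Gamma> (vpow g a \<lfloor>s\<rfloor>) a) (frac s)"

definition line :: "'v kvertex \<Rightarrow> 'v \<Rightarrow> 'v kpoint set" where
  "line g a = range (line_pt g a)"

lemma line_pt_flat_pt: "g \<in> G \<Longrightarrow> b \<in> lk a \<Longrightarrow> line_pt g a s = flat_pt g a b (s, 0)"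
  using lkD(1)[of b a] by (simp add: line_pt_def flat_pt_def lifted_square_act square_pt_sides lifted_edge_def step_act)

section \<open>The covering projection in coordinates\<close>

lemma covering_proj_square:
  assumes "g \<in> G" "b \<in> lk a" "s \<in> {0..1}" "t \<in> {0..1}"
  shows "covering_proj \<Gamma> (square_pt (lifted_square \<Gamma> g a b) (s, t)) = torus_map a b (s, t)"
  by (rule covering_proj_eqI[OF fsg])
    (use lies_over.intros(3)[of g \<Gamma> a b s t] assms in \<open>simp add: torus_map_def lk_def\<close>)

lemma covering_proj_edge:
  assumes "g \<in> G" "a \<in> V" "s \<in> {0..1}"
  shows "covering_proj \<Gamma> (edge_pt (lifted_edge \<Gamma> g a) s) = circle_map a s"
  by (rule covering_proj_eqI[OF fsg])
    (use lies_over.intros(2)[of g \<Gamma> a s] assms in \<open>simp add: circle_map_def\<close>)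

lemma cis_frac: "cis (2 * pi * frac s) = cis (2 * pi * s)"
  by (simp add: cis_eq_iff frac_def)

lemma covering_proj_flat_pt:
  assumes "g \<in> G" "b \<in> lk a"
  shows "covering_proj \<Gamma> (flat_pt g a b z) = torus_map a b z"
proof -
  have "covering_proj \<Gamma> (flat_pt g a b z) = torus_map a b (frac (fst z), frac (snd z))"
    unfolding flat_pt_def
    by (rule covering_proj_square) (use assms in \<open>auto simp: frac_lt_1 less_imp_le\<close>)
  then show ?thesis by (simp add: torus_map_def cis_frac)
qed

lemma covering_proj_line_pt:
  assumes "g \<in> G" "a \<in> V"
  shows "covering_proj \<Gamma> (line_pt g a s) = circle_map a s"
proof -
  have "covering_proj \<Gamma> (line_pt g a s) = circle_map a (frac s)"
    unfolding line_pt_def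
    by (rule covering_proj_edge) (use assms in \<open>auto simp: frac_lt_1 less_imp_le\<close>)
  then show ?thesis by (simp add: circle_map_def cis_frac)
qed

lemma flat_pt_is_isometric_embedding:
  "g \<in> G \<Longrightarrow> b \<in> lk a \<Longrightarrow> isometric_embedding TYPE(real \<times> real) K (flat_pt g a b)"
  unfolding isometric_embedding_def using flat_pt_in_K flat_pt_isometric by blast

lemma line_pt_is_isometric_embedding:
  assumes "g \<in> G" "b \<in> lk a"
  shows "isometric_embedding TYPE(real) K (line_pt g a)"
  unfolding isometric_embedding_def
  using flat_pt_in_K[OF assms] flat_pt_isometric[OF assms] by (auto simp: line_pt_flat_pt[OF assms] dist_prod_def)

lemma affine_ext_lipschitz_dist:
  assumes "x \<in> realization K" "y \<in> realization K"
    "\<And>g a. g \<in> G \<Longrightarrow> a \<in> V \<Longrightarrow> \<bar>\<phi> (act g [(a, True)]) - \<phi> g\<bar> \<le> 1"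
  shows "\<bar>affine_ext \<phi> x - affine_ext \<phi> y\<bar> \<le> 2 * path_dist K x y"
proof -
  obtain l where l: "polygonal K x y l" using assms(1,2) by (rule K_connected)
  have "\<bar>affine_ext \<phi> x - affine_ext \<phi> y\<bar> / 2 \<le> path_dist K x y"
    by (rule path_dist_ge[OF l]) (use affine_ext_lipschitz[OF _ assms(3)] in fastforce)
  then show ?thesis by simp
qed

text \<open>In both applications \<open>\<phi>\<close> is the indicator function of a coset; it keeps the image of \<open>c\<close>
  inside a single one of the pairwise disjoint flats (or lines) of a given type.\<close>

lemma isometric_embedding_fills:
  fixes c d :: "'e::euclidean_space \<Rightarrow> 'v kpoint"
  assumes "isometric_embedding TYPE('e) K c" "isometric_embedding TYPE('e) K d"
    "\<And>g a. g \<in> G \<Longrightarrow> a \<in> V \<Longrightarrow> \<bar>\<phi> (act g [(a, True)]) - \<phi> g\<bar> \<le> 1"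
    "\<And>z. affine_ext \<phi> (d z) = 1" "\<And>z. c z \<in> range d \<or> affine_ext \<phi> (c z) = 0" "c 0 \<in> range d"
  shows "range c = range d"
proof -
  have c: "c z \<in> realization K" "path_dist K (c z) (c w) = dist z w" for z w
    using assms(1) by (auto simp: isometric_embedding_def)
  define f where "f = (\<lambda>z. affine_ext \<phi> (c z))"
  have lip: "\<bar>f z - f w\<bar> \<le> 2 * dist z w" for z w
    using affine_ext_lipschitz_dist[OF c(1) c(1) assms(3), of z w] c(2) by (simp add: f_def)
  have "2-lipschitz_on UNIV f" by (rule lipschitz_onI) (use lip in \<open>auto simp: dist_real_def\<close>)
  then have cont: "continuous_on UNIV f" by (rule lipschitz_on_continuous_on)
  have val: "f z = 0 \<or> f z = 1" for z using assms(4,5) unfolding f_def by (metis imageE)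
  \<comment> \<open>\<open>f\<close> is continuous on a connected space and takes only the values 0
    and 1, so \<open>c\<close> never leaves the flat or line containing \<open>c 0\<close>.\<close>
  have "f constant_on UNIV"
  proof (rule continuous_discrete_range_constant[OF connected_UNIV cont])
    fix x
    show "\<exists>e>0. \<forall>y. y \<in> UNIV \<and> f y \<noteq> f x \<longrightarrow> e \<le> norm (f y - f x)"
    proof (intro exI[of _ 1] conjI allI impI)
      fix y assume "y \<in> UNIV \<and> f y \<noteq> f x"
      then show "1 \<le> norm (f y - f x)" using val[of x] val[of y] by auto
    qed simp
  qed
  moreover have "f 0 = 1" using assms(4,6) unfolding f_def by (metis imageE)
  ultimately have "f z = 1" for z by (metis UNIV_I constant_on_def)
  then have "c z \<in> range d" for z using assms(5)[of z] by (simp add: f_def)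
  then have "\<forall>z. \<exists>w. c z = d w" by blast
  then obtain \<kappa> where \<kappa>: "\<And>z. c z = d (\<kappa> z)" using choice[of "\<lambda>z w. c z = d w"] by blast
  \<comment> \<open>Read in the coordinates of \<open>d\<close>, the map \<open>c\<close> becomes a
    self-isometry of a Euclidean space, hence is onto.\<close>
  have "dist (\<kappa> z) (\<kappa> w) = dist z w" for z w
    using c(2)[of z w] assms(2) by (simp add: \<kappa> isometric_embedding_def)
  then have "surj \<kappa>" by (rule isometry_surj)
  moreover have "c = d \<circ> \<kappa>" using \<kappa> by auto
  ultimately show ?thesis by (metis image_comp)
qed

lemma step_back: "g \<in> G \<Longrightarrow> a \<in> V \<Longrightarrow> act g [(a, True)] = h \<Longrightarrow> act h [(a, False)] = g"
  by auto

section \<open>The vertices of flats and lines\<close>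

lemma coset_edge_iff:
  assumes "g \<in> G" "b \<in> lk a"
  shows "q \<in> coset {a, b} g \<longleftrightarrow> (\<exists>m n. q = grid g a b m n)"
proof
  have V: "a \<in> V" "b \<in> V" using assms lkD by blast+
  assume "q \<in> coset {a, b} g"
  then obtain u where u: "u \<in> words {a, b}" "q = act g u" by (rule cosetE)
  have "\<exists>m n. act g u = grid g a b m n"
    using u(1)
  proof (induction u rule: rev_induct)
    case Nil
    have "act g [] = grid g a b 0 0" using assms V by simp
    then show ?case by blast
  next
    case (snoc x u)
    then obtain m n where mn: "act g u = grid g a b m n" by auto
    have u: "u \<in> words V" using snoc.prems words_mono[of "{a, b}" V] V by auto
    obtain c d where x: "x = (c, d)" by force
    have cab: "c = a \<or> c = b" using snoc.prems x by auto
    have *: "act g (u @ [x]) = act (grid g a b m n) [(c, d)]"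
      using u x cab V assms(1) mn by (auto simp: act_append)
    have "act (grid g a b m n) [(a, False)] = grid g a b (m - 1) n"
      "act (grid g a b m n) [(b, False)] = grid g a b m (n - 1)"
      using step_back[OF grid_in[OF assms] V(1) grid_succ(1)[OF assms, of "m - 1" n, symmetric]]
        step_back[OF grid_in[OF assms] V(2) grid_succ(2)[OF assms, of m "n - 1", symmetric]] by simp_all
    then show ?case
      using cab grid_succ[OF assms, of m n] unfolding * by (cases d) metis+
  qed
  then show "\<exists>m n. q = grid g a b m n" using u by simp
next
  assume "\<exists>m n. q = grid g a b m n"
  then obtain m n where q: "q = grid g a b m n" by blast
  have V: "a \<in> V" "b \<in> V" using assms lkD by blast+
  have "q = act g (replicate (nat \<bar>m\<bar>) (a, 0 \<le> m) @ replicate (nat \<bar>n\<bar>) (b, 0 \<le> n))"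
    using assms V by (simp add: q grid_def vpow_def act_append)
  then show "q \<in> coset {a, b} g" using coset_act by simp
qed

lemma coset_vertex_iff:
  assumes "g \<in> G" "a \<in> V"
  shows "q \<in> coset {a} g \<longleftrightarrow> (\<exists>n. q = vpow g a n)"
proof
  assume "q \<in> coset {a} g"
  then obtain u where u: "u \<in> words {a}" "q = act g u" by (rule cosetE)
  have "\<exists>n. act g u = vpow g a n"
    using u(1)
  proof (induction u rule: rev_induct)
    case Nil
    have "act g [] = vpow g a 0" using assms by simp
    then show ?case by blast
  next
    case (snoc x u)
    then obtain n where n: "act g u = vpow g a n" by auto
    have u: "u \<in> words V" using snoc.prems words_mono[of "{a}" V] assms by auto
    obtain d where x: "x = (a, d)" using snoc.prems by (cases x) auto
    have *: "act g (u @ [x]) = act (vpow g a n) [(a, d)]"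
      using u x assms n by (simp add: act_append)
    show ?case
      using vpow_succ[OF assms, of n] vpow_pred[OF assms, of n] unfolding * by (cases d) metis+
  qed
  then show "\<exists>n. q = vpow g a n" using u by simp
next
  assume "\<exists>n. q = vpow g a n"
  then show "q \<in> coset {a} g" using coset_act unfolding vpow_def by auto
qed

lemma affine_ext_on_flat:
  assumes "g \<in> G" "b \<in> lk a" "\<And>q. q \<in> coset {a, b} g \<Longrightarrow> \<phi> q = r"
  shows "affine_ext \<phi> (flat_pt g a b z) = r"
proof -
  have "\<phi> (grid g a b m n) = r" for m n using assms coset_edge_iff by blast
  then show ?thesis
    using grid_succ[OF assms(1,2), of "\<lfloor>fst z\<rfloor>" "\<lfloor>snd z\<rfloor>"]
      grid_succ(2)[OF assms(1,2), of "\<lfloor>fst z\<rfloor> + 1" "\<lfloor>snd z\<rfloor>"]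
    by (simp add: flat_pt_def lifted_square_act affine_ext_square flip: grid_succ[OF assms(1,2)])
      (simp add: algebra_simps)
qed

lemma affine_ext_on_line:
  assumes "g \<in> G" "a \<in> V" "\<And>q. q \<in> coset {a} g \<Longrightarrow> \<phi> q = r"
  shows "affine_ext \<phi> (line_pt g a s) = r"
proof -
  have "\<phi> (vpow g a n) = r" for n using assms coset_vertex_iff by blast
  then show ?thesis
    by (simp add: line_pt_def lifted_edge_def step_act affine_ext_edge flip: vpow_succ[OF assms(1,2)])
      (simp add: algebra_simps)
qed

text \<open>The extended indicator function of the coset is 1 on the whole flat, and at a vertex it
  tests membership. This replaces a comparison of weights in different cells.\<close>

lemma vertex_in_flat:
  assumes "g \<in> G" "b \<in> lk a"
  shows "vertex_pt q \<in> flat g a b \<longleftrightarrow> q \<in> coset {a, b} g"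
proof
  assume "vertex_pt q \<in> flat g a b"
  then obtain z where z: "vertex_pt q = flat_pt g a b z" by (auto simp: flat_def)
  have "affine_ext (\<lambda>p. of_bool (p \<in> coset {a, b} g)) (flat_pt g a b z) = 1"
    by (rule affine_ext_on_flat[OF assms]) simp
  then show "q \<in> coset {a, b} g" by (simp add: z[symmetric] affine_ext_vertex)
next
  assume "q \<in> coset {a, b} g"
  then show "vertex_pt q \<in> flat g a b"
    using coset_edge_iff[OF assms] flat_pt_lattice[OF assms] unfolding flat_def by (metis rangeI)
qed

lemma line_pt_lattice: "g \<in> G \<Longrightarrow> a \<in> V \<Longrightarrow> line_pt g a (of_int n) = vertex_pt (vpow g a n)"
  by (simp add: line_pt_def lifted_edge_def)

lemma vertex_in_line:
  assumes "g \<in> G" "a \<in> V"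
  shows "vertex_pt q \<in> line g a \<longleftrightarrow> q \<in> coset {a} g"
proof
  assume "vertex_pt q \<in> line g a"
  then obtain s where s: "vertex_pt q = line_pt g a s" by (auto simp: line_def)
  have "affine_ext (\<lambda>p. of_bool (p \<in> coset {a} g)) (line_pt g a s) = 1"
    by (rule affine_ext_on_line[OF assms]) simp
  then show "q \<in> coset {a} g" by (simp add: s[symmetric] affine_ext_vertex)
next
  assume "q \<in> coset {a} g"
  then show "vertex_pt q \<in> line g a"
    using coset_vertex_iff[OF assms] line_pt_lattice[OF assms] unfolding line_def by (metis rangeI)
qed

lemma flat_eq:
  assumes "g \<in> G" "b \<in> lk a" "h \<in> coset {a, b} g"
  shows "flat h a b = flat g a b"
proof -
  obtain m n where h: "h = grid g a b m n" using assms coset_edge_iff by blast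
  have "flat_pt h a b = flat_pt g a b \<circ> (\<lambda>z. z + (of_int m, of_int n))"
    using flat_pt_translate[OF assms(1,2), of m n] by (auto simp: h)
  moreover have "surj (\<lambda>z. z + (real_of_int m, real_of_int n))"
    by (rule isometry_surj) simp
  ultimately show ?thesis unfolding flat_def by (metis image_comp)
qed

lemma flat_swap:
  assumes "g \<in> G" "b \<in> lk a"
  shows "flat g a b = flat g b a"
proof -
  have "flat_pt g a b = flat_pt g b a \<circ> prod.swap" using flat_pt_swap[OF assms] by auto
  then show ?thesis unfolding flat_def by (metis image_comp surj_swap)
qed

lemma line_eq:
  assumes "g \<in> G" "b \<in> lk a" "h \<in> coset {a} g"
  shows "line h a = line g a"
proof -
  have V: "a \<in> V" "b \<in> V" using assms lkD by blast+
  obtain m where h: "h = grid g a b m 0" using assms V coset_vertex_iff[of g a h] by auto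
  have "line_pt h a = line_pt g a \<circ> (\<lambda>s. s + of_int m)"
    using flat_pt_translate[OF assms(1,2), of m 0] line_pt_flat_pt[OF _ assms(2)] assms(1) grid_in[OF assms(1,2), of m 0]
    by (auto simp: h)
  moreover have "surj (\<lambda>s. s + real_of_int m)" by (rule isometry_surj) simp
  ultimately show ?thesis unfolding line_def by (metis image_comp)
qed

lemma square_in_flat:
  assumes "g \<in> G" "b \<in> lk a" "s \<in> {0..1}" "t \<in> {0..1}"
  shows "square_pt (lifted_square \<Gamma> g a b) (s, t) \<in> flat g a b"
proof -
  have "a \<in> V" "b \<in> V" using assms lkD by blast+
  then have "flat_pt g a b (s, t) = square_pt (lifted_square \<Gamma> g a b) (s, t)"
    using flat_pt_cell[OF assms(1,2), of 0 s 0 t] assms by simp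
  then show ?thesis unfolding flat_def by (metis rangeI)
qed

section \<open>Points above a circle or a torus\<close>

lemma circle_map_trivial: "0 \<le> s \<Longrightarrow> s \<le> 1 \<Longrightarrow> circle_map c s c = 1 \<Longrightarrow> s = 0 \<or> s = 1"
proof -
  assume s: "0 \<le> s" "s \<le> 1" "circle_map c s c = 1"
  then have "s \<in> \<int>" using cis_eq_iff[of s 0] by (simp add: circle_map_def)
  then obtain n where "s = of_int n" by (auto elim: Ints_cases)
  then show ?thesis using s by auto
qed

text \<open>If the label is not in \<open>{a, b}\<close>, its circle coordinate must be trivial,
  which leaves only end points of the edge; every vertex lies on a flat of the given type.\<close>

lemma edge_over_torus:
  assumes "g \<in> G" "c \<in> V" "s \<in> {0..1}" "b \<in> lk a"
    "covering_proj \<Gamma> (edge_pt (lifted_edge \<Gamma> g c) s) \<in> subtorus {a, b}"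
  shows "\<exists>h \<in> G. edge_pt (lifted_edge \<Gamma> g c) s \<in> flat h a b"
proof -
  have ba: "a \<in> lk b" using assms lk_sym by blast
  have V: "a \<in> V" "b \<in> V" using assms lkD by blast+
  have on: "edge_pt (lifted_edge \<Gamma> g c) s \<in> flat g c d" if "d \<in> lk c" for d
    using square_in_flat[OF assms(1) that assms(3), of 0]
    by (simp add: lifted_square_act square_pt_sides lifted_edge_def step_act)
  consider "c = a" | "c = b" | "c \<notin> {a, b}" by blast
  then show ?thesis
  proof cases
    case 1
    then show ?thesis using on[of b] assms by blast
  next
    case 2
    then show ?thesis using on[of a] assms ba flat_swap[of g b a] by auto
  next
    case 3
    then have "circle_map c s c = 1"
      using assms(5) unfolding covering_proj_edge[OF assms(1-3)] subtorus_def by blast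
    then have "s = 0 \<or> s = 1" using circle_map_trivial[of s c] assms(3) by auto
    moreover have "act g [(c, True)] \<in> G" using assms(1,2) by simp
    ultimately have "\<exists>h \<in> G. edge_pt (lifted_edge \<Gamma> g c) s = vertex_pt h"
      using assms(1) by (auto simp: lifted_edge_def step_act)
    then obtain h where "h \<in> G" "edge_pt (lifted_edge \<Gamma> g c) s = vertex_pt h" by blast
    then show ?thesis using vertex_in_flat[OF _ assms(4)] by (metis coset_self)
  qed
qed

text \<open>A square with a label outside \<open>{a, b}\<close> meets the preimage of the torus only
  where that coordinate is 0 or 1, hence along edges.\<close>

lemma point_over_torus:
  assumes "x \<in> realization K" "b \<in> lk a" "covering_proj \<Gamma> x \<in> subtorus {a, b}"
  shows "\<exists>h \<in> G. x \<in> flat h a b"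
  using assms(1)
proof (cases rule: realization_cases)
  case (vertex g)
  then show ?thesis
    using vertex_in_flat[OF _ assms(2), of g g] by (intro bexI[of _ g]) (auto simp: K_verts)
next
  case (edge e s)
  then show ?thesis using edge_over_torus[OF _ _ _ assms(2)] assms(3) by (auto simp: K_edges)
next
  case (square q z)
  obtain s t where z: "z = (s, t)" by force
  obtain g c d where q: "q = lifted_square \<Gamma> g c d" "g \<in> G" "d \<in> lk c" using square by (auto simp: K_squares)
  have V: "c \<in> V" "d \<in> V" "c \<noteq> d" using q lkD by blast+
  have st: "s \<in> {0..1}" "t \<in> {0..1}" using square z by auto
  have xe: "x = square_pt (lifted_square \<Gamma> g c d) (s, t)" using square z q by simp
  have edge: ?thesis if "x = edge_pt (lifted_edge \<Gamma> h i) r" "h \<in> G" "i \<in> V" "r \<in> {0..1}" for h i r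
    using edge_over_torus[OF that(2-4) assms(2)] assms(3) that(1) by simp
  have proj: "torus_map c d (s, t) \<in> subtorus {a, b}"
    using assms(3) covering_proj_square[OF q(2,3) st] xe by simp
  consider "c \<notin> {a, b}" | "d \<notin> {a, b}" | "c = a" "d = b" | "c = b" "d = a" using V by blast
  then show ?thesis
  proof cases
    case 1
    then have "torus_map c d (s, t) c = 1" using proj unfolding subtorus_def by blast
    then have "circle_map c s c = 1" using V by (simp add: torus_map_def circle_map_def)
    then have "s = 0 \<or> s = 1" using circle_map_trivial[of s c] st by auto
    then show ?thesis
      using edge[of g d t] edge[of "act g [(c, True)]" d t] q V st
      by (auto simp: xe lifted_square_act square_pt_sides lifted_edge_def step_act)
  next
    case 2
    then have "torus_map c d (s, t) d = 1" using proj unfolding subtorus_def by blast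
    then have "circle_map d t d = 1" using V by (simp add: torus_map_def circle_map_def)
    then have "t = 0 \<or> t = 1" using circle_map_trivial[of t d] st by auto
    then show ?thesis
      using edge[of g c s] edge[of "act g [(d, True)]" c s] q V st act_commute1[OF q(3,2)]
      by (auto simp: xe lifted_square_act square_pt_sides lifted_edge_def step_act)
  next
    case 3
    then show ?thesis using square_in_flat[OF q(2,3) st] q xe by auto
  next
    case 4
    then show ?thesis using square_in_flat[OF q(2,3) st] flat_swap[OF q(2,3)] q xe by auto
  qed
qed

text \<open>The circle lies in the torus of \<open>{a, b}\<close>, so the point is on a flat, and
  its \<open>b\<close>-coordinate is an integer.\<close>

lemma point_over_circle:
  assumes "x \<in> realization K" "b \<in> lk a" "covering_proj \<Gamma> x \<in> subtorus {a}"
  shows "\<exists>h \<in> G. x \<in> line h a"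
proof -
  have ab: "a \<noteq> b" "a \<in> V" "b \<in> V" using assms lkD by blast+
  have "covering_proj \<Gamma> x \<in> subtorus {a, b}" using assms(3) by (auto simp: subtorus_def)
  then obtain g s t where g: "g \<in> G" "x = flat_pt g a b (s, t)"
    using point_over_torus[OF assms(1,2)] by (auto simp: flat_def)
  have "torus_map a b (s, t) b = 1"
    using assms(3) covering_proj_flat_pt[OF g(1) assms(2)] ab(1) unfolding subtorus_def g(2) by auto
  then have "t \<in> \<int>" using cis_eq_iff[of t 0] by (simp add: torus_map_def)
  then obtain n where "t = of_int n" by (auto elim: Ints_cases)
  then have "x = line_pt (grid g a b 0 n) a s"
    using flat_pt_translate[OF g(1) assms(2), of 0 n s 0] g line_pt_flat_pt[OF grid_in[OF g(1) assms(2)] assms(2)] by simp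
  then show ?thesis unfolding line_def using grid_in[OF g(1) assms(2)] by blast
qed

lemma indicator_step: "\<bar>of_bool P - (of_bool Q :: real)\<bar> \<le> 1"
  by simp

text \<open>A point of an embedding that covers the torus of \<open>{a, b}\<close> lies on some grid
  flat of this type. The indicator of one coset shows that all points lie on the same flat, and the
  embedding fills it.\<close>

lemma standard_flats_eq: "standard_flats \<Gamma> = {flat g a b | g a b. g \<in> G \<and> b \<in> lk a}"
proof (intro set_eqI iffI)
  fix F assume "F \<in> {flat g a b | g a b. g \<in> G \<and> b \<in> lk a}"
  then obtain g a b where F: "F = range (flat_pt g a b)" "g \<in> G" "b \<in> lk a" by (auto simp: flat_def)
  have "covering_proj \<Gamma> \<circ> flat_pt g a b = torus_map a b" using covering_proj_flat_pt F by auto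
  then have "covering_space UNIV (covering_proj \<Gamma> \<circ> flat_pt g a b) (subtorus {a, b})"
    using torus_covering lkD(3)[OF F(3)] by simp
  moreover have "{a, b} \<in> gedges \<Gamma>" using F by (simp add: lk_def)
  ultimately show "F \<in> standard_flats \<Gamma>"
    unfolding standard_flats_def using F flat_pt_is_isometric_embedding by blast
next
  fix F assume "F \<in> standard_flats \<Gamma>"
  then obtain c e where F: "F = range c" "e \<in> gedges \<Gamma>"
    "isometric_embedding TYPE(real \<times> real) K c" "covering_space UNIV (covering_proj \<Gamma> \<circ> c) (subtorus e)"
    by (auto simp: standard_flats_def)
  have "card e = 2" using F fsg by (auto simp: finite_simplicial_graph_def)
  then obtain a b where e: "e = {a, b}" by (auto simp: card_2_iff)
  have ab: "b \<in> lk a" using F e by (simp add: lk_def)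
  have abV: "{a, b} \<subseteq> V" using ab lkD by blast
  have "covering_proj \<Gamma> (c z) \<in> subtorus {a, b}" for z
    using covering_space_imp_surjective[OF F(4)] e by auto
  moreover have "c z \<in> realization K" for z using F(3) by (auto simp: isometric_embedding_def)
  ultimately have over: "\<exists>h \<in> G. c z \<in> flat h a b" for z using point_over_torus[OF _ ab] by blast
  obtain g where g: "g \<in> G" "c 0 \<in> flat g a b" using over by blast
  let ?\<phi> = "\<lambda>p. of_bool (p \<in> coset {a, b} g)"
  have "range c = range (flat_pt g a b)"
  proof (rule isometric_embedding_fills[OF F(3) flat_pt_is_isometric_embedding[OF g(1) ab], of ?\<phi>])
    show "\<bar>of_bool (act h [(i, True)] \<in> coset {a, b} g) - (of_bool (h \<in> coset {a, b} g) :: real)\<bar> \<le> 1" for h i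
      by (rule indicator_step)
    show "affine_ext ?\<phi> (flat_pt g a b z) = 1" for z by (rule affine_ext_on_flat[OF g(1) ab]) simp
    show "c 0 \<in> range (flat_pt g a b)" using g by (simp add: flat_def)
    fix z
    obtain h where h: "h \<in> G" "c z \<in> flat h a b" using over by blast
    show "c z \<in> range (flat_pt g a b) \<or> affine_ext ?\<phi> (c z) = 0"
    proof (cases "h \<in> coset {a, b} g")
      case True
      then show ?thesis using flat_eq[OF g(1) ab True] h by (simp add: flat_def)
    next
      case False
      have "q \<notin> coset {a, b} g" if "q \<in> coset {a, b} h" for q
        using False that coset_eq[OF abV g(1)] coset_eq[OF abV h(1)] coset_self[OF h(1)] by blast
      then have "affine_ext ?\<phi> (flat_pt h a b w) = 0" for w by (intro affine_ext_on_flat[OF h(1) ab]) simp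
      then show ?thesis using h(2) by (auto simp: flat_def)
    qed
  qed
  then show "F \<in> {flat g a b | g a b. g \<in> G \<and> b \<in> lk a}" using F g ab by (auto simp: flat_def)
qed

end

context atomic_graph
begin

text \<open>The argument for flats with one coordinate less; a neighbour \<open>b\<close> of
  \<open>a\<close> places each line in a flat, from which it inherits its metric.\<close>

lemma standard_geodesics_eq: "standard_geodesics \<Gamma> = {line g a | g a. g \<in> G \<and> a \<in> V}"
proof (intro set_eqI iffI)
  fix F assume "F \<in> {line g a | g a. g \<in> G \<and> a \<in> V}"
  then obtain g a where F: "F = range (line_pt g a)" "g \<in> G" "a \<in> V" by (auto simp: line_def)
  obtain b where b: "b \<in> lk a" using two_neighbours[OF F(3)] by metis
  have "covering_proj \<Gamma> \<circ> line_pt g a = circle_map a" using covering_proj_line_pt F by auto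
  then have "covering_space UNIV (covering_proj \<Gamma> \<circ> line_pt g a) (subtorus {a})"
    using circle_covering by simp
  then show "F \<in> standard_geodesics \<Gamma>"
    unfolding standard_geodesics_def using F line_pt_is_isometric_embedding[OF F(2) b] by blast
next
  fix F assume "F \<in> standard_geodesics \<Gamma>"
  then obtain c a where F: "F = range c" "a \<in> V"
    "isometric_embedding TYPE(real) K c" "covering_space UNIV (covering_proj \<Gamma> \<circ> c) (subtorus {a})"
    by (auto simp: standard_geodesics_def)
  obtain b where b: "b \<in> lk a" using two_neighbours[OF F(2)] by metis
  have aV: "{a} \<subseteq> V" using F by simp
  have "covering_proj \<Gamma> (c z) \<in> subtorus {a}" for z
    using covering_space_imp_surjective[OF F(4)] by auto
  moreover have "c z \<in> realization K" for z using F(3) by (auto simp: isometric_embedding_def)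
  ultimately have over: "\<exists>h \<in> G. c z \<in> line h a" for z using point_over_circle[OF _ b] by blast
  obtain g where g: "g \<in> G" "c 0 \<in> line g a" using over by blast
  let ?\<phi> = "\<lambda>p. of_bool (p \<in> coset {a} g)"
  have "range c = range (line_pt g a)"
  proof (rule isometric_embedding_fills[OF F(3) line_pt_is_isometric_embedding[OF g(1) b], of ?\<phi>])
    show "\<bar>of_bool (act h [(i, True)] \<in> coset {a} g) - (of_bool (h \<in> coset {a} g) :: real)\<bar> \<le> 1" for h i
      by (rule indicator_step)
    show "affine_ext ?\<phi> (line_pt g a z) = 1" for z by (rule affine_ext_on_line[OF g(1) F(2)]) simp
    show "c 0 \<in> range (line_pt g a)" using g by (simp add: line_def)
    fix z
    obtain h where h: "h \<in> G" "c z \<in> line h a" using over by blast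
    show "c z \<in> range (line_pt g a) \<or> affine_ext ?\<phi> (c z) = 0"
    proof (cases "h \<in> coset {a} g")
      case True
      then show ?thesis using line_eq[OF g(1) b True] h by (simp add: line_def)
    next
      case False
      have "q \<notin> coset {a} g" if "q \<in> coset {a} h" for q
        using False that coset_eq[OF aV g(1)] coset_eq[OF aV h(1)] coset_self[OF h(1)] by blast
      then have "affine_ext ?\<phi> (line_pt h a w) = 0" for w by (intro affine_ext_on_line[OF h(1) F(2)]) simp
      then show ?thesis using h(2) by (auto simp: line_def)
    qed
  qed
  then show "F \<in> {line g a | g a. g \<in> G \<and> a \<in> V}" using F g by (auto simp: line_def)
qed

end

section \<open>Flats as edges of the extension graph\<close>

definition verts :: "('a \<Rightarrow> real) set \<Rightarrow> 'a set" where
  "verts F = {q. vertex_pt q \<in> F}"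

context atomic_graph
begin

text \<open>A condition on vertices only. By \<open>inc_flat\<close> below, the classes incident to
  a flat are exactly those of its two directions.\<close>

definition inc :: "'v \<times> 'v kvertex set \<Rightarrow> 'v kpoint set \<Rightarrow> bool" where
  "inc u F \<longleftrightarrow> verts F \<subseteq> snd u"

section \<open>Flats and geodesics through their vertex sets\<close>

lemma verts_flat: "g \<in> G \<Longrightarrow> b \<in> lk a \<Longrightarrow> verts (flat g a b) = coset {a, b} g"
  by (simp add: verts_def vertex_in_flat)

lemma verts_line: "g \<in> G \<Longrightarrow> a \<in> V \<Longrightarrow> verts (line g a) = coset {a} g"
  by (simp add: verts_def vertex_in_line)

lemma standard_flatE:
  assumes "F \<in> standard_flats \<Gamma>"
  obtains g a b where "g \<in> G" "b \<in> lk a" "F = flat g a b"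
  using assms by (auto simp: standard_flats_eq)

lemma standard_geodesicE:
  assumes "F \<in> standard_geodesics \<Gamma>"
  obtains g a where "g \<in> G" "a \<in> V" "F = line g a"
  using assms by (auto simp: standard_geodesics_eq)

text \<open>A single letter is a reduced word, so convexity of the larger coset forces it into
  \<open>T\<close>.\<close>

lemma coset_label_subset:
  assumes "g \<in> G" "S \<subseteq> V" "T \<subseteq> V" "coset S g \<subseteq> coset T g"
  shows "S \<subseteq> T"
proof
  fix a assume a: "a \<in> S"
  then have "act g [(a, True)] \<in> coset T g"
    using assms(4) coset_act[of "[(a, True)]" S g] by auto
  then show "a \<in> T"
    using reduced_in_coset[OF assms(1,3), of "[(a, True)]"] a assms(2) by auto
qed

lemma verts_flat_eq:
  assumes "g \<in> G" "b \<in> lk a" "h \<in> G" "d \<in> lk c" "verts (flat g a b) = verts (flat h c d)"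
  shows "{a, b} = {c, d}" "flat g a b = flat h c d"
proof -
  have V: "{a, b} \<subseteq> V" "{c, d} \<subseteq> V" using assms lkD by blast+
  have eq: "coset {a, b} g = coset {c, d} h" using assms by (simp add: verts_flat)
  then have hg: "h \<in> coset {a, b} g" using coset_self[OF assms(3)] by simp
  then have eh: "coset {a, b} h = coset {c, d} h" using coset_eq[OF V(1) assms(1)] eq by simp
  show l: "{a, b} = {c, d}"
    using coset_label_subset[OF assms(3) V] coset_label_subset[OF assms(3) V(2,1)] eh by auto
  have "flat g a b = flat h a b" using flat_eq[OF assms(1,2) hg] by simp
  moreover have "flat h a b = flat h c d"
    using l flat_swap[OF assms(3,4)] by (auto simp: doubleton_eq_iff)
  ultimately show "flat g a b = flat h c d" by simp
qed

lemma flats_determined: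
  assumes "F \<in> standard_flats \<Gamma>" "F' \<in> standard_flats \<Gamma>" "verts F = verts F'"
  shows "F = F'"
  using assms verts_flat_eq(2) by (metis standard_flatE)

lemma coset_in_flat_label:
  assumes "g \<in> G" "b \<in> lk a" "h \<in> G" "c \<in> V" "coset {c} h \<subseteq> coset {a, b} g"
  shows "c \<in> {a, b}" "flat g a b = flat h a b"
proof -
  have V: "{a, b} \<subseteq> V" using assms lkD by blast
  have h: "h \<in> coset {a, b} g" using assms(5) coset_self[OF assms(3)] by blast
  then show "flat g a b = flat h a b" using flat_eq[OF assms(1,2) h] by simp
  have "coset {c} h \<subseteq> coset {a, b} h" using coset_eq[OF V assms(1) h] assms(5) by simp
  then show "c \<in> {a, b}" using coset_label_subset[OF assms(3) _ V, of "{c}"] assms(4) by simp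
qed

lemma line_in_flat: "g \<in> G \<Longrightarrow> b \<in> lk a \<Longrightarrow> line g a \<subseteq> flat g a b"
  using line_pt_flat_pt by (auto simp: line_def flat_def)

text \<open>Containment can be tested on vertices, so a bijection of vertices suffices to transport
  the squares of the flat space.\<close>

lemma geodesic_in_flat_iff:
  assumes "\<gamma> \<in> standard_geodesics \<Gamma>" "F \<in> standard_flats \<Gamma>"
  shows "\<gamma> \<subseteq> F \<longleftrightarrow> verts \<gamma> \<subseteq> verts F"
proof
  obtain h c where h: "h \<in> G" "c \<in> V" "\<gamma> = line h c" using assms(1) by (rule standard_geodesicE)
  obtain g a b where g: "g \<in> G" "b \<in> lk a" "F = flat g a b" using assms(2) by (rule standard_flatE)
  assume "verts \<gamma> \<subseteq> verts F"
  then have "coset {c} h \<subseteq> coset {a, b} g" using g h by (simp add: verts_flat verts_line)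
  from coset_in_flat_label[OF g(1,2) h(1,2) this]
  have "c = a \<or> c = b" "F = flat h a b" using g by auto
  then show "\<gamma> \<subseteq> F"
    using line_in_flat[OF h(1), of b a] line_in_flat[OF h(1), of a b] flat_swap[OF h(1) g(2)] g(2) lk_sym h(3)
    by auto
qed (auto simp: verts_def)

lemma geodesics_determined:
  assumes "\<gamma> \<in> standard_geodesics \<Gamma>" "\<gamma>' \<in> standard_geodesics \<Gamma>" "verts \<gamma> = verts \<gamma>'"
  shows "\<gamma> = \<gamma>'"
proof -
  obtain g a where g: "g \<in> G" "a \<in> V" "\<gamma> = line g a" using assms(1) by (rule standard_geodesicE)
  obtain h c where h: "h \<in> G" "c \<in> V" "\<gamma>' = line h c" using assms(2) by (rule standard_geodesicE)
  have eq: "coset {a} g = coset {c} h" using assms g h by (simp add: verts_line)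
  then have hg: "h \<in> coset {a} g" using coset_self[OF h(1)] by simp
  then have "coset {a} h = coset {c} h" using coset_eq[of "{a}" g h] eq g by simp
  then have "a = c" using coset_label_subset[OF h(1), of "{a}" "{c}"] g h by simp
  moreover obtain b where "b \<in> lk a" using two_neighbours[OF g(2)] by metis
  ultimately show ?thesis using line_eq[OF g(1) _ hg] g h by simp
qed

text \<open>If the flat lies in the parallel set of \<open>u\<close>, both directions lie in the
  star of the label of \<open>u\<close>; without triangles this label must be one of them.\<close>

lemma inc_flat:
  assumes "g \<in> G" "b \<in> lk a" "u \<in> ext_verts"
  shows "inc u (flat g a b) \<longleftrightarrow> u = par_class g a \<or> u = par_class g b"
proof
  have V: "a \<in> V" "b \<in> V" "a \<in> lk b" "{a, b} \<subseteq> V" using assms lkD lk_sym by blast+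
  assume "inc u (flat g a b)"
  then have sub: "coset {a, b} g \<subseteq> snd u" using assms by (simp add: inc_def verts_flat)
  then have "g \<in> snd u" using assms by auto
  then have u: "fst u \<in> V" "u = par_class g (fst u)" using ext_verts_at assms by blast+
  then have "coset {a, b} g \<subseteq> coset (st (fst u)) g" using sub by (metis par_class_simps(2))
  then have "{a, b} \<subseteq> st (fst u)"
    using coset_label_subset[OF assms(1) V(4) st_subset[OF u(1)]] by blast
  then have "fst u = a \<or> fst u = b"
    using no_triangle[of a "fst u" b] assms(2) V lk_sym by (auto simp: st_def)
  then show "u = par_class g a \<or> u = par_class g b" using u by metis
next
  have "coset {a, b} g \<subseteq> coset (st a) g" "coset {a, b} g \<subseteq> coset (st b) g"
    by (rule coset_mono; use assms lk_sym in \<open>auto simp: st_def\<close>)+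
  then show "u = par_class g a \<or> u = par_class g b \<Longrightarrow> inc u (flat g a b)"
    using assms by (auto simp: inc_def verts_flat)
qed

lemma flat_at:
  assumes "F \<in> standard_flats \<Gamma>" "u \<in> ext_verts" "inc u F"
  obtains g b where "g \<in> G" "b \<in> lk (fst u)" "F = flat g (fst u) b" "u = par_class g (fst u)"
proof -
  obtain g a b where g: "g \<in> G" "b \<in> lk a" "F = flat g a b" using assms(1) by (rule standard_flatE)
  then have "u = par_class g a \<or> u = par_class g b" using inc_flat assms by simp
  then show thesis
    using that[of g b] that[of g a] g flat_swap[OF g(1,2)] lk_sym by auto
qed

lemma verts_flat_ends:
  assumes "F \<in> standard_flats \<Gamma>" "u \<in> ext_verts" "w \<in> ext_verts" "u \<noteq> w" "inc u F" "inc w F"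
  shows "verts F = snd u \<inter> snd w"
proof -
  obtain g a b where g: "g \<in> G" "b \<in> lk a" "F = flat g a b" using assms(1) by (rule standard_flatE)
  then have "u = par_class g a \<and> w = par_class g b \<or> u = par_class g b \<and> w = par_class g a" using inc_flat assms by metis
  then show ?thesis using coset_edge[OF g(1,2)] g verts_flat by auto
qed

lemma ext_adj_iff_flat:
  assumes "u \<in> ext_verts" "w \<in> ext_verts"
  shows "ext_adj u w \<longleftrightarrow> u \<noteq> w \<and> (\<exists>F \<in> standard_flats \<Gamma>. inc u F \<and> inc w F)"
proof
  assume e: "ext_adj u w"
  then obtain g a b where g: "g \<in> G" "b \<in> lk a" "u = par_class g a" "w = par_class g b" by (auto simp: ext_adj_def)
  then have "flat g a b \<in> standard_flats \<Gamma>" "inc u (flat g a b)" "inc w (flat g a b)"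
    using inc_flat[OF g(1,2)] assms by (auto simp: standard_flats_eq)
  moreover have "u \<noteq> w" using ext_adj_fst[OF e] lkD(3) by blast
  ultimately show "u \<noteq> w \<and> (\<exists>F \<in> standard_flats \<Gamma>. inc u F \<and> inc w F)" by blast
next
  assume "u \<noteq> w \<and> (\<exists>F \<in> standard_flats \<Gamma>. inc u F \<and> inc w F)"
  then obtain F where F: "u \<noteq> w" "F \<in> standard_flats \<Gamma>" "inc u F" "inc w F" by blast
  obtain g a b where g: "g \<in> G" "b \<in> lk a" "F = flat g a b" using F(2) by (rule standard_flatE)
  then have "u = par_class g a \<and> w = par_class g b \<or> u = par_class g b \<and> w = par_class g a" using inc_flat assms F by metis
  then show "ext_adj u w" using ext_adj_cl[OF g(1,2)] ext_adj_sym by blast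
qed

text \<open>Two classes determine the vertices of a flat incident to both, hence the flat; the
  degree bound is the bound on valences.\<close>

sublocale incidence ext_verts "standard_flats \<Gamma>" inc
proof
  fix e e' u w
  assume "e \<in> standard_flats \<Gamma>" "e' \<in> standard_flats \<Gamma>" "u \<in> ext_verts" "w \<in> ext_verts" "u \<noteq> w"
    "inc u e" "inc w e" "inc u e'" "inc w e'"
  then show "e = e'" using flats_determined verts_flat_ends by metis
next
  fix u assume u: "u \<in> ext_verts"
  then obtain g a where g: "g \<in> G" "a \<in> V" "u = par_class g a" by (auto simp: ext_verts_def)
  obtain b c where b: "b \<in> lk a" "c \<in> lk a" "b \<noteq> c" using two_neighbours[OF g(2)] by metis
  have "flat g a b \<noteq> flat g a c"
  proof
    assume "flat g a b = flat g a c"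
    then have "{a, b} = {a, c}" using verts_flat_eq(1)[OF g(1) b(1) g(1) b(2)] by simp
    then show False using b by (auto simp: doubleton_eq_iff)
  qed
  moreover have "flat g a b \<in> standard_flats \<Gamma>" "flat g a c \<in> standard_flats \<Gamma>"
    using g b by (auto simp: standard_flats_eq)
  moreover have "inc u (flat g a b)" "inc u (flat g a c)"
    using inc_flat[OF g(1) b(1) u] inc_flat[OF g(1) b(2) u] g by auto
  ultimately show "\<exists>e \<in> standard_flats \<Gamma>. \<exists>e' \<in> standard_flats \<Gamma>. e \<noteq> e' \<and> inc u e \<and> inc u e'"
    by blast
next
  fix u v w e1 e2 e3
  assume "u \<in> ext_verts" "v \<in> ext_verts" "w \<in> ext_verts" "u \<noteq> v" "v \<noteq> w" "w \<noteq> u"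
    "e1 \<in> standard_flats \<Gamma>" "e2 \<in> standard_flats \<Gamma>" "e3 \<in> standard_flats \<Gamma>"
    "inc u e1" "inc v e1" "inc v e2" "inc w e2" "inc w e3" "inc u e3"
  then have "ext_adj u v" "ext_adj v w" "ext_adj w u" using ext_adj_iff_flat by blast+
  then show False by (rule ext_adj_no_triangle)
qed

section \<open>Coarse intersections of flats\<close>

text \<open>The hyperplanes dual to the edges in a parallel class of standard geodesics are linearly
  ordered, and \<open>slab v\<close> counts how many of them lie below a vertex.\<close>

definition slab :: "'v \<times> 'v kvertex set \<Rightarrow> 'v kvertex \<Rightarrow> int" where
  "slab v = pot (\<lambda>k. of_bool (fst k = fst v \<and> snd k \<subseteq> snd v))"

lemma hyp_in_class_iff:
  assumes "v \<in> ext_verts" "q \<in> G" "i \<in> V"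
  shows "fst (hyp q (i, d)) = fst v \<and> snd (hyp q (i, d)) \<subseteq> snd v \<longleftrightarrow> i = fst v \<and> q \<in> snd v"
proof -
  define q' where "q' = (if d then q else act q [(i, False)])"
  have q': "q' \<in> G" "q' \<in> coset (st i) q"
    using assms coset_act[of "[(i, False)]" "st i" q] by (auto simp: q'_def st_def)
  have V: "st i \<subseteq> V" "lk i \<subseteq> st i" using assms st_subset by (auto simp: st_def)
  have qq': "q \<in> coset (st i) q'" using coset_sym[OF V(1) assms(2) q'(2)] .
  have snd: "snd (hyp q (i, d)) = coset (lk i) q'" by (simp add: hyp.simps q'_def)
  show ?thesis
  proof
    assume a: "fst (hyp q (i, d)) = fst v \<and> snd (hyp q (i, d)) \<subseteq> snd v"
    then have "i = fst v" "q' \<in> snd v" using coset_self[OF q'(1), of "lk i"] snd by auto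
    then have "v = par_class q' i" using ext_verts_at(3)[OF assms(1)] by blast
    then show "i = fst v \<and> q \<in> snd v" using qq' by simp
  next
    assume a: "i = fst v \<and> q \<in> snd v"
    then have v: "v = par_class q i" using ext_verts_at(3)[OF assms(1)] by blast
    have "coset (lk i) q' \<subseteq> coset (st i) q'" using coset_mono[OF V(2)] .
    also have "\<dots> = coset (st i) q" using coset_eq[OF V(1) assms(2) q'(2)] .
    also have "\<dots> = snd v" using v by (metis par_class_simps(2))
    finally show "fst (hyp q (i, d)) = fst v \<and> snd (hyp q (i, d)) \<subseteq> snd v"
      using conjunct1[OF a] snd by simp
  qed
qed

lemma slab_step:
  assumes "v \<in> ext_verts" "q \<in> G" "i \<in> V"
  shows "slab v (act q [(i, True)]) = slab v q + of_bool (i = fst v \<and> q \<in> snd v)"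
  using pot_step[OF assms(2), of "(i, True)"] assms(3) hyp_in_class_iff[OF assms, of True]
  by (simp add: slab_def)

lemma slab_lipschitz:
  assumes "v \<in> ext_verts" "q \<in> G" "i \<in> V"
  shows "\<bar>real_of_int (slab v (act q [(i, True)])) - real_of_int (slab v q)\<bar> \<le> 1"
  using slab_step[OF assms] by simp

text \<open>An edge of the flat that changes the count would have the label of \<open>v\<close> and
  lie in its parallel set, so \<open>v\<close> would be one of the two directions of the
  flat.\<close>

lemma slab_const_on_flat:
  assumes "v \<in> ext_verts" "g \<in> G" "b \<in> lk a" "\<not> inc v (flat g a b)" "q \<in> coset {a, b} g"
  shows "slab v q = slab v g"
proof -
  have V: "a \<in> V" "b \<in> V" "{a, b} \<subseteq> V" using assms lkD by blast+
  obtain u where u: "u \<in> words {a, b}" "q = act g u" using assms(5) by (rule cosetE)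
  have "\<not> (i = fst v \<and> h \<in> snd v)" if h: "h \<in> coset {a, b} g" "i \<in> {a, b}" for h i
  proof
    assume "i = fst v \<and> h \<in> snd v"
    then have "v = par_class h i" using ext_verts_at(3)[OF assms(1)] by blast
    moreover have "flat h a b = flat g a b" using flat_eq[OF assms(2,3) h(1)] .
    moreover have "h \<in> G" using coset_subset[OF V(3) assms(2)] h by blast
    ultimately show False using inc_flat[of h b a v] assms h(2) by auto
  qed
  then have "of_bool (fst (hyp h (i, d)) = fst v \<and> snd (hyp h (i, d)) \<subseteq> snd v) = (0 :: int)"
    if "h \<in> coset {a, b} g" "i \<in> {a, b}" for h i d
    using that hyp_in_class_iff[OF assms(1), of h i d] coset_subset[OF V(3) assms(2)] V by auto
  then show ?thesis
    unfolding slab_def u(2) by (intro pot_const[OF assms(2) u(1) V(3)]) blast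
qed

text \<open>On a flat incident to the class, \<open>slab\<close> is a coordinate up to a constant,
  whereas on all other flats it is constant. This contrast drives both directions of the coarse
  criterion.\<close>

lemma slab_coordinate:
  assumes "g \<in> G" "b \<in> lk a"
  shows "slab (par_class g b) (grid g a b m n) = slab (par_class g b) g + n"
proof -
  have V: "a \<in> V" "b \<in> V" "a \<noteq> b" "a \<in> lk b" using assms lkD lk_sym by blast+
  have v: "par_class g b \<in> ext_verts" using assms V by simp
  have m: "slab (par_class g b) (grid g a b (i + 1) j) = slab (par_class g b) (grid g a b i j)" for i j
    using slab_step[OF v grid_in[OF assms, of i j] V(1)] V(3) grid_succ(1)[OF assms, of i j] by simp
  have "grid g a b i j \<in> coset (st b) g" for i j
    using coset_edge_iff[OF assms] coset_mono[of "{a, b}" "st b" g] V by (auto simp: st_def)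
  then have n: "slab (par_class g b) (grid g a b i (j + 1)) = slab (par_class g b) (grid g a b i j) + 1" for i j
    using slab_step[OF v grid_in[OF assms, of i j] V(2)] grid_succ(2)[OF assms, of i j] by simp
  have "slab (par_class g b) (grid g a b m 0) = slab (par_class g b) g"
  proof (induction m rule: int_induct[where k = 0])
    case base
    then show ?case using assms V by simp
  next
    case (step1 i)
    then show ?case using m[of i 0] by simp
  next
    case (step2 i)
    then show ?case using m[of "i - 1" 0] by simp
  qed
  moreover have "slab (par_class g b) (grid g a b m n) = slab (par_class g b) (grid g a b m 0) + n"
  proof (induction n rule: int_induct[where k = 0])
    case (step1 i)
    then show ?case using n[of m i] by simp
  next
    case (step2 i)
    then show ?case using n[of m "i - 1"] by simp
  qed simp
  ultimately show ?thesis by simp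
qed

lemma affine_ext_slab:
  fixes s t :: real
  assumes "g \<in> G" "b \<in> lk a"
  shows "affine_ext (\<lambda>q. real_of_int (slab (par_class g b) q)) (flat_pt g a b (s, t)) = slab (par_class g b) g + t"
proof -
  let ?p = "grid g a b \<lfloor>s\<rfloor> \<lfloor>t\<rfloor>"
  have "act ?p [(a, True)] = grid g a b (\<lfloor>s\<rfloor> + 1) \<lfloor>t\<rfloor>" "act ?p [(b, True)] = grid g a b \<lfloor>s\<rfloor> (\<lfloor>t\<rfloor> + 1)"
    "act (act ?p [(a, True)]) [(b, True)] = grid g a b (\<lfloor>s\<rfloor> + 1) (\<lfloor>t\<rfloor> + 1)"
    by (simp_all only: grid_succ[OF assms])
  then show ?thesis
    by (simp add: flat_pt_def lifted_square_act affine_ext_square slab_coordinate[OF assms])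
      (simp add: frac_def algebra_simps)
qed

section \<open>Distance estimates between flats and geodesics\<close>

lemma flat_in_K: "g \<in> G \<Longrightarrow> b \<in> lk a \<Longrightarrow> flat g a b \<subseteq> realization K"
  using flat_pt_in_K by (auto simp: flat_def)

lemma line_in_K:
  assumes "g \<in> G" "a \<in> V"
  shows "line g a \<subseteq> realization K"
proof -
  obtain b where "b \<in> lk a" using two_neighbours[OF assms(2)] by metis
  then show ?thesis using line_in_flat flat_in_K assms(1) by blast
qed

lemma nbhd_in_K: "nbhd K r S \<subseteq> realization K"
  by (auto simp: nbhd_def)

lemma subset_nbhd:
  assumes "S \<subseteq> realization K" "0 < r"
  shows "S \<subseteq> nbhd K r S"
  using nbhd_iff[OF assms(1)] polygonal.const assms by blast

text \<open>The geodesic is the line through \<open>g\<close> in the common direction. A word in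
  \<open>lk a\<close> translates it into the second flat at bounded distance. Conversely, a point
  near both flats has a bounded second coordinate on the first one, as \<open>slab\<close> measures
  this coordinate there and is constant on the second.\<close>

lemma parallel_flats_intersect_coarsely:
  assumes "g \<in> G" "b \<in> lk a" "h \<in> G" "d \<in> lk a" "par_class g a = par_class h a" "flat g a b \<noteq> flat h a d"
  shows "intersect_coarsely_in_geodesic \<Gamma> (flat g a b) (flat h a d)"
proof -
  have V: "a \<in> V" "b \<in> V" "d \<in> V" using assms lkD by blast+
  define F1 F2 \<gamma> where "F1 = flat g a b" and "F2 = flat h a d" and "\<gamma> = line g a"
  have FK: "F1 \<subseteq> realization K" "F2 \<subseteq> realization K" "\<gamma> \<subseteq> realization K"
    using flat_in_K line_in_K assms V by (auto simp: F1_def F2_def \<gamma>_def)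
  have "h \<in> coset (st a) g"
    using assms(5) coset_self[OF assms(3), of "st a"] by (simp add: par_class_def)
  then obtain u where "u \<in> words (st a)" "h = act g u" by (rule cosetE)
  then obtain u1 u2 where u: "u1 \<in> words {a}" "u2 \<in> words (lk a)" "h = act (act g u1) u2"
    using act_st_decompose[OF assms(1) _ V(1)] by metis
  obtain k where k: "act g u1 = vpow g a k"
    using coset_vertex_iff[OF assms(1) V(1)] coset_act[OF u(1)] by blast
  have u2V: "u2 \<in> words V" using u(2) words_mono[OF lk_subset] by blast
  \<comment> \<open>Less than one unit leads to a vertex of the line, and \<open>length u2\<close>
    more to the second flat.\<close>
  define r where "r = real (length u2) + 2"
  have near: "\<exists>z \<in> F2. \<exists>l < r. polygonal K (line_pt g a s) z l" for s
  proof -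
    let ?n = "\<lfloor>s\<rfloor>"
    have "polygonal K (flat_pt g a b (s, 0)) (flat_pt g a b (of_int ?n, 0)) (dist (s, 0 :: real) (of_int ?n, 0))"
      by (rule flat_pt_polygonal[OF assms(1,2)])
    then have 1: "polygonal K (line_pt g a s) (vertex_pt (vpow g a ?n)) (frac s)"
      using flat_pt_lattice[OF assms(1,2), of ?n 0] assms(1) V
      by (simp add: line_pt_flat_pt[OF assms(1,2)] dist_prod_def dist_real_def frac_def)
    have "vpow h a (?n - k) = act (vpow (vpow g a k) a (?n - k)) u2"
      using vpow_act_commute[OF _ u(2) V(1), of "vpow g a k" "?n - k"] u(3) k assms(1) V by simp
    then have e: "vpow h a (?n - k) = act (vpow g a ?n) u2" using vpow_add[OF assms(1) V(1)] by simp
    have 2: "polygonal K (vertex_pt (vpow g a ?n)) (vertex_pt (vpow h a (?n - k))) (length u2)"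
      unfolding e using polygonal_act u2V assms(1) V by simp
    have "vertex_pt (vpow h a (?n - k)) \<in> F2"
      using vertex_in_flat[OF assms(3,4)] coset_vertex_iff[OF assms(3) V(1)] coset_mono[of "{a}" "{a, d}" h]
      by (auto simp: F2_def)
    moreover have "frac s + length u2 < r" using frac_lt_1[of s] by (simp add: r_def)
    ultimately show ?thesis using polygonal_trans[OF 2 1] by blast
  qed
  define v where "v = par_class g b"
  have v: "v \<in> ext_verts" using assms V by (simp add: v_def)
  \<comment> \<open>The flats already share the class of direction \<open>a\<close>; a second common
    class would make them equal.\<close>
  have "\<not> inc v F2"
  proof
    assume "inc v F2"
    then have "v = par_class h a \<or> v = par_class h d" using inc_flat[OF assms(3,4) v] by (simp add: F2_def)
    moreover have "v \<noteq> par_class h a" using lkD(3)[OF assms(2)] by (auto simp: v_def par_class_def)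
    ultimately have "v = par_class h d" by blast
    moreover have "par_class g a \<in> ext_verts" using assms V by simp
    ultimately have "inc v F1" "inc v F2" "inc (par_class g a) F1" "inc (par_class g a) F2"
      using inc_flat[OF assms(1,2)] inc_flat[OF assms(3,4)] v assms(5) by (auto simp: F1_def F2_def v_def)
    moreover have "v \<noteq> par_class g a" using lkD(3)[OF assms(2)] by (auto simp: v_def par_class_def)
    moreover have "F1 \<in> standard_flats \<Gamma>" "F2 \<in> standard_flats \<Gamma>"
      using assms by (auto simp: F1_def F2_def standard_flats_eq)
    ultimately have "F1 = F2" using simple[of F1 F2 v "par_class g a"] v \<open>par_class g a \<in> ext_verts\<close> by blast
    then show False using assms(6) by (simp add: F1_def F2_def)
  qed
  let ?\<sigma> = "\<lambda>q. real_of_int (slab v q)"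
  have F2c: "affine_ext ?\<sigma> z = slab v h" if z: "z \<in> F2" for z
  proof -
    obtain w where "z = flat_pt h a d w" using z by (auto simp: F2_def flat_def)
    then show ?thesis
      using affine_ext_on_flat[OF assms(3,4), of ?\<sigma> "slab v h" w] slab_const_on_flat[OF v assms(3,4)]
        \<open>\<not> inc v F2\<close> by (simp add: F2_def)
  qed
  \<comment> \<open>Less than \<open>r\<close> from \<open>x\<close> to the first flat, plus
    \<open>\<bar>t\<bar>\<close>, which is less than \<open>4 * r\<close> plus the difference of the
    two slab values, since \<open>slab\<close> is 2-Lipschitz and the flats are joined by a path
    shorter than \<open>2 * r\<close>.\<close>
  define R where "R = 5 * r + \<bar>real_of_int (slab v g) - slab v h\<bar>"
  have r0: "0 < r" "0 < R" by (auto simp: r_def R_def intro!: add_pos_nonneg)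
  have "nbhd K r F1 \<inter> nbhd K r F2 \<subseteq> nbhd K R \<gamma>"
  proof
    fix x assume "x \<in> nbhd K r F1 \<inter> nbhd K r F2"
    then obtain y z l m where y: "y \<in> F1" "l < r" "polygonal K x y l"
      and z: "z \<in> F2" "m < r" "polygonal K x z m"
      using nbhd_iff FK by auto
    obtain s t where st: "y = flat_pt g a b (s, t)" using y(1) by (auto simp: F1_def flat_def)
    have "polygonal K y z (l + m)" using polygonal_trans[OF z(3) polygonal_sym[OF y(3)]] .
    then have "\<bar>affine_ext ?\<sigma> y - affine_ext ?\<sigma> z\<bar> \<le> 2 * (l + m)"
      by (rule affine_ext_lipschitz) (rule slab_lipschitz[OF v])
    then have "\<bar>slab v g + t - slab v h\<bar> \<le> 2 * (l + m)"
      using F2c[OF z(1)] affine_ext_slab[OF assms(1,2), of s t] st by (simp add: v_def)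
    moreover have "\<bar>t\<bar> \<le> \<bar>slab v g + t - slab v h\<bar> + \<bar>real_of_int (slab v g) - slab v h\<bar>"
      using abs_triangle_ineq4[of "slab v g + t - slab v h" "real_of_int (slab v g) - slab v h"] by simp
    ultimately have "l + \<bar>t\<bar> < R" using y(2) z(2) by (simp add: R_def)
    moreover have "polygonal K y (line_pt g a s) \<bar>t\<bar>"
      using flat_pt_polygonal[OF assms(1,2), of "(s, t)" "(s, 0)"]
      by (simp add: st line_pt_flat_pt[OF assms(1,2)] dist_prod_def dist_real_def)
    then have "polygonal K x (line_pt g a s) (l + \<bar>t\<bar>)" using polygonal_trans y(3) by blast
    ultimately show "x \<in> nbhd K R \<gamma>"
      using nbhd_iff[OF FK(3)] by (auto simp: \<gamma>_def line_def)
  qed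
  moreover have "\<gamma> \<subseteq> nbhd K r F1 \<inter> nbhd K r F2"
  proof
    fix y assume y: "y \<in> \<gamma>"
    then obtain s where "y = line_pt g a s" by (auto simp: \<gamma>_def line_def)
    then have "y \<in> nbhd K r F2" using near nbhd_iff[OF FK(2)] by blast
    moreover have "y \<in> F1" using y line_in_flat[OF assms(1,2)] by (auto simp: \<gamma>_def F1_def)
    ultimately show "y \<in> nbhd K r F1 \<inter> nbhd K r F2" using subset_nbhd[OF FK(1) r0(1)] by blast
  qed
  moreover have "nbhd K r F1 \<inter> nbhd K r F2 \<subseteq> nbhd K R (nbhd K r F1 \<inter> nbhd K r F2)"
    by (rule subset_nbhd) (use nbhd_in_K r0 in auto)
  ultimately have "finite_Hausdorff_dist K (nbhd K r F1 \<inter> nbhd K r F2) \<gamma>"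
    unfolding finite_Hausdorff_dist_def by (intro exI[of _ R]) blast
  moreover have "\<gamma> \<in> standard_geodesics \<Gamma>"
    using assms(1) V by (auto simp: standard_geodesics_eq \<gamma>_def)
  ultimately show ?thesis
    unfolding intersect_coarsely_in_geodesic_def F1_def[symmetric] F2_def[symmetric]
    using r0(1) by blast
qed

text \<open>Along the line, \<open>slab\<close> of its own class grows with unit speed, but on a
  flat not incident to this class it is constant; then the line could not stay at bounded
  distance.\<close>

lemma geodesic_near_flat:
  assumes "k \<in> G" "c \<in> V" "F \<in> standard_flats \<Gamma>" "line k c \<subseteq> nbhd K R (nbhd K r F)"
  shows "inc (par_class k c) F"
proof (rule ccontr)
  assume n: "\<not> inc (par_class k c) F"
  obtain g a b where g: "g \<in> G" "b \<in> lk a" "F = flat g a b" using assms(3) by (rule standard_flatE)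
  obtain d where d: "d \<in> lk c" using two_neighbours[OF assms(2)] by metis
  then have d': "c \<in> lk d" using lk_sym by blast
  have FK: "F \<subseteq> realization K" using g flat_in_K by blast
  define v where "v = par_class k c"
  have v: "v \<in> ext_verts" using assms by (simp add: v_def)
  let ?\<sigma> = "\<lambda>q. real_of_int (slab v q)"
  have bound: "\<bar>slab v k + s - slab v g\<bar> \<le> 2 * (R + r)" for s :: real
  proof -
    have "line_pt k c s \<in> nbhd K R (nbhd K r F)" using assms(4) by (auto simp: line_def)
    then obtain y l where y: "y \<in> nbhd K r F" "l < R" "polygonal K (line_pt k c s) y l"
      using nbhd_iff[OF nbhd_in_K] by blast
    then obtain z m where z: "z \<in> F" "m < r" "polygonal K y z m" using nbhd_iff[OF FK] by blast
    have "polygonal K (line_pt k c s) z (l + m)" using polygonal_trans[OF z(3) y(3)] .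
    then have "\<bar>affine_ext ?\<sigma> (line_pt k c s) - affine_ext ?\<sigma> z\<bar> \<le> 2 * (l + m)"
      by (rule affine_ext_lipschitz) (rule slab_lipschitz[OF v])
    moreover have "affine_ext ?\<sigma> (line_pt k c s) = slab v k + s"
      using affine_ext_slab[OF assms(1) d', of 0 s] line_pt_flat_pt[OF assms(1) d] flat_pt_swap[OF assms(1) d]
      by (simp add: v_def)
    moreover have "affine_ext ?\<sigma> z = slab v g"
    proof -
      obtain w where "z = flat_pt g a b w" using z(1) g by (auto simp: flat_def)
      then show ?thesis
        using affine_ext_on_flat[OF g(1,2), of ?\<sigma> "slab v g" w] slab_const_on_flat[OF v g(1,2)] n g(3)
        by (simp add: v_def)
    qed
    ultimately have "\<bar>slab v k + s - slab v g\<bar> \<le> 2 * (l + m)" by simp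
    also have "\<dots> \<le> 2 * (R + r)" using y(2) z(2) by simp
    finally show ?thesis .
  qed
  \<comment> \<open>With this parameter the bounded quantity equals
    \<open>2 * (R + r) + 1\<close>.\<close>
  show False using abs_le_D1[OF bound[of "2 * (R + r) + 1 - slab v k + slab v g"]] by simp
qed

text \<open>The exponent of \<open>b\<close> is unbounded on the flat and constant on a line with
  another label.\<close>

lemma flat_not_near_geodesic:
  assumes "k \<in> G" "c \<in> V" "g \<in> G" "b \<in> lk a" "b \<noteq> c" "flat g a b \<subseteq> nbhd K R (line k c)"
  shows False
proof -
  let ?\<phi> = "\<lambda>q. real_of_int (class_exponent b q)"
  have bound: "\<bar>class_exponent b g + t - class_exponent b k\<bar> \<le> 2 * R" for t :: real
  proof -
    have "flat_pt g a b (0, t) \<in> nbhd K R (line k c)" using assms(6) by (auto simp: flat_def)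
    then obtain y l where y: "y \<in> line k c" "l < R" "polygonal K (flat_pt g a b (0, t)) y l"
      using nbhd_iff[OF line_in_K[OF assms(1,2)]] by blast
    have "\<bar>affine_ext ?\<phi> (flat_pt g a b (0, t)) - affine_ext ?\<phi> y\<bar> \<le> 2 * l"
      by (rule affine_ext_lipschitz[OF y(3)]) (simp add: class_exponent_act)
    moreover have "affine_ext ?\<phi> (flat_pt g a b (0, t)) = class_exponent b g + t"
      using point_exponent_flat_pt[OF assms(3,4), of b 0 t] lkD(3)[OF assms(4)] by (simp add: point_exponent_affine_ext)
    moreover have "affine_ext ?\<phi> y = class_exponent b k"
    proof -
      obtain s where "y = line_pt k c s" using y(1) by (auto simp: line_def)
      moreover have "class_exponent b q = class_exponent b k" if q: "q \<in> coset {c} k" for q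
        using q coset_vertex_iff[OF assms(1,2)] class_exponent_vpow[OF assms(1,2)] assms(5) by auto
      ultimately show ?thesis
        using affine_ext_on_line[OF assms(1,2), of ?\<phi> "class_exponent b k" s] by simp
    qed
    ultimately have "\<bar>class_exponent b g + t - class_exponent b k\<bar> \<le> 2 * l" by simp
    also have "\<dots> \<le> 2 * R" using y(2) by simp
    finally show ?thesis .
  qed
  show False
    using abs_le_D1[OF bound[of "2 * R + 1 - class_exponent b g + class_exponent b k"]] by simp
qed

text \<open>The geodesic stays near both flats, so its class is incident to both. Equal flats are
  excluded because a flat does not stay near a line.\<close>

lemma intersect_coarsely_iff:
  assumes "F1 \<in> standard_flats \<Gamma>" "F2 \<in> standard_flats \<Gamma>"
  shows "intersect_coarsely_in_geodesic \<Gamma> F1 F2 \<longleftrightarrow> F1 \<noteq> F2 \<and> (\<exists>u \<in> ext_verts. inc u F1 \<and> inc u F2)"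
proof
  have FK: "F1 \<subseteq> realization K" using assms(1) flat_in_K by (auto simp: standard_flats_eq)
  assume "intersect_coarsely_in_geodesic \<Gamma> F1 F2"
  then obtain r \<gamma> R where r: "0 < r" "\<gamma> \<in> standard_geodesics \<Gamma>"
    "nbhd K r F1 \<inter> nbhd K r F2 \<subseteq> nbhd K R \<gamma>" "\<gamma> \<subseteq> nbhd K R (nbhd K r F1 \<inter> nbhd K r F2)"
    unfolding intersect_coarsely_in_geodesic_def finite_Hausdorff_dist_def by blast
  obtain k c where k: "k \<in> G" "c \<in> V" "\<gamma> = line k c" using r(2) by (rule standard_geodesicE)
  have mono: "nbhd K R S \<subseteq> nbhd K R T" if "S \<subseteq> T" for S T using that by (auto simp: nbhd_def)
  have "line k c \<subseteq> nbhd K R (nbhd K r F1)" "line k c \<subseteq> nbhd K R (nbhd K r F2)"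
    using r(4) mono[of "nbhd K r F1 \<inter> nbhd K r F2" "nbhd K r F1"]
      mono[of "nbhd K r F1 \<inter> nbhd K r F2" "nbhd K r F2"] k(3) by blast+
  then have i: "inc (par_class k c) F1" "inc (par_class k c) F2" using geodesic_near_flat k assms by blast+
  have v: "par_class k c \<in> ext_verts" using k by simp
  have "F1 \<noteq> F2"
  proof
    assume "F1 = F2"
    then have "F1 \<subseteq> nbhd K R (line k c)" using r(3) subset_nbhd[OF FK r(1)] k by blast
    moreover obtain g b where "g \<in> G" "b \<in> lk (fst (par_class k c))" "F1 = flat g (fst (par_class k c)) b"
      using assms(1) v i(1) by (rule flat_at)
    then have g: "g \<in> G" "b \<in> lk c" "F1 = flat g c b" by simp_all
    moreover have "b \<noteq> c" using lkD(3)[OF g(2)] by blast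
    ultimately show False using flat_not_near_geodesic[OF k(1,2) g(1,2)] by blast
  qed
  then show "F1 \<noteq> F2 \<and> (\<exists>u \<in> ext_verts. inc u F1 \<and> inc u F2)" using i v by blast
next
  assume "F1 \<noteq> F2 \<and> (\<exists>u \<in> ext_verts. inc u F1 \<and> inc u F2)"
  then obtain u where u: "F1 \<noteq> F2" "u \<in> ext_verts" "inc u F1" "inc u F2" by blast
  obtain g b where g: "g \<in> G" "b \<in> lk (fst u)" "F1 = flat g (fst u) b" "u = par_class g (fst u)"
    using assms(1) u(2,3) by (rule flat_at)
  obtain h d where h: "h \<in> G" "d \<in> lk (fst u)" "F2 = flat h (fst u) d" "u = par_class h (fst u)"
    using assms(2) u(2,4) by (rule flat_at)
  show "intersect_coarsely_in_geodesic \<Gamma> F1 F2"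
    using parallel_flats_intersect_coarsely[OF g(1,2) h(1,2)] g h u(1) by metis
qed

end

section \<open>Isomorphisms of square complexes are isometries\<close>

text \<open>The map of realizations induced by a vertex map: weights are carried along \<Phi> and
  extended by 0.\<close>

definition push :: "('a \<Rightarrow> 'b) \<Rightarrow> 'a set \<Rightarrow> ('a \<Rightarrow> real) \<Rightarrow> 'b \<Rightarrow> real" where
  "push \<Phi> D x = (\<lambda>y. if y \<in> \<Phi> ` D then x (inv_into D \<Phi> y) else 0)"

text \<open>Purely combinatorial. The record type does not tie cells to vertices, so the axioms also
  demand that the corners of edges and squares are vertices.\<close>

locale complex_embedding =
  fixes X :: "'a square_complex" and Y :: "'b square_complex" and \<Phi> :: "'a \<Rightarrow> 'b"
  assumes inj: "inj_on \<Phi> (cverts X)"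
    and vert: "a \<in> cverts X \<Longrightarrow> \<Phi> a \<in> cverts Y"
    and edge: "(a, b) \<in> cedges X \<Longrightarrow> a \<in> cverts X \<and> b \<in> cverts X \<and> (\<Phi> a, \<Phi> b) \<in> cedges Y"
    and square: "(a, b, c, d) \<in> csquares X \<Longrightarrow>
      {a, b, c, d} \<subseteq> cverts X \<and> (\<Phi> a, \<Phi> b, \<Phi> c, \<Phi> d) \<in> csquares Y"
begin

abbreviation "P \<equiv> push \<Phi> (cverts X)"

lemma push_vertex: "a \<in> cverts X \<Longrightarrow> P (vertex_pt a) = vertex_pt (\<Phi> a)"
  using inj by (auto simp: push_def vertex_pt_def fun_eq_iff inj_on_eq_iff)

lemma push_edge:
  assumes "a \<in> cverts X" "b \<in> cverts X"
  shows "P (edge_pt (a, b) s) = edge_pt (\<Phi> a, \<Phi> b) s"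
  by (rule ext) (simp add: edge_pt.simps flip: push_vertex[OF assms(1)] push_vertex[OF assms(2)],
    simp add: push_def edge_pt.simps)

lemma push_square:
  assumes "a \<in> cverts X" "b \<in> cverts X" "c \<in> cverts X" "d \<in> cverts X"
  shows "P (square_pt (a, b, c, d) z) = square_pt (\<Phi> a, \<Phi> b, \<Phi> c, \<Phi> d) z"
proof (cases z)
  case (Pair s t)
  show ?thesis
    unfolding Pair
    by (rule ext) (simp add: square_pt.simps flip: push_vertex[OF assms(1)] push_vertex[OF assms(2)]
      push_vertex[OF assms(3)] push_vertex[OF assms(4)], simp add: push_def square_pt.simps)
qed

lemma push_edge_cell:
  assumes "e \<in> cedges X"
  obtains e' where "e' \<in> cedges Y" "\<And>s. P (edge_pt e s) = edge_pt e' s"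
proof -
  obtain a b where e: "e = (a, b)" by force
  then have "a \<in> cverts X" "b \<in> cverts X" "(\<Phi> a, \<Phi> b) \<in> cedges Y" using edge assms by auto
  then show thesis using that[of "(\<Phi> a, \<Phi> b)"] push_edge e by simp
qed

lemma push_square_cell:
  assumes "q \<in> csquares X"
  obtains q' where "q' \<in> csquares Y" "\<And>z. P (square_pt q z) = square_pt q' z"
proof -
  obtain a b c d where q: "q = (a, b, c, d)" by (cases q)
  then have "{a, b, c, d} \<subseteq> cverts X" "(\<Phi> a, \<Phi> b, \<Phi> c, \<Phi> d) \<in> csquares Y" using square assms by auto
  then show thesis using that[of "(\<Phi> a, \<Phi> b, \<Phi> c, \<Phi> d)"] push_square q by simp
qed

lemma push_realization:
  assumes "x \<in> realization X"
  shows "P x \<in> realization Y"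
  using assms
proof (cases rule: realization_cases)
  case (vertex a)
  then show ?thesis using push_vertex vert by (auto simp: realization_def)
next
  case (edge e s)
  obtain e' where "e' \<in> cedges Y" "P (edge_pt e s) = edge_pt e' s"
    using push_edge_cell[OF edge(1)] by metis
  then show ?thesis using edge edge_pt_in_realization by metis
next
  case (square q z)
  obtain q' where "q' \<in> csquares Y" "P (square_pt q z) = square_pt q' z"
    using push_square_cell[OF square(1)] by metis
  then show ?thesis using square square_pt_in_realization by metis
qed

lemma push_polygonal:
  assumes "polygonal X x y l"
  shows "polygonal Y (P x) (P y) l"
  using assms
proof (induction)
  case (const x)
  then show ?case by (intro polygonal.const push_realization)
next
  case (along_edge x e s l t)
  obtain e' where "e' \<in> cedges Y" "\<And>s. P (edge_pt e s) = edge_pt e' s"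
    using push_edge_cell[OF along_edge(2)] by metis
  then show ?case using polygonal.along_edge along_edge by metis
next
  case (along_square x q z l w)
  obtain q' where "q' \<in> csquares Y" "\<And>z. P (square_pt q z) = square_pt q' z"
    using push_square_cell[OF along_square(2)] by metis
  then show ?case using polygonal.along_square along_square by metis
qed

end

text \<open>Cells are mapped to cells with the same coordinates, so polygonal paths and their
  lengths are carried over in both directions and the two infima are over the same set.\<close>

lemma complex_isomorphism_isometry:
  assumes "complex_embedding X Y \<Phi>" "complex_embedding Y X \<Psi>"
    "\<And>a. a \<in> cverts X \<Longrightarrow> \<Psi> (\<Phi> a) = a" "\<And>b. b \<in> cverts Y \<Longrightarrow> \<Phi> (\<Psi> b) = b"
  shows "complex_isometry X Y (push \<Phi> (cverts X))"
proof -
  interpret I: complex_embedding X Y \<Phi> by fact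
  interpret J: complex_embedding Y X \<Psi> by fact
  have JI: "push \<Psi> (cverts Y) (push \<Phi> (cverts X) x) = x" if "x \<in> realization X" for x
    using that
  proof (cases rule: realization_cases)
    case (vertex a)
    then show ?thesis using I.push_vertex J.push_vertex I.vert assms(3) by simp
  next
    case (edge e s)
    obtain a b where e: "e = (a, b)" by force
    have "a \<in> cverts X" "b \<in> cverts X" using I.edge edge(1) e by auto
    then show ?thesis using I.push_edge J.push_edge I.vert assms(3) edge e by simp
  next
    case (square q z)
    obtain a b c d where q: "q = (a, b, c, d)" by (cases q)
    have "{a, b, c, d} \<subseteq> cverts X" using I.square square(1) q by blast
    then show ?thesis using I.push_square J.push_square I.vert assms(3) square q by simp
  qed
  have IJ: "push \<Phi> (cverts X) (push \<Psi> (cverts Y) x) = x" if "x \<in> realization Y" for x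
    using that
  proof (cases rule: realization_cases)
    case (vertex a)
    then show ?thesis using I.push_vertex J.push_vertex J.vert assms(4) by simp
  next
    case (edge e s)
    obtain a b where e: "e = (a, b)" by force
    have "a \<in> cverts Y" "b \<in> cverts Y" using J.edge edge(1) e by auto
    then show ?thesis using I.push_edge J.push_edge J.vert assms(4) edge e by simp
  next
    case (square q z)
    obtain a b c d where q: "q = (a, b, c, d)" by (cases q)
    have "{a, b, c, d} \<subseteq> cverts Y" using J.square square(1) q by blast
    then show ?thesis using I.push_square J.push_square J.vert assms(4) square q by simp
  qed
  have "bij_betw (push \<Phi> (cverts X)) (realization X) (realization Y)"
    by (rule bij_betw_byWitness[of _ "push \<Psi> (cverts Y)"])
      (use JI IJ I.push_realization J.push_realization in auto)
  moreover have "path_dist Y (push \<Phi> (cverts X) x) (push \<Phi> (cverts X) y) = path_dist X x y"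
    if "x \<in> realization X" "y \<in> realization X" for x y
  proof -
    have "polygonal Y (push \<Phi> (cverts X) x) (push \<Phi> (cverts X) y) l \<longleftrightarrow> polygonal X x y l" for l
      using I.push_polygonal[of x y l]
        J.push_polygonal[of "push \<Phi> (cverts X) x" "push \<Phi> (cverts X) y" l] JI that by auto
    then show ?thesis by (simp add: path_dist_def)
  qed
  ultimately show ?thesis by (simp add: complex_isometry_def)
qed

section \<open>Isomorphisms of flat spaces\<close>

lemma (in atomic_graph) verts_in_raag:
  assumes "S \<in> standard_flats \<Gamma> \<union> standard_geodesics \<Gamma>"
  shows "verts S \<subseteq> G"
  using assms
proof
  assume "S \<in> standard_flats \<Gamma>"
  then obtain g a b where "g \<in> G" "b \<in> lk a" "S = flat g a b" by (rule standard_flatE)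
  then show ?thesis using coset_subset[of "{a, b}" g] lkD[of b a] by (simp add: verts_flat)
next
  assume "S \<in> standard_geodesics \<Gamma>"
  then obtain g a where "g \<in> G" "a \<in> V" "S = line g a" by (rule standard_geodesicE)
  then show ?thesis using coset_subset[of "{a}" g] by (simp add: verts_line)
qed

primrec flat_space_map ::
    "('v kvertex \<Rightarrow> 'w kvertex) \<Rightarrow> ('v kpoint set \<Rightarrow> 'w kpoint set) \<Rightarrow> ('v kpoint set \<Rightarrow> 'w kpoint set)
      \<Rightarrow> 'v flat_space_vertex \<Rightarrow> 'w flat_space_vertex" where
  "flat_space_map \<phi> \<psi> f (Cone p) = Cone (\<phi> p)"
| "flat_space_map \<phi> \<psi> f (Singular \<gamma>) = Singular (\<psi> \<gamma>)"
| "flat_space_map \<phi> \<psi> f (Flat F) = Flat (f F)"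

text \<open>A square records incidences among a vertex, two geodesics and a flat. Each of them can
  be tested on \<open>verts\<close>, where all three maps act through \<phi>.\<close>

lemma flat_space_embedding:
  assumes "atomic \<Gamma>" "atomic \<Gamma>'"
    and \<phi>: "inj_on \<phi> (raag \<Gamma>)" "\<And>p. p \<in> raag \<Gamma> \<Longrightarrow> \<phi> p \<in> raag \<Gamma>'"
    and \<psi>: "inj_on \<psi> (standard_geodesics \<Gamma>)"
      "\<And>\<gamma>. \<gamma> \<in> standard_geodesics \<Gamma> \<Longrightarrow> \<psi> \<gamma> \<in> standard_geodesics \<Gamma>' \<and> verts (\<psi> \<gamma>) = \<phi> ` verts \<gamma>"
    and f: "inj_on f (standard_flats \<Gamma>)"
      "\<And>F. F \<in> standard_flats \<Gamma> \<Longrightarrow> f F \<in> standard_flats \<Gamma>' \<and> verts (f F) = \<phi> ` verts F"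
  shows "complex_embedding (flat_space \<Gamma>) (flat_space \<Gamma>') (flat_space_map \<phi> \<psi> f)"
proof -
  interpret A: atomic_graph \<Gamma> by unfold_locales fact
  interpret B: atomic_graph \<Gamma>' by unfold_locales fact
  let ?\<Phi> = "flat_space_map \<phi> \<psi> f"
  have sq: "\<exists>p \<gamma>1 F \<gamma>2. (a, b, c, d) = (Cone p, Singular \<gamma>1, Flat F, Singular \<gamma>2) \<and>
      {a, b, c, d} \<subseteq> cverts (flat_space \<Gamma>) \<and> (?\<Phi> a, ?\<Phi> b, ?\<Phi> c, ?\<Phi> d) \<in> flat_space_squares \<Gamma>'"
    if abcd: "(a, b, c, d) \<in> flat_space_squares \<Gamma>" for a b c d
  proof -
    obtain p \<gamma>1 F \<gamma>2 where "(a, b, c, d) = (Cone p, Singular \<gamma>1, Flat F, Singular \<gamma>2) \<and>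
      p \<in> raag \<Gamma> \<and> F \<in> standard_flats \<Gamma> \<and> vertex_pt p \<in> F \<and> \<gamma>1 \<noteq> \<gamma>2 \<and>
      (\<forall>\<gamma> \<in> {\<gamma>1, \<gamma>2}. \<gamma> \<in> standard_geodesics \<Gamma> \<and> \<gamma> \<subseteq> F \<and> vertex_pt p \<in> \<gamma>)"
      using abcd unfolding flat_space_squares_def mem_Collect_eq by (elim exE) (rule that)
    then have s: "a = Cone p" "b = Singular \<gamma>1" "c = Flat F" "d = Singular \<gamma>2"
      "p \<in> raag \<Gamma>" "F \<in> standard_flats \<Gamma>" "vertex_pt p \<in> F" "\<gamma>1 \<noteq> \<gamma>2"
      "\<gamma>1 \<in> standard_geodesics \<Gamma>" "\<gamma>1 \<subseteq> F" "vertex_pt p \<in> \<gamma>1"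
      "\<gamma>2 \<in> standard_geodesics \<Gamma>" "\<gamma>2 \<subseteq> F" "vertex_pt p \<in> \<gamma>2"
      by simp_all
    have pv: "vertex_pt (\<phi> p) \<in> T" if "verts T = \<phi> ` verts S" "vertex_pt p \<in> S" for S T
    proof -
      have "\<phi> p \<in> verts T" unfolding that(1) using that(2) by (simp add: verts_def)
      then show ?thesis by (simp add: verts_def)
    qed
    note vp = pv[OF conjunct2[OF f(2)[OF s(6)]] s(7)] pv[OF conjunct2[OF \<psi>(2)[OF s(9)]] s(11)]
      pv[OF conjunct2[OF \<psi>(2)[OF s(12)]] s(14)]
    have sub: "\<psi> \<gamma> \<subseteq> f F" if "\<gamma> \<in> standard_geodesics \<Gamma>" "\<gamma> \<subseteq> F" for \<gamma>
    proof -
      have "verts \<gamma> \<subseteq> verts F" using A.geodesic_in_flat_iff[OF that(1) s(6)] that(2) by simp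
      then have "verts (\<psi> \<gamma>) \<subseteq> verts (f F)"
        unfolding conjunct2[OF \<psi>(2)[OF that(1)]] conjunct2[OF f(2)[OF s(6)]] by (rule image_mono)
      then show ?thesis
        using B.geodesic_in_flat_iff[OF conjunct1[OF \<psi>(2)[OF that(1)]] conjunct1[OF f(2)[OF s(6)]]] by simp
    qed
    have ne: "\<psi> \<gamma>1 \<noteq> \<psi> \<gamma>2" using \<psi>(1) s by (auto simp: inj_on_def)
    have "(?\<Phi> a, ?\<Phi> b, ?\<Phi> c, ?\<Phi> d) \<in> flat_space_squares \<Gamma>'"
      unfolding flat_space_squares_def
      using s vp sub[OF s(9,10)] sub[OF s(12,13)] ne \<phi>(2)[OF s(5)] f(2)[OF s(6)] \<psi>(2)[OF s(9)] \<psi>(2)[OF s(12)]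
      by simp
    moreover have "{a, b, c, d} \<subseteq> cverts (flat_space \<Gamma>)" using s by (auto simp: flat_space_def)
    ultimately show ?thesis using s by blast
  qed
  show ?thesis
  proof
    show "inj_on ?\<Phi> (cverts (flat_space \<Gamma>))"
    proof (rule inj_onI)
      fix x y assume "x \<in> cverts (flat_space \<Gamma>)" "y \<in> cverts (flat_space \<Gamma>)" "?\<Phi> x = ?\<Phi> y"
      then show "x = y"
        by (cases x; cases y)
          (auto simp: flat_space_def inj_on_eq_iff[OF \<phi>(1)] inj_on_eq_iff[OF \<psi>(1)] inj_on_eq_iff[OF f(1)])
    qed
    show "?\<Phi> a \<in> cverts (flat_space \<Gamma>')" if "a \<in> cverts (flat_space \<Gamma>)" for a
      using that \<phi>(2) \<psi>(2) f(2) by (auto simp: flat_space_def)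
    show "{a, b, c, d} \<subseteq> cverts (flat_space \<Gamma>) \<and> (?\<Phi> a, ?\<Phi> b, ?\<Phi> c, ?\<Phi> d) \<in> csquares (flat_space \<Gamma>')"
      if "(a, b, c, d) \<in> csquares (flat_space \<Gamma>)" for a b c d
      using sq[of a b c d] that by (auto simp: flat_space_def)
    show "a \<in> cverts (flat_space \<Gamma>) \<and> b \<in> cverts (flat_space \<Gamma>) \<and> (?\<Phi> a, ?\<Phi> b) \<in> cedges (flat_space \<Gamma>')"
      if "(a, b) \<in> cedges (flat_space \<Gamma>)" for a b
    proof -
      obtain p x F y where e: "(p, x, F, y) \<in> flat_space_squares \<Gamma>"
        "(a, b) \<in> {(p, x), (x, F), (F, y), (y, p)}"
        using \<open>(a, b) \<in> cedges (flat_space \<Gamma>)\<close> by (auto simp: flat_space_def)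
      have s: "{p, x, F, y} \<subseteq> cverts (flat_space \<Gamma>)" "(?\<Phi> p, ?\<Phi> x, ?\<Phi> F, ?\<Phi> y) \<in> flat_space_squares \<Gamma>'"
        using sq[OF e(1)] by blast+
      have "(?\<Phi> a, ?\<Phi> b) \<in> {(?\<Phi> p, ?\<Phi> x), (?\<Phi> x, ?\<Phi> F), (?\<Phi> F, ?\<Phi> y), (?\<Phi> y, ?\<Phi> p)}" using e(2) by auto
      then have "(?\<Phi> a, ?\<Phi> b) \<in> cedges (flat_space \<Gamma>')"
        unfolding flat_space_def square_complex.select_convs by (intro UN_I[OF s(2)]) simp
      then show ?thesis using s(1) e(2) by auto
    qed
  qed
qed

text \<open>The classes through \<open>p\<close> adjacent to \<open>u\<close> correspond to the
  neighbours of the label \<open>a\<close>. As \<open>F\<close> matches them with the neighbours of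
  \<open>F u\<close> through \<open>\<phi> p\<close>, the intersections in
  \<open>coset_vertex\<close> correspond.\<close>

lemma (in extension_graph_iso) line_image:
  assumes \<phi>: "bij_betw \<phi> A.G B.G"
    and iff: "\<And>u q. u \<in> A.ext_verts \<Longrightarrow> q \<in> A.G \<Longrightarrow> q \<in> snd u \<longleftrightarrow> \<phi> q \<in> snd (F u)"
    and \<gamma>: "\<gamma> \<in> standard_geodesics \<Gamma>"
  shows "\<exists>\<gamma>' \<in> standard_geodesics \<Gamma>'. verts \<gamma>' = \<phi> ` verts \<gamma>"
proof -
  obtain p a where p: "p \<in> A.G" "a \<in> A.V" "\<gamma> = A.line p a" using \<gamma> by (rule A.standard_geodesicE)
  define u where "u = A.par_class p a"
  have u: "u \<in> A.ext_verts" "p \<in> snd u" using p by (auto simp: u_def)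
  \<comment> \<open>No map of labels is given; the label of the image line is read off
    \<open>F u\<close>.\<close>
  define a' where "a' = fst (F u)"
  have "\<phi> p \<in> snd (F u)" using iff[OF u(1) p(1)] u by blast
  from B.ext_verts_at[OF F_in[OF u(1)] this]
  have p': "\<phi> p \<in> B.G" "a' \<in> B.V" "F u = B.par_class (\<phi> p) a'" by (simp_all add: a'_def)
  have *: "(\<forall>b \<in> A.lk a. q \<in> A.coset (A.st b) p) \<longleftrightarrow> (\<forall>b \<in> B.lk a'. \<phi> q \<in> B.coset (B.st b) (\<phi> p))"
    if q: "q \<in> A.G" for q
  proof
    assume l: "\<forall>b \<in> A.lk a. q \<in> A.coset (A.st b) p"
    show "\<forall>b \<in> B.lk a'. \<phi> q \<in> B.coset (B.st b) (\<phi> p)"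
    proof
      fix b assume b: "b \<in> B.lk a'"
      then have "B.ext_adj (F u) (B.par_class (\<phi> p) b)" "B.par_class (\<phi> p) b \<in> B.ext_verts"
        using B.ext_adj_cl[OF p'(1) b] p' B.lkD(2)[OF b] by simp_all
      then obtain w where w: "w \<in> A.ext_verts" "F w = B.par_class (\<phi> p) b"
        using bij_betw_imp_surj_on[OF bij] by (metis imageE)
      have "A.ext_adj u w" using adj[OF u(1) w(1)] w \<open>B.ext_adj (F u) (B.par_class (\<phi> p) b)\<close> by simp
      then have c: "fst w \<in> A.lk a" using A.ext_adj_fst by (fastforce simp: u_def)
      have "p \<in> snd w" using iff[OF w(1) p(1)] w p' by simp
      then have "w = A.par_class p (fst w)" using A.ext_verts_at(3)[OF w(1)] by blast
      then have "q \<in> snd w" using l c by (metis A.par_class_simps(2))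
      then show "\<phi> q \<in> B.coset (B.st b) (\<phi> p)" using iff[OF w(1) q] w by simp
    qed
  next
    assume r: "\<forall>b \<in> B.lk a'. \<phi> q \<in> B.coset (B.st b) (\<phi> p)"
    show "\<forall>b \<in> A.lk a. q \<in> A.coset (A.st b) p"
    proof
      fix b assume b: "b \<in> A.lk a"
      define w where "w = A.par_class p b"
      have w: "w \<in> A.ext_verts" "A.ext_adj u w" using A.ext_adj_cl[OF p(1) b] A.ext_adj_EV by (auto simp: u_def w_def)
      then have c: "fst (F w) \<in> B.lk a'" using adj[OF u(1) w(1)] B.ext_adj_fst by (simp add: a'_def)
      have "p \<in> snd w" using p by (simp add: w_def)
      then have "\<phi> p \<in> snd (F w)" using iff[OF w(1) p(1)] by blast
      then have "F w = B.par_class (\<phi> p) (fst (F w))" using B.ext_verts_at(3)[OF F_in[OF w(1)]] by blast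
      then have "\<phi> q \<in> snd (F w)" using r c by (metis B.par_class_simps(2))
      then show "q \<in> A.coset (A.st b) p" using iff[OF w(1) q] by (simp add: w_def)
    qed
  qed
  have "verts (B.line (\<phi> p) a') = {y \<in> B.G. \<forall>b \<in> B.lk a'. y \<in> B.coset (B.st b) (\<phi> p)}"
    using B.verts_line[OF p'(1,2)] B.coset_vertex[OF p'(1,2)] by simp
  also have "\<dots> = \<phi> ` {q \<in> A.G. \<forall>b \<in> A.lk a. q \<in> A.coset (A.st b) p}"
  proof
    show "{y \<in> B.G. \<forall>b \<in> B.lk a'. y \<in> B.coset (B.st b) (\<phi> p)}
        \<subseteq> \<phi> ` {q \<in> A.G. \<forall>b \<in> A.lk a. q \<in> A.coset (A.st b) p}"
    proof
      fix y assume y: "y \<in> {y \<in> B.G. \<forall>b \<in> B.lk a'. y \<in> B.coset (B.st b) (\<phi> p)}"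
      then obtain q where "q \<in> A.G" "y = \<phi> q" using bij_betw_imp_surj_on[OF \<phi>] by blast
      then show "y \<in> \<phi> ` {q \<in> A.G. \<forall>b \<in> A.lk a. q \<in> A.coset (A.st b) p}" using * y by blast
    qed
  qed (use * bij_betwE[OF \<phi>] in blast)
  also have "\<dots> = \<phi> ` verts \<gamma>" using A.verts_line[OF p(1,2)] A.coset_vertex[OF p(1,2)] p(3) by simp
  finally show ?thesis using p' by (intro bexI[of _ "B.line (\<phi> p) a'"]) (auto simp: B.standard_geodesics_eq)
qed

lemma (in extension_graph_iso) line_bijection:
  assumes \<phi>: "bij_betw \<phi> A.G B.G"
    and iff: "\<And>u q. u \<in> A.ext_verts \<Longrightarrow> q \<in> A.G \<Longrightarrow> q \<in> snd u \<longleftrightarrow> \<phi> q \<in> snd (F u)"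
  shows "\<exists>\<psi>. bij_betw \<psi> (standard_geodesics \<Gamma>) (standard_geodesics \<Gamma>') \<and>
    (\<forall>\<gamma> \<in> standard_geodesics \<Gamma>. verts (\<psi> \<gamma>) = \<phi> ` verts \<gamma>)"
proof -
  interpret I: extension_graph_iso \<Gamma>' \<Gamma> "inv_into A.ext_verts F" by (rule inverse)
  let ?\<phi>' = "inv_into A.G \<phi>"
  have \<phi>': "bij_betw ?\<phi>' B.G A.G" using \<phi> by (rule bij_betw_inv_into)
  have iff': "q \<in> snd u \<longleftrightarrow> ?\<phi>' q \<in> snd (inv_into A.ext_verts F u)" if "u \<in> B.ext_verts" "q \<in> B.G" for u q
  proof -
    have "\<phi> (?\<phi>' q) = q" "F (inv_into A.ext_verts F u) = u"
      using bij_betw_inv_into_right \<phi> bij that by metis+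
    moreover have "?\<phi>' q \<in> A.G" using bij_betwE[OF \<phi>'] that by blast
    ultimately show ?thesis using iff[of "inv_into A.ext_verts F u" "?\<phi>' q"] I.F_in[OF that(1)] by simp
  qed
  obtain \<psi> where \<psi>: "\<And>\<gamma>. \<gamma> \<in> standard_geodesics \<Gamma> \<Longrightarrow>
      \<psi> \<gamma> \<in> standard_geodesics \<Gamma>' \<and> verts (\<psi> \<gamma>) = \<phi> ` verts \<gamma>"
    using line_image[OF \<phi> iff] by metis
  have inj: "inj_on \<phi> A.G" using \<phi> by (simp add: bij_betw_def)
  have "inj_on \<psi> (standard_geodesics \<Gamma>)"
  proof
    fix x y assume xy: "x \<in> standard_geodesics \<Gamma>" "y \<in> standard_geodesics \<Gamma>" "\<psi> x = \<psi> y"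
    have "\<phi> ` verts x = \<phi> ` verts y" using \<psi> xy by metis
    moreover have "verts x \<subseteq> A.G" "verts y \<subseteq> A.G" using A.verts_in_raag xy by blast+
    ultimately have "verts x = verts y" using inj_on_image_eq_iff[OF inj, of "verts x" "verts y"] by simp
    then show "x = y" using A.geodesics_determined xy by blast
  qed
  moreover have "\<gamma>' \<in> \<psi> ` standard_geodesics \<Gamma>" if \<gamma>': "\<gamma>' \<in> standard_geodesics \<Gamma>'" for \<gamma>'
  proof -
    obtain \<gamma> where \<gamma>: "\<gamma> \<in> standard_geodesics \<Gamma>" "verts \<gamma> = ?\<phi>' ` verts \<gamma>'"
      using I.line_image[OF \<phi>' iff' \<gamma>'] by blast
    have sub: "verts \<gamma>' \<subseteq> B.G" using B.verts_in_raag \<gamma>' by blast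
    have "verts (\<psi> \<gamma>) = \<phi> ` ?\<phi>' ` verts \<gamma>'" using \<psi>[OF \<gamma>(1)] \<gamma>(2) by simp
    also have "\<dots> = verts \<gamma>'"
      using sub bij_betw_imp_surj_on[OF \<phi>] by (metis image_inv_into_cancel)
    finally have "\<psi> \<gamma> = \<gamma>'" using B.geodesics_determined \<psi>[OF \<gamma>(1)] \<gamma>' by blast
    then show ?thesis using \<gamma>(1) by blast
  qed
  ultimately show ?thesis using \<psi> unfolding bij_betw_def by blast
qed

theorem theorem1p14:
  fixes \<Gamma> :: "'v sgraph" and \<Gamma>' :: "'w sgraph"
    and f :: "'v kpoint set \<Rightarrow> 'w kpoint set"
  assumes "atomic \<Gamma>" and "atomic \<Gamma>'"
    and "bij_betw f (standard_flats \<Gamma>) (standard_flats \<Gamma>')"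
    and "\<And>F\<^sub>1 F\<^sub>2. F\<^sub>1 \<in> standard_flats \<Gamma> \<Longrightarrow> F\<^sub>2 \<in> standard_flats \<Gamma> \<Longrightarrow>
           intersect_coarsely_in_geodesic \<Gamma> F\<^sub>1 F\<^sub>2
             \<longleftrightarrow> intersect_coarsely_in_geodesic \<Gamma>' (f F\<^sub>1) (f F\<^sub>2)"
  shows "\<exists>\<phi>. complex_isometry (flat_space \<Gamma>) (flat_space \<Gamma>') \<phi> \<and>
           (\<forall>F \<in> standard_flats \<Gamma>. \<phi> (vertex_pt (Flat F)) = vertex_pt (Flat (f F)))"
proof -
  interpret A: atomic_graph \<Gamma> by unfold_locales fact
  interpret B: atomic_graph \<Gamma>' by unfold_locales fact
  have fin: "f e \<in> standard_flats \<Gamma>'" if "e \<in> standard_flats \<Gamma>" for e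
    using bij_betwE[OF assms(3)] that by blast
  have finj: "inj_on f (standard_flats \<Gamma>)" using assms(3) by (simp add: bij_betw_def)
  \<comment> \<open>The coarse relation excludes equality, so for distinct flats it says that some
    class is incident to both.\<close>
  interpret L: line_graph_iso A.ext_verts "standard_flats \<Gamma>" A.inc B.ext_verts "standard_flats \<Gamma>'" B.inc f
  proof
    show "bij_betw f (standard_flats \<Gamma>) (standard_flats \<Gamma>')" by fact
    fix e1 e2 assume e: "e1 \<in> standard_flats \<Gamma>" "e2 \<in> standard_flats \<Gamma>" "e1 \<noteq> e2"
    then have "f e1 \<noteq> f e2" using finj by (auto simp: inj_on_def)
    then show "(\<exists>u \<in> A.ext_verts. A.inc u e1 \<and> A.inc u e2) \<longleftrightarrow> (\<exists>u \<in> B.ext_verts. B.inc u (f e1) \<and> B.inc u (f e2))"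
      using A.intersect_coarsely_iff[OF e(1,2)] B.intersect_coarsely_iff[OF fin[OF e(1)] fin[OF e(2)]]
        assms(4)[OF e(1,2)] e(3) by simp
  qed
  obtain F where F: "bij_betw F A.ext_verts B.ext_verts"
    "\<And>u e. u \<in> A.ext_verts \<Longrightarrow> e \<in> standard_flats \<Gamma> \<Longrightarrow> A.inc u e \<longleftrightarrow> B.inc (F u) (f e)"
    using L.vertex_bijection by blast
  have Fin: "F u \<in> B.ext_verts" if "u \<in> A.ext_verts" for u using bij_betwE[OF F(1)] that by blast
  have Fne: "F u \<noteq> F w \<longleftrightarrow> u \<noteq> w" if "u \<in> A.ext_verts" "w \<in> A.ext_verts" for u w
    using F(1) that by (auto simp: bij_betw_def inj_on_def)
  interpret E: extension_graph_iso \<Gamma> \<Gamma>' F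
  proof
    show "bij_betw F A.ext_verts B.ext_verts" by fact
    fix u w assume uw: "u \<in> A.ext_verts" "w \<in> A.ext_verts"
    have "(\<exists>e \<in> standard_flats \<Gamma>. A.inc u e \<and> A.inc w e)
        \<longleftrightarrow> (\<exists>e \<in> f ` standard_flats \<Gamma>. B.inc (F u) e \<and> B.inc (F w) e)"
      using F(2) uw by auto
    then show "A.ext_adj u w \<longleftrightarrow> B.ext_adj (F u) (F w)"
      using A.ext_adj_iff_flat[OF uw] B.ext_adj_iff_flat[OF Fin[OF uw(1)] Fin[OF uw(2)]] Fne[OF uw]
        bij_betw_imp_surj_on[OF assms(3)] by simp
  qed
  obtain \<phi> where \<phi>: "bij_betw \<phi> A.G B.G"
    "\<And>u q. u \<in> A.ext_verts \<Longrightarrow> q \<in> A.G \<Longrightarrow> q \<in> snd u \<longleftrightarrow> \<phi> q \<in> snd (F u)"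
    using E.vertex_bijection by blast
  obtain \<psi> where \<psi>: "bij_betw \<psi> (standard_geodesics \<Gamma>) (standard_geodesics \<Gamma>')"
    "\<And>\<gamma>. \<gamma> \<in> standard_geodesics \<Gamma> \<Longrightarrow> verts (\<psi> \<gamma>) = \<phi> ` verts \<gamma>"
    using E.line_bijection[OF \<phi>] by blast
  \<comment> \<open>The map \<phi> was obtained from \<open>F\<close>; compatibility with the given
    \<open>f\<close> is checked here. The vertices of a flat are the intersection of the parallel
    sets of its two classes, and \<open>F\<close> maps these to the classes of the image
    flat.\<close>
  have vf: "verts (f e) = \<phi> ` verts e" if e: "e \<in> standard_flats \<Gamma>" for e
  proof -
    obtain g a b where g: "g \<in> A.G" "b \<in> A.lk a" "e = A.flat g a b" using e by (rule A.standard_flatE)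
    define u w where "u = A.par_class g a" and "w = A.par_class g b"
    have V: "a \<in> A.V" "b \<in> A.V" "a \<noteq> b" using A.lkD[OF g(2)] by auto
    have ne: "u \<noteq> w" using V by (simp add: u_def w_def A.par_class_def)
    have "u \<in> A.ext_verts" "w \<in> A.ext_verts" using g V by (simp_all add: u_def w_def)
    note uw = this ne
    have i: "A.inc u e" "A.inc w e" using A.inc_flat[OF g(1,2)] uw g(3) by (auto simp: u_def w_def)
    have "verts (f e) = snd (F u) \<inter> snd (F w)"
      using B.verts_flat_ends[OF fin[OF e] Fin[OF uw(1)] Fin[OF uw(2)]] F(2)[OF _ e] uw i Fne by blast
    moreover have "verts e = snd u \<inter> snd w" using A.verts_flat_ends[OF e uw i] .
    moreover have "y \<in> \<phi> ` (snd u \<inter> snd w)" if y: "y \<in> snd (F u) \<inter> snd (F w)" for y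
    proof -
      have "y \<in> B.G" using B.ext_verts_at(1)[OF Fin[OF uw(1)]] y by blast
      then obtain q where "q \<in> A.G" "y = \<phi> q" using bij_betw_imp_surj_on[OF \<phi>(1)] by blast
      then show ?thesis using \<phi>(2) uw y by blast
    qed
    moreover have "\<phi> q \<in> snd (F u) \<inter> snd (F w)" if q: "q \<in> snd u \<inter> snd w" for q
      using A.ext_verts_at(1)[OF uw(1)] \<phi>(2) uw q by blast
    ultimately show ?thesis by blast
  qed
  define \<phi>' \<psi>' f' where "\<phi>' = inv_into A.G \<phi>" and "\<psi>' = inv_into (standard_geodesics \<Gamma>) \<psi>"
    and "f' = inv_into (standard_flats \<Gamma>) f"
  have bij': "bij_betw \<phi>' B.G A.G" "bij_betw \<psi>' (standard_geodesics \<Gamma>') (standard_geodesics \<Gamma>)"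
    "bij_betw f' (standard_flats \<Gamma>') (standard_flats \<Gamma>)"
    unfolding \<phi>'_def \<psi>'_def f'_def using \<phi>(1) \<psi>(1) assms(3) by (auto intro: bij_betw_inv_into)
  have right: "p \<in> B.G \<Longrightarrow> \<phi> (\<phi>' p) = p" "\<gamma> \<in> standard_geodesics \<Gamma>' \<Longrightarrow> \<psi> (\<psi>' \<gamma>) = \<gamma>"
    "e \<in> standard_flats \<Gamma>' \<Longrightarrow> f (f' e) = e" for p \<gamma> e
    unfolding \<phi>'_def \<psi>'_def f'_def
    using bij_betw_inv_into_right[OF \<phi>(1)] bij_betw_inv_into_right[OF \<psi>(1)]
      bij_betw_inv_into_right[OF assms(3)] by auto
  have left: "p \<in> A.G \<Longrightarrow> \<phi>' (\<phi> p) = p" "\<gamma> \<in> standard_geodesics \<Gamma> \<Longrightarrow> \<psi>' (\<psi> \<gamma>) = \<gamma>"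
    "e \<in> standard_flats \<Gamma> \<Longrightarrow> f' (f e) = e" for p \<gamma> e
    unfolding \<phi>'_def \<psi>'_def f'_def
    using bij_betw_inv_into_left[OF \<phi>(1)] bij_betw_inv_into_left[OF \<psi>(1)]
      bij_betw_inv_into_left[OF assms(3)] by auto
  have invert: "S = \<phi>' ` \<phi> ` S" if "S \<subseteq> A.G" for S using that left(1) by (force simp: image_image)
  have vf': "verts (f' e) = \<phi>' ` verts e" if e: "e \<in> standard_flats \<Gamma>'" for e
  proof -
    have fe: "f' e \<in> standard_flats \<Gamma>" using bij_betwE[OF bij'(3)] e by blast
    have "verts (f' e) = \<phi>' ` \<phi> ` verts (f' e)" using invert A.verts_in_raag fe by blast
    then show ?thesis using vf[OF fe] right(3)[OF e] by simp
  qed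
  have v\<psi>': "verts (\<psi>' \<gamma>) = \<phi>' ` verts \<gamma>" if \<gamma>: "\<gamma> \<in> standard_geodesics \<Gamma>'" for \<gamma>
  proof -
    have g: "\<psi>' \<gamma> \<in> standard_geodesics \<Gamma>" using bij_betwE[OF bij'(2)] \<gamma> by blast
    have "verts (\<psi>' \<gamma>) = \<phi>' ` \<phi> ` verts (\<psi>' \<gamma>)" using invert A.verts_in_raag g by blast
    then show ?thesis using \<psi>(2)[OF g] right(2)[OF \<gamma>] by simp
  qed
  let ?\<Phi> = "flat_space_map \<phi> \<psi> f" and ?\<Psi> = "flat_space_map \<phi>' \<psi>' f'"
  have 1: "complex_embedding (flat_space \<Gamma>) (flat_space \<Gamma>') ?\<Phi>"
    by (rule flat_space_embedding[OF assms(1,2)])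
      (use \<phi>(1) \<psi> finj fin vf in \<open>auto simp: bij_betw_def\<close>)
  have 2: "complex_embedding (flat_space \<Gamma>') (flat_space \<Gamma>) ?\<Psi>"
    by (rule flat_space_embedding[OF assms(2,1)])
      (use bij' vf' v\<psi>' in \<open>auto simp: bij_betw_def\<close>)
  have "complex_isometry (flat_space \<Gamma>) (flat_space \<Gamma>') (push ?\<Phi> (cverts (flat_space \<Gamma>)))"
    by (rule complex_isomorphism_isometry[OF 1 2]) (use left right in \<open>auto simp: flat_space_def\<close>)
  moreover have "push ?\<Phi> (cverts (flat_space \<Gamma>)) (vertex_pt (Flat e)) = vertex_pt (Flat (f e))"
    if "e \<in> standard_flats \<Gamma>" for e
    using complex_embedding.push_vertex[OF 1, of "Flat e"] that by (simp add: flat_space_def)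
  ultimately show ?thesis by blast
qed

end
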